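(* Let $V$ be a quantum VOA. For any $\mathbf v,\mathbf w\in V$ and any integer $n$ there exists a unique $\mathbf y_n\in V$ such that for all $\mathbf u\in V$ $$\mathrm{Res}_{z=w}\,(z-w)^n\,Y(z)(1\otimes Y(w))(\mathbf v\otimes\mathbf w\otimes\mathbf u)=Y(w)(\mathbf y_n\otimes\mathbf u).$$
   Context: $k$ is a field of characteristic $0$, $h$ a formal parameter, tensor products are $h$-adically completed. For a topologically free $k[[h]]$-module $V$, $V((z))=\{\sum_{n\in\mathbb Z}v_nz^n:\ v_n\to0\ h\text{-adically as }n\to-\infty\}$. Superscripts indicate tensor factors on which an operator acts; $\mathcal S^{21}=\sigma\mathcal S\sigma$ with $\sigma$ the flip. A braided VOA over $k[[h]]$ is: a topologically free $k[[h]]$-module $V$; a linear map $Y:V\otimes V\to V((z))$, $\mathbf v\otimes\mathbf w\mapsto Y(z)(\mathbf v\otimes\mathbf w)=Y(\mathbf v,z)\mathbf w$; a linear operator $T:V\to V$; a vector $\Omega\in V$; a linear map $\mathcal S(z):V\otimes V\to V\otimes V\otimes k((z))$ with $\mathcal S=1+O(h)$, satisfying the shift condition $[T\otimes1,\mathcal S(z)]=-\frac{d\mathcal S}{dz}$, the quantum Yang–Baxter equation $\mathcal S^{12}(z)\mathcal S^{13}(z+w)\mathcal S^{23}(w)=\mathcal S^{23}(w)\mathcal S^{13}(z+w)\mathcal S^{12}(z)$ and unitarity $\mathcal S^{21}(z)=\mathcal S^{-1}(-z)$; subject to: (QA1) for any $\mathbf v,\mathbf w\in V$ and any natural $M$ there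 is $N\ge0$ such that for any $\mathbf u\in V$, $(z_1-z_2)^NY(z_1)(1\otimes Y(z_2))(\mathcal S(z_1-z_2)(\mathbf v\otimes\mathbf w)\otimes\mathbf u)$ coincides with $(z_1-z_2)^NY(z_2)(1\otimes Y(z_1))(\mathbf w\otimes\mathbf v\otimes\mathbf u)$ modulo $h^M$; (QA2) $T\Omega=0$ and $\frac{d}{dz}Y(z)=TY(z)-Y(z)(1\otimes T)$; (QA3) $Y(z)(\Omega\otimes\mathbf v)=\mathbf v$ for all $\mathbf v$; $Y(z)(\mathbf v\otimes\Omega)$ is regular at $z=0$ and its value there is $\mathbf v$. A quantum VOA is a braided VOA satisfying (QA4) $\mathcal S(w)(Y(u)\otimes1)=(Y(u)\otimes1)\mathcal S^{23}(w)\mathcal S^{13}(u+w)$ (matrix elements coincide in $k((w))((u))[[h]]$). Meaning of $\mathrm{Res}_{z=w}$: modulo any power $h^M$, after multiplication by a suitable power $z^{N}$ and re-expansion ($Y(z)=\sum_mY^{(m)}(z-w)w^m/m!$), the series $z^NY(z)(1\otimes Y(w))(\mathbf v\otimes\mathbf w\otimes\mathbf u)$ becomes a Laurent series in $z-w$ with coefficients in $V((w))$; one then divides by $z^N=(w+(z-w))^N$ expanding in nonnegative powers of $z-w$, and $\mathrm{Res}_{z=w}(z-w)^n(\cdot)$ is the coefficient of $(z-w)^{-n-1}$ of the resulting series. *)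

theory Defs
  imports
    "HOL-Computational_Algebra.Computational_Algebra"
    "HOL-Library.Poly_Mapping"
begin

text \<open>
  Conventions. \<open>k\<close> is a type of class \<^class>\<open>field_char_0\<close>, \<open>k[[h]]\<close> is \<open>'k fps\<close> (so \<open>h\<close> is
  \<^const>\<open>fps_X\<close>) and \<open>k((z))\<close> is \<open>'k fls\<close>. In \<open>'k fls fls\<close> the outer variable is the second one:
  \<open>k((w))((u))\<close> is \<open>'k fls fls\<close> with \<open>u\<close> the outer variable and \<open>w\<close> the variable of the
  coefficients. An element of \<open>V((z))\<close> is its coefficient family \<open>int \<Rightarrow> 'v\<close>, and a series in two
  variables \<open>z1, z2\<close> is a family \<open>A p q\<close>, the coefficient of \<open>z1^p z2^q\<close>.
\<close>


section \<open>Laurent series in several variables\<close>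

text \<open>\<open>fls_outer f\<close> is \<open>f(u)\<close> in \<open>k((w))((u))\<close>; \<open>f(w)\<close> is \<open>fls_const f\<close>.\<close>

definition fls_outer :: "'k::zero fls \<Rightarrow> 'k fls fls" where
  "fls_outer f = Abs_fls (\<lambda>n. fls_const (fls_nth f n))"

text \<open>\<open>fls_taylor s f\<close> is \<open>f(w + s u)\<close>, expanded in nonnegative powers of \<open>u\<close>.\<close>

definition fls_taylor :: "'k::field_char_0 \<Rightarrow> 'k fls \<Rightarrow> 'k fls fls" where
  "fls_taylor s f =
     fps_to_fls (Abs_fps (\<lambda>m. fls_const (s ^ m / fact m) * (fls_deriv ^^ m) f))"

text \<open>\<open>fls_reflect f\<close> is \<open>f(-z)\<close>.\<close>

definition fls_reflect :: "'k::field fls \<Rightarrow> 'k fls" where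
  "fls_reflect f = fls_compose_fps f (- fps_X)"


section \<open>Formal sums of pure tensors\<close>

text \<open>
  An element of the free abelian group on pairs \<open>(vs, c)\<close>, where \<open>vs = [v1, ..., vn]\<close> and \<open>c\<close> lies
  in a \<open>k\<close>-algebra \<open>C\<close> of functions (\<open>k((z))\<close> or \<open>k((w))((u))\<close>), stands for a finite sum of pure
  tensors \<open>v1 \<otimes> ... \<otimes> vn \<otimes> c\<close>.
\<close>

type_synonym ('v, 'c) fsum = "('v list \<times> 'c) \<Rightarrow>\<^sub>0 int"

definition on_slot :: "nat \<Rightarrow> ('v \<Rightarrow> 'v) \<Rightarrow> ('v, 'c) fsum \<Rightarrow> ('v, 'c) fsum" where
  "on_slot i g = frag_extend (\<lambda>(vs, c). frag_of (vs[i := g (vs ! i)], c))"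

definition on_coeff :: "('c \<Rightarrow> 'd) \<Rightarrow> ('v, 'c) fsum \<Rightarrow> ('v, 'd) fsum" where
  "on_coeff g = frag_extend (\<lambda>(vs, c). frag_of (vs, g c))"

text \<open>
  An element \<open>X\<close> of an \<open>h\<close>-adically completed tensor product is given by its residue classes
  \<open>X M\<close> modulo \<open>h^M\<close>, each being a coset of formal sums (see \<open>completed_tensor\<close> below). All
  operations used below descend to residue classes, so the choice made here is immaterial.
\<close>

definition rep :: "(nat \<Rightarrow> ('v, 'c) fsum set) \<Rightarrow> nat \<Rightarrow> ('v, 'c) fsum" where
  "rep X M = (SOME x. x \<in> X M)"

text \<open>
  \<open>act S e M i j\<close> is \<open>S^(i+1,j+1)\<close> modulo \<open>h^M\<close>: for \<open>S(a \<otimes> b) = \<Sum> a' \<otimes> b' \<otimes> f\<close> with \<open>a, b\<close> in the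
  slots \<open>i, j\<close> (counted from 0), it puts \<open>a', b'\<close> into the slots \<open>i, j\<close> and multiplies the
  coefficient by \<open>e f\<close>. The map \<open>e\<close> determines at which argument \<open>S\<close> is taken. For \<open>i = 1, j = 0\<close>
  this is \<open>S^21 = \<sigma> S \<sigma>\<close>.
\<close>

definition act ::
    "('v \<Rightarrow> 'v \<Rightarrow> nat \<Rightarrow> ('v, 'k fls) fsum set) \<Rightarrow> ('k fls \<Rightarrow> 'c::comm_ring_1) \<Rightarrow>
      nat \<Rightarrow> nat \<Rightarrow> nat \<Rightarrow> ('v, 'c) fsum \<Rightarrow> ('v, 'c) fsum" where
  "act S e M i j =
     frag_extend (\<lambda>(vs, c).
       frag_extend (\<lambda>(us, f). frag_of (vs[i := us ! 0, j := us ! 1], c * e f))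
         (rep (S (vs ! i) (vs ! j)) M))"


section \<open>Topologically free modules and their completed tensor powers\<close>

text \<open>
  \<open>V\<close> is isomorphic, as a \<open>k[[h]]\<close>-module, to \<open>V0[[h]]\<close> for a \<open>k\<close>-vector space \<open>V0\<close>. Since
  \<open>V0\<close> embeds \<open>k\<close>-linearly into \<open>V0[[h]]\<close>, there is no loss in letting \<open>V0\<close> range over the
  \<open>k\<close>-subspaces of \<open>V\<close>.
\<close>

locale topologically_free = module scale
  for scale :: "'k::field_char_0 fps \<Rightarrow> 'v::ab_group_add \<Rightarrow> 'v" (infixr "*s" 75) +
  assumes iso_power_series:
    "\<exists>(V0 :: 'v set) (\<phi> :: 'v \<Rightarrow> nat \<Rightarrow> 'v).
        0 \<in> V0 \<and> (\<forall>x\<in>V0. \<forall>y\<in>V0. x + y \<in> V0) \<and> (\<forall>c. \<forall>x\<in>V0. fps_const c *s x \<in> V0) \<and>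
        bij_betw \<phi> UNIV {a. \<forall>n. a n \<in> V0} \<and>
        (\<forall>x y n. \<phi> (x + y) n = \<phi> x n + \<phi> y n) \<and>
        (\<forall>f x n. \<phi> (f *s x) n = (\<Sum>i\<le>n. fps_const (fps_nth f i) *s \<phi> x (n - i)))"
begin

definition hdvd :: "nat \<Rightarrow> 'v \<Rightarrow> bool" where
  "hdvd M x \<longleftrightarrow> (\<exists>y. x = fps_X ^ M *s y)"

text \<open>Membership in \<open>V((z))\<close>.\<close>

definition laurent :: "(int \<Rightarrow> 'v) \<Rightarrow> bool" where
  "laurent a \<longleftrightarrow> (\<forall>M. \<exists>n0. \<forall>n<n0. hdvd M (a n))"

text \<open>
  The sum, modulo \<open>h^M\<close>, of a family almost all of whose members are divisible by \<open>h^M\<close>.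
\<close>

definition sum_mod :: "nat \<Rightarrow> ('i \<Rightarrow> 'v) \<Rightarrow> 'v" where
  "sum_mod M a = (\<Sum>i | \<not> hdvd M (a i). a i)"

text \<open>
  The subgroup of relations defining \<open>(V \<otimes> ... \<otimes> V) \<otimes> C\<close> modulo \<open>h^M\<close>, with \<open>n\<close> factors \<open>V\<close> over
  \<open>k[[h]]\<close> and the last tensor product over \<open>k\<close>; \<open>\<iota>\<close> is the inclusion of \<open>k\<close> into \<open>C\<close>.
\<close>

inductive_set tensor_rel :: "('k \<Rightarrow> 'c::comm_ring_1) \<Rightarrow> nat \<Rightarrow> nat \<Rightarrow> ('v, 'c) fsum set"
  for \<iota> :: "'k \<Rightarrow> 'c::comm_ring_1" and n :: nat and M :: nat where
  zero: "0 \<in> tensor_rel \<iota> n M"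
| diff: "x \<in> tensor_rel \<iota> n M \<Longrightarrow> y \<in> tensor_rel \<iota> n M \<Longrightarrow> x - y \<in> tensor_rel \<iota> n M"
| add_slot: "length vs = n \<Longrightarrow> i < n \<Longrightarrow>
    frag_of (vs[i := a + b], c) - frag_of (vs[i := a], c) - frag_of (vs[i := b], c)
      \<in> tensor_rel \<iota> n M"
| add_coeff: "length vs = n \<Longrightarrow>
    frag_of (vs, c + d) - frag_of (vs, c) - frag_of (vs, d) \<in> tensor_rel \<iota> n M"
| balance_slots: "length vs = n \<Longrightarrow> i < n \<Longrightarrow> j < n \<Longrightarrow>
    frag_of (vs[i := r *s (vs ! i)], c) - frag_of (vs[j := r *s (vs ! j)], c)
      \<in> tensor_rel \<iota> n M"
| balance_coeff: "length vs = n \<Longrightarrow> i < n \<Longrightarrow>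
    frag_of (vs[i := fps_const s *s (vs ! i)], c) - frag_of (vs, \<iota> s * c) \<in> tensor_rel \<iota> n M"
| hpower: "length vs = n \<Longrightarrow> i < n \<Longrightarrow>
    frag_of (vs[i := fps_X ^ M *s a], c) \<in> tensor_rel \<iota> n M"

definition tensor_eq ::
    "('k \<Rightarrow> 'c::comm_ring_1) \<Rightarrow> nat \<Rightarrow> nat \<Rightarrow> ('v, 'c) fsum \<Rightarrow> ('v, 'c) fsum \<Rightarrow> bool" where
  "tensor_eq \<iota> n M x y \<longleftrightarrow> x - y \<in> tensor_rel \<iota> n M"

abbreviation tensor_eq1 :: "nat \<Rightarrow> nat \<Rightarrow> ('v, 'k fls) fsum \<Rightarrow> ('v, 'k fls) fsum \<Rightarrow> bool" where
  "tensor_eq1 \<equiv> tensor_eq fls_const"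

abbreviation tensor_eq2 ::
    "nat \<Rightarrow> nat \<Rightarrow> ('v, 'k fls fls) fsum \<Rightarrow> ('v, 'k fls fls) fsum \<Rightarrow> bool" where
  "tensor_eq2 \<equiv> tensor_eq (\<lambda>s. fls_const (fls_const s))"

text \<open>
  The completed tensor product, as the inverse limit over \<open>M\<close> of the quotients modulo \<open>h^M\<close>. As
  classes modulo \<open>h^(M+1)\<close> are contained in classes modulo \<open>h^M\<close>, compatibility is inclusion.
\<close>

definition completed_tensor ::
    "('k \<Rightarrow> 'c::comm_ring_1) \<Rightarrow> nat \<Rightarrow> (nat \<Rightarrow> ('v, 'c) fsum set) set" where
  "completed_tensor \<iota> n =
     {X. \<forall>M. X (Suc M) \<subseteq> X M \<and>
        (\<exists>x. (\<forall>(vs, c) \<in> Poly_Mapping.keys x. length vs = n) \<and>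
             X M = {y. tensor_eq \<iota> n M y x})}"

text \<open>The additive extension to formal sums of a \<open>V\<close>-valued function on pure tensors.\<close>

definition fsum_apply :: "('v list \<times> 'c \<Rightarrow> 'v) \<Rightarrow> ('v, 'c) fsum \<Rightarrow> 'v" where
  "fsum_apply F x =
     (\<Sum>t\<in>Poly_Mapping.keys x. of_int (Poly_Mapping.lookup x t) *s F t)"

text \<open>
  Product modulo \<open>h^M\<close> of \<open>g\<close> in \<open>k((z1))((z2))\<close> with a \<open>V\<close>-valued series \<open>A\<close> in \<open>z1, z2\<close>.
\<close>

definition series_mult :: "nat \<Rightarrow> 'k fls fls \<Rightarrow> (int \<Rightarrow> int \<Rightarrow> 'v) \<Rightarrow> int \<Rightarrow> int \<Rightarrow> 'v" where
  "series_mult M g A p q =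
     sum_mod M (\<lambda>(i, j). fps_const (fls_nth (fls_nth g j) i) *s A (p - i) (q - j))"


section \<open>The residue at \<open>z = w\<close>\<close>

text \<open>
  Below \<open>A\<close> is a series in \<open>z, w\<close> and \<open>x = z - w\<close>. \<open>reexpand M N A i j\<close> is the coefficient of
  \<open>x^i w^j\<close>, modulo \<open>h^M\<close>, in \<open>z^N A\<close> after the substitution
  \<open>z^p = (x + w)^p = \<Sum>m. (p choose m) x^(p-m) w^m\<close>.
\<close>

definition reexpand :: "nat \<Rightarrow> nat \<Rightarrow> (int \<Rightarrow> int \<Rightarrow> 'v) \<Rightarrow> int \<Rightarrow> int \<Rightarrow> 'v" where
  "reexpand M N A i j =
     sum_mod M (\<lambda>m::nat. fps_const (of_int (i + int m) gchoose m) *s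
                           A (i + int m - int N) (j - int m))"

text \<open>
  Modulo \<open>h^M\<close>, the re-expansion of \<open>z^N A\<close> is a Laurent series in \<open>x\<close> with coefficients in
  \<open>V((w))\<close>.
\<close>

definition suitable :: "nat \<Rightarrow> nat \<Rightarrow> (int \<Rightarrow> int \<Rightarrow> 'v) \<Rightarrow> bool" where
  "suitable M N A \<longleftrightarrow>
     (\<exists>i0. \<forall>i<i0. \<forall>j. hdvd M (reexpand M N A i j)) \<and>
     (\<forall>i. \<exists>j0. \<forall>j<j0. hdvd M (reexpand M N A i j))"

text \<open>
  The coefficient of \<open>x^(-n-1) w^j\<close> in the product of this series with
  \<open>(w + x)^(-N) = \<Sum>m. (-N choose m) w^(-N-m) x^m\<close>.
\<close>

definition residue_coeff :: "nat \<Rightarrow> nat \<Rightarrow> int \<Rightarrow> (int \<Rightarrow> int \<Rightarrow> 'v) \<Rightarrow> int \<Rightarrow> 'v" where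
  "residue_coeff M N n A j =
     sum_mod M (\<lambda>m::nat. fps_const ((- of_nat N) gchoose m) *s
                           reexpand M N A (- n - 1 - int m) (j + int N + int m))"

text \<open>
  \<open>has_residue n A r\<close>: \<open>Res_{z=w} (z-w)^n A\<close> exists, does not depend on the suitable powers of
  \<open>z\<close> used to compute it, and is the series \<open>r\<close> in \<open>w\<close>.
\<close>

definition has_residue :: "int \<Rightarrow> (int \<Rightarrow> int \<Rightarrow> 'v) \<Rightarrow> (int \<Rightarrow> 'v) \<Rightarrow> bool" where
  "has_residue n A r \<longleftrightarrow>
     (\<forall>M. (\<exists>N. suitable M N A) \<and>
          (\<forall>N. suitable M N A \<longrightarrow> (\<forall>j. hdvd M (r j - residue_coeff M N n A j))))"

end


section \<open>Braided and quantum vertex operator algebras\<close>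

text \<open>
  \<open>Y v w n\<close> is the coefficient of \<open>z^n\<close> in \<open>Y(v,z)w\<close>. The \<open>k[[h]]\<close>-linear maps \<open>Y\<close> and \<open>S\<close> on
  the completed tensor product \<open>V \<otimes> V\<close>, with values in complete separated modules, are given as
  \<open>k[[h]]\<close>-bilinear maps on \<open>V \<times> V\<close>.

  In (QA1), \<open>S(z1-z2)\<close> is expanded in nonnegative powers of \<open>z2\<close>, as needed for its product with
  \<open>Y(z1)(1 \<otimes> Y(z2))\<close> to make sense; for \<open>N\<close> large compared to the pole of \<open>S\<close> modulo \<open>h^M\<close> the
  expansion does not matter.
\<close>

locale braided_VOA = topologically_free scale
  for scale :: "'k::field_char_0 fps \<Rightarrow> 'v::ab_group_add \<Rightarrow> 'v" (infixr "*s" 75) +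
  fixes Y :: "'v \<Rightarrow> 'v \<Rightarrow> int \<Rightarrow> 'v"
    and T :: "'v \<Rightarrow> 'v"
    and \<Omega> :: 'v
    and S :: "'v \<Rightarrow> 'v \<Rightarrow> nat \<Rightarrow> ('v, 'k fls) fsum set"
  assumes Y_laurent: "laurent (Y v w)"
    and Y_linear_left: "module_hom scale scale (\<lambda>v. Y v w n)"
    and Y_linear_right: "module_hom scale scale (\<lambda>w. Y v w n)"
    and T_linear: "module_hom scale scale T"
    and S_in: "S v w \<in> completed_tensor fls_const 2"
    and S_add_left: "tensor_eq1 2 M (rep (S (v + v') w) M) (rep (S v w) M + rep (S v' w) M)"
    and S_add_right: "tensor_eq1 2 M (rep (S v (w + w')) M) (rep (S v w) M + rep (S v w') M)"
    and S_scale_left: "tensor_eq1 2 M (rep (S (r *s v) w) M) (on_slot 0 (scale r) (rep (S v w) M))"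
    and S_scale_right: "tensor_eq1 2 M (rep (S v (r *s w)) M) (on_slot 0 (scale r) (rep (S v w) M))"
    and S_mod_h: "tensor_eq1 2 1 (rep (S v w) 1) (frag_of ([v, w], 1))"
    and S_shift:
      "tensor_eq1 2 M
         (on_slot 0 T (rep (S v w) M) - rep (S (T v) w) M)
         (on_coeff (\<lambda>f. - fls_deriv f) (rep (S v w) M))"
    and S_Yang_Baxter: \<comment> \<open>in \<open>k((z))((w))\<close>\<close>
      "tensor_eq2 3 M
         (act S fls_const M 0 1 (act S (fls_taylor 1) M 0 2 (act S fls_outer M 1 2
           (frag_of ([v1, v2, v3], 1)))))
         (act S fls_outer M 1 2 (act S (fls_taylor 1) M 0 2 (act S fls_const M 0 1
           (frag_of ([v1, v2, v3], 1)))))"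
    and S_unitary_left:
      "tensor_eq1 2 M
         (act S id M 1 0 (act S fls_reflect M 0 1 (frag_of ([v, w], 1)))) (frag_of ([v, w], 1))"
    and S_unitary_right:
      "tensor_eq1 2 M
         (act S fls_reflect M 0 1 (act S id M 1 0 (frag_of ([v, w], 1)))) (frag_of ([v, w], 1))"
    and QA1:
      "\<exists>N::nat. \<forall>u p q.
         hdvd M
           (fsum_apply
              (\<lambda>(vs, f). series_mult M ((fls_const fls_X - fls_X) ^ N * fls_taylor (- 1) f)
                 (\<lambda>p q. Y (vs ! 0) (Y (vs ! 1) u q) p) p q)
              (rep (S v w) M)
            - series_mult M ((fls_const fls_X - fls_X) ^ N)
                 (\<lambda>p q. Y w (Y v u p) q) p q)"
    and QA2_vacuum: "T \<Omega> = 0"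
    and QA2_derivative: "of_int (n + 1) *s Y v w (n + 1) = T (Y v w n) - Y v (T w) n"
    and QA3_left: "Y \<Omega> v n = (if n = 0 then v else 0)"
    and QA3_regular: "n < 0 \<Longrightarrow> Y v \<Omega> n = 0"
    and QA3_value: "Y v \<Omega> 0 = v"
begin

text \<open>
  The coefficient of \<open>u^n\<close>, modulo \<open>h^M\<close>, in the image under \<open>Y(u) \<otimes> 1\<close> of a formal sum with three
  slots and coefficients in \<open>k((w))((u))\<close>.
\<close>

definition Y_tensor_one :: "nat \<Rightarrow> int \<Rightarrow> ('v, 'k fls fls) fsum \<Rightarrow> ('v, 'k fls) fsum" where
  "Y_tensor_one M n =
     frag_extend (\<lambda>(vs, g).
       \<Sum>p | fls_nth g (n - p) \<noteq> 0 \<and> \<not> hdvd M (Y (vs ! 0) (vs ! 1) p).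
         frag_of ([Y (vs ! 0) (vs ! 1) p, vs ! 2], fls_nth g (n - p)))"

end

text \<open>(QA4) is stated as an equality, for each \<open>n\<close>, of the coefficients of \<open>u^n\<close>.\<close>

locale quantum_VOA = braided_VOA +
  assumes QA4:
    "tensor_eq1 2 M
       (rep (S (Y v1 v2 n) v3) M)
       (Y_tensor_one M n
         (act S fls_const M 1 2 (act S (fls_taylor 1) M 0 2 (frag_of ([v1, v2, v3], 1)))))"

end

theory Submission
  imports Defs
begin

text \<open>
  The vector is \<open>y_n\<close>, the coefficient of \<open>x^(-n-1)\<close> in \<open>Y(v,x)w\<close>, and the statement is the
  associativity of \<open>Y\<close>: modulo \<open>h^M\<close> and after multiplication by a power of \<open>z = u + w\<close>, where
  \<open>u = z - w\<close>, the product \<open>Y(a,z) Y(c,w) d\<close> (\<open>prodY\<close>, a series in \<open>V((u))((w))\<close>) coincides with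
  \<open>Y(Y(a,u)c,w) d\<close> (\<open>iterY\<close>, a series in \<open>V((w))((u))\<close>); see \<open>associativity_mod\<close>. On
  \<open>V((w))((u))\<close> the power of \<open>w + u\<close> can be cancelled again, so the residue is a coefficient of
  \<open>Y(Y(a,u)c,w) d\<close> whatever power has been used (\<open>has_residue_if_associative\<close>). Uniqueness follows by
  applying both vertex operators to \<open>\<Omega>\<close>, because \<open>V\<close> is \<open>h\<close>-adically separated.

  Associativity rests on skew symmetry \<open>Y(z) S(z) (a \<otimes> b) = e^(zT) Y(-z) (b \<otimes> a)\<close>
  (\<open>skew_symmetry\<close>), which is braided commutativity (QA1) applied to the vacuum at \<open>z2 = 0\<close>.
  By (QA4) and skew symmetry,
    \<open>Y(w) (Y(u) \<otimes> 1) S23(w) S13(u+w) (v1 \<otimes> v2 \<otimes> v3) = Y(w) S(w) (Y(u)(v1 \<otimes> v2) \<otimes> v3)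
      = e^(wT) Y(-w) (v3 \<otimes> Y(u)(v1 \<otimes> v2))\<close>
  (\<open>hexagon_and_skew_symmetry\<close>). After multiplication by a power of \<open>u + w\<close>, braided commutativity
  with \<open>z1 = u\<close> and \<open>z2 = -w\<close> turns this into
    \<open>e^(wT) Y(u) (1 \<otimes> Y(-w)) S12(u+w) (v1 \<otimes> v3 \<otimes> v2)\<close>,
  and moving \<open>e^(wT)\<close> to the right, which replaces \<open>u\<close> by \<open>u + w\<close>, and using skew symmetry once more
  (\<open>expT_Y_Y\<close>) gives
    \<open>Y(u+w) (1 \<otimes> Y(w)) S23(w) S13(u+w) (v1 \<otimes> v2 \<otimes> v3)\<close>.
  So associativity holds on the image of \<open>S23(w) S13(u+w)\<close>. As \<open>S = 1 + O(h)\<close>, an induction on the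
  power of \<open>h\<close> (\<open>vanishes_if_vanishes_on_S\<close>) removes first \<open>S13\<close> and then \<open>S23\<close>.

  All identities are congruences modulo \<open>h^M\<close> between families of coefficients. A negative power
  of \<open>u + w\<close> has different expansions on the two products, whereas power series in \<open>u + w\<close> act on both
  alike. A Laurent series \<open>f(u+w)\<close> is therefore mostly used in the form of the regular part of
  \<open>x^N f(x)\<close> at \<open>x = u + w\<close>, for all large \<open>N\<close>; this is the operator \<open>pmul\<close>.
\<close>

context topologically_free
begin

section \<open>Congruences and sums modulo powers of \<open>h\<close>\<close>

definition hcong :: "'v \<Rightarrow> nat \<Rightarrow> 'v \<Rightarrow> bool" ("(_ \<approx>\<^bsub>_\<^esub> _)" [51, 0, 51] 50) where
  "x \<approx>\<^bsub>M\<^esub> y \<longleftrightarrow> hdvd M (x - y)"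

lemma hdvd_0 [simp]: "hdvd M 0"
  unfolding hdvd_def by (metis scale_zero_right)

lemma hdvd_add: "hdvd M x \<Longrightarrow> hdvd M y \<Longrightarrow> hdvd M (x + y)"
  unfolding hdvd_def by (metis scale_right_distrib)

lemma hdvd_diff: "hdvd M x \<Longrightarrow> hdvd M y \<Longrightarrow> hdvd M (x - y)"
  unfolding hdvd_def by (metis scale_right_diff_distrib)

lemma hdvd_scale: "hdvd M x \<Longrightarrow> hdvd M (r *s x)"
  unfolding hdvd_def by (metis scale_left_commute)

lemma hdvd_neg: "hdvd M x \<Longrightarrow> hdvd M (- x)"
  using hdvd_diff[of M 0 x] by simp

lemma hdvd_neg_iff [simp]: "hdvd M (- x) \<longleftrightarrow> hdvd M x"
  using hdvd_neg[of M x] hdvd_neg[of M "- x"] by auto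

lemma hdvd_sum: "(\<And>i. i \<in> F \<Longrightarrow> hdvd M (a i)) \<Longrightarrow> hdvd M (sum a F)"
  by (induction F rule: infinite_finite_induct) (auto intro: hdvd_add)

lemma hdvd_zero_power [simp]: "hdvd 0 x"
  by (simp add: hdvd_def)

lemma hdvd_Suc_X: "hdvd m x \<Longrightarrow> hdvd (Suc m) (fps_X *s x)"
  unfolding hdvd_def by auto

lemma hdvd_mono: "m \<le> M \<Longrightarrow> hdvd M x \<Longrightarrow> hdvd m x"
  unfolding hdvd_def by (metis le_add_diff_inverse power_add scale_scale)

lemma hdvd_hom:
  assumes "module_hom scale scale g" "hdvd M x"
  shows "hdvd M (g x)"
  using assms unfolding hdvd_def by (metis module_hom.scale)

text \<open>
  In the power series model, divisibility by \<open>h^M\<close> makes the first \<open>M\<close> coefficients vanish.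
\<close>

lemma hdvd_all_imp_zero:
  assumes "\<And>M. hdvd M x"
  shows "x = 0"
proof -
  obtain V0 :: "'v set" and \<phi> :: "'v \<Rightarrow> nat \<Rightarrow> 'v" where
    bij: "bij_betw \<phi> UNIV {a. \<forall>n. a n \<in> V0}" and
    add: "\<forall>x y n. \<phi> (x + y) n = \<phi> x n + \<phi> y n" and
    sc: "\<forall>f x n. \<phi> (f *s x) n = (\<Sum>i\<le>n. fps_const (fps_nth f i) *s \<phi> x (n - i))"
    using iso_power_series by blast
  have \<phi>0: "\<phi> 0 n = 0" for n
    using add[rule_format, of 0 0 n] by simp
  have "\<phi> x n = 0" for n
  proof -
    obtain y where "x = fps_X ^ Suc n *s y"
      using assms unfolding hdvd_def by blast
    then show ?thesis
      by (auto simp: sc simp del: power_Suc simp add: fps_X_power_nth intro!: sum.neutral)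
  qed
  then have "\<phi> x = \<phi> 0"
    using \<phi>0 by auto
  then show ?thesis
    using bij by (metis UNIV_I bij_betw_inv_into_left)
qed

lemma hcong_refl [simp, intro]: "x \<approx>\<^bsub>M\<^esub> x"
  by (simp add: hcong_def)

lemma hcong_sym: "x \<approx>\<^bsub>M\<^esub> y \<Longrightarrow> y \<approx>\<^bsub>M\<^esub> x"
  unfolding hcong_def using hdvd_neg[of M "x - y"] by simp

lemma hcong_trans [trans]: "x \<approx>\<^bsub>M\<^esub> y \<Longrightarrow> y \<approx>\<^bsub>M\<^esub> z \<Longrightarrow> x \<approx>\<^bsub>M\<^esub> z"
  unfolding hcong_def using hdvd_add[of M "x - y" "y - z"] by simp

lemma hcong_eq_trans [trans]: "x \<approx>\<^bsub>M\<^esub> y \<Longrightarrow> y = z \<Longrightarrow> x \<approx>\<^bsub>M\<^esub> z"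
  by simp

lemma eq_hcong_trans [trans]: "x = y \<Longrightarrow> y \<approx>\<^bsub>M\<^esub> z \<Longrightarrow> x \<approx>\<^bsub>M\<^esub> z"
  by simp

lemma hcong_0_iff [simp]: "x \<approx>\<^bsub>M\<^esub> 0 \<longleftrightarrow> hdvd M x"
  by (simp add: hcong_def)

lemma hcong_hdvd: "x \<approx>\<^bsub>M\<^esub> y \<Longrightarrow> hdvd M x \<longleftrightarrow> hdvd M y"
  using hcong_trans[of x M y 0] hcong_trans[of y M x 0] hcong_sym by auto

lemma hcong_add: "x \<approx>\<^bsub>M\<^esub> x' \<Longrightarrow> y \<approx>\<^bsub>M\<^esub> y' \<Longrightarrow> x + y \<approx>\<^bsub>M\<^esub> x' + y'"
  unfolding hcong_def using hdvd_add[of M "x - x'" "y - y'"] by (simp add: algebra_simps)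

lemma hcong_diff: "x \<approx>\<^bsub>M\<^esub> x' \<Longrightarrow> y \<approx>\<^bsub>M\<^esub> y' \<Longrightarrow> x - y \<approx>\<^bsub>M\<^esub> x' - y'"
  unfolding hcong_def using hdvd_diff[of M "x - x'" "y - y'"] by (simp add: algebra_simps)

lemma hcong_scale: "x \<approx>\<^bsub>M\<^esub> x' \<Longrightarrow> r *s x \<approx>\<^bsub>M\<^esub> r *s x'"
  unfolding hcong_def using hdvd_scale[of M "x - x'" r] by (simp add: scale_right_diff_distrib)

lemma hcong_sum: "(\<And>i. i \<in> F \<Longrightarrow> a i \<approx>\<^bsub>M\<^esub> b i) \<Longrightarrow> sum a F \<approx>\<^bsub>M\<^esub> sum b F"
  unfolding hcong_def using hdvd_sum[of F M "\<lambda>i. a i - b i"] by (simp add: sum_subtractf)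

lemma hcong_hom: "module_hom scale scale g \<Longrightarrow> x \<approx>\<^bsub>M\<^esub> y \<Longrightarrow> g x \<approx>\<^bsub>M\<^esub> g y"
  unfolding hcong_def using hdvd_hom[of g M "x - y"] by (simp add: module_hom.diff)

abbreviation kscale :: "'k \<Rightarrow> 'v \<Rightarrow> 'v" (infixr "*k" 75) where
  "c *k x \<equiv> fps_const c *s x"

lemma fps_const_add_scale: "(c + d) *k x = c *k x + d *k x"
  by (simp add: fps_const_add[symmetric] scale_left_distrib del: fps_const_add)

lemma fps_const_mult_scale: "(c * d) *k x = c *k (d *k x)"
  by (simp add: fps_const_mult[symmetric] del: fps_const_mult)

lemma kscale_neg: "(- c) *k x = - (c *k x)"
  by (simp flip: fps_const_neg)

lemma kscale_sum_left: "(\<Sum>i\<in>J. c i) *k x = (\<Sum>i\<in>J. c i *k x)"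
  by (induction J rule: infinite_finite_induct) (auto simp: fps_const_add_scale simp del: fps_const_add)

lemma kscale_cancel_Suc:
  assumes "of_nat (Suc k) *k x = of_nat (Suc k) *k y"
  shows "x = y"
proof -
  have "(1 / of_nat (Suc k)) *k (of_nat (Suc k) *k z) = z" for z
    by (simp flip: fps_const_mult_scale del: of_nat_Suc)
  then show ?thesis
    using assms by metis
qed

definition summable_mod :: "nat \<Rightarrow> ('i \<Rightarrow> 'v) \<Rightarrow> bool" where
  "summable_mod M a \<longleftrightarrow> finite {i. \<not> hdvd M (a i)}"

lemma summable_modI: "finite F \<Longrightarrow> (\<And>i. i \<notin> F \<Longrightarrow> hdvd M (a i)) \<Longrightarrow> summable_mod M a"
  unfolding summable_mod_def by (rule finite_subset[of _ F]) auto

lemma sum_mod_finite: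
  assumes "finite F" "\<And>i. i \<notin> F \<Longrightarrow> hdvd M (a i)"
  shows "sum_mod M a \<approx>\<^bsub>M\<^esub> sum a F"
proof -
  let ?S = "{i. \<not> hdvd M (a i)}"
  have "?S \<subseteq> F"
    using assms(2) by auto
  then have "sum a F = sum a ?S + sum a (F - ?S)"
    using assms(1) by (metis add.commute sum.subset_diff)
  moreover have "hdvd M (sum a (F - ?S))"
    by (rule hdvd_sum) auto
  ultimately show ?thesis
    unfolding hcong_def sum_mod_def by simp
qed

lemma sum_mod_cong: "(\<And>i. a i \<approx>\<^bsub>M\<^esub> b i) \<Longrightarrow> sum_mod M a \<approx>\<^bsub>M\<^esub> sum_mod M b"
proof -
  assume *: "\<And>i. a i \<approx>\<^bsub>M\<^esub> b i"
  then have "{i. \<not> hdvd M (a i)} = {i. \<not> hdvd M (b i)}"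
    using hcong_hdvd by blast
  then show ?thesis
    unfolding sum_mod_def using * by (auto intro: hcong_sum)
qed

lemma summable_mod_cong:
  assumes "\<And>i. a i \<approx>\<^bsub>M\<^esub> b i"
  shows "summable_mod M a \<longleftrightarrow> summable_mod M b"
  by (simp add: summable_mod_def hcong_hdvd[OF assms])

lemma sum_mod_hdvd: "(\<And>i. hdvd M (a i)) \<Longrightarrow> sum_mod M a = 0"
  by (simp add: sum_mod_def)

lemma hdvd_sum_mod:
  assumes "m \<le> M" "\<And>i. hdvd m (a i)"
  shows "hdvd m (sum_mod M a)"
  unfolding sum_mod_def using assms by (auto intro: hdvd_sum)

lemma sum_mod_hom:
  assumes "module_hom scale scale g" "summable_mod M a"
  shows "g (sum_mod M a) \<approx>\<^bsub>M\<^esub> sum_mod M (\<lambda>i. g (a i))"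
proof -
  let ?F = "{i. \<not> hdvd M (a i)}"
  have "sum_mod M (\<lambda>i. g (a i)) \<approx>\<^bsub>M\<^esub> (\<Sum>i\<in>?F. g (a i))"
    using assms by (intro sum_mod_finite) (auto simp: summable_mod_def intro: hdvd_hom)
  then show ?thesis
    unfolding sum_mod_def[of M a] by (simp add: module_hom.sum[OF assms(1)] hcong_sym)
qed

lemma module_hom_scale: "module_hom scale scale (\<lambda>x. r *s x)"
  by unfold_locales (auto simp: scale_right_distrib mult.commute)

lemma sum_mod_scale:
  assumes "summable_mod M a"
  shows "r *s sum_mod M a \<approx>\<^bsub>M\<^esub> sum_mod M (\<lambda>i. r *s a i)"
  by (rule sum_mod_hom[OF module_hom_scale assms])

lemma summable_mod_scale: "summable_mod M a \<Longrightarrow> summable_mod M (\<lambda>i. r i *s a i)"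
  unfolding summable_mod_def by (rule finite_subset[rotated]) (auto intro: hdvd_scale)

lemma summable_mod_add:
  "summable_mod M a \<Longrightarrow> summable_mod M b \<Longrightarrow> summable_mod M (\<lambda>i. a i + b i)"
  unfolding summable_mod_def
  by (rule finite_subset[of _ "{i. \<not> hdvd M (a i)} \<union> {i. \<not> hdvd M (b i)}"]) (auto intro: hdvd_add)

lemma summable_mod_sum:
  "(\<And>t. t \<in> J \<Longrightarrow> summable_mod M (a t)) \<Longrightarrow> summable_mod M (\<lambda>i. \<Sum>t\<in>J. a t i)"
proof (induction J rule: infinite_finite_induct)
  case (insert t J)
  then show ?case
    using summable_mod_add[of M "a t" "\<lambda>i. \<Sum>t\<in>J. a t i"] by simp
qed (simp_all add: summable_mod_def)

lemma sum_mod_add: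
  assumes "summable_mod M a" "summable_mod M b"
  shows "sum_mod M (\<lambda>i. a i + b i) \<approx>\<^bsub>M\<^esub> sum_mod M a + sum_mod M b"
proof -
  let ?F = "{i. \<not> hdvd M (a i)} \<union> {i. \<not> hdvd M (b i)}"
  have fin: "finite ?F"
    using assms by (simp add: summable_mod_def)
  have "sum_mod M (\<lambda>i. a i + b i) \<approx>\<^bsub>M\<^esub> (\<Sum>i\<in>?F. a i + b i)"
    by (rule sum_mod_finite[OF fin]) (auto intro: hdvd_add)
  also have "\<dots> = sum a ?F + sum b ?F"
    by (rule sum.distrib)
  also have "\<dots> \<approx>\<^bsub>M\<^esub> sum_mod M a + sum_mod M b"
    by (rule hcong_add; rule hcong_sym; rule sum_mod_finite[OF fin]) auto
  finally show ?thesis .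
qed

lemma sum_mod_diff:
  assumes "summable_mod M a" "summable_mod M b"
  shows "sum_mod M (\<lambda>i. a i - b i) \<approx>\<^bsub>M\<^esub> sum_mod M a - sum_mod M b"
proof -
  have eq: "- x = (- 1) *s x" for x
    by simp
  have "sum_mod M (\<lambda>i. a i + (- 1) *s b i) \<approx>\<^bsub>M\<^esub> sum_mod M a + sum_mod M (\<lambda>i. (- 1) *s b i)"
    using assms by (intro sum_mod_add summable_mod_scale)
  also have "\<dots> \<approx>\<^bsub>M\<^esub> sum_mod M a + (- 1) *s sum_mod M b"
    by (intro hcong_add hcong_refl hcong_sym[OF sum_mod_scale] assms)
  finally show ?thesis
    by simp
qed

lemma sum_mod_sum:
  assumes "\<And>t. t \<in> J \<Longrightarrow> summable_mod M (a t)"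
  shows "sum_mod M (\<lambda>i. \<Sum>t\<in>J. a t i) \<approx>\<^bsub>M\<^esub> (\<Sum>t\<in>J. sum_mod M (a t))"
  using assms
proof (induction J rule: infinite_finite_induct)
  case (insert t J)
  have "sum_mod M (\<lambda>i. a t i + (\<Sum>t\<in>J. a t i)) \<approx>\<^bsub>M\<^esub>
      sum_mod M (a t) + sum_mod M (\<lambda>i. \<Sum>t\<in>J. a t i)"
    using insert.prems by (intro sum_mod_add summable_mod_sum) auto
  also have "\<dots> \<approx>\<^bsub>M\<^esub> sum_mod M (a t) + (\<Sum>t\<in>J. sum_mod M (a t))"
    using insert by (intro hcong_add) auto
  finally show ?case
    using insert by simp
qed (simp_all add: sum_mod_hdvd)

text \<open>
  Summability is required of the double family: finite rows and finitely many row sums that matter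
  would not suffice, as the members of a row may cancel.
\<close>

lemma sum_mod_Fubini:
  assumes "summable_mod M (\<lambda>(i, j). a i j)"
  shows "sum_mod M (\<lambda>i. sum_mod M (a i)) \<approx>\<^bsub>M\<^esub> sum_mod M (\<lambda>(i, j). a i j)"
proof -
  let ?F = "{(i, j). \<not> hdvd M (a i j)}"
  have "?F = {x. \<not> hdvd M (case x of (i, j) \<Rightarrow> a i j)}"
    by auto
  then have fin: "finite ?F"
    using assms unfolding summable_mod_def by simp
  obtain I J where finIJ: "finite I" "finite J" and "?F \<subseteq> I \<times> J"
    using fin by (metis finite_imageI subset_fst_snd)
  then have hdvd_I: "i \<notin> I \<Longrightarrow> hdvd M (a i j)" and hdvd_J: "j \<notin> J \<Longrightarrow> hdvd M (a i j)" for i j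
    by blast+
  have "sum_mod M (\<lambda>i. sum_mod M (a i)) \<approx>\<^bsub>M\<^esub> sum_mod M (\<lambda>i. sum (a i) J)"
    by (rule sum_mod_cong, rule sum_mod_finite[OF finIJ(2) hdvd_J])
  also have "\<dots> \<approx>\<^bsub>M\<^esub> (\<Sum>i\<in>I. sum (a i) J)"
    by (rule sum_mod_finite[OF finIJ(1)], rule hdvd_sum, rule hdvd_I)
  also have "\<dots> = (\<Sum>(i, j)\<in>I \<times> J. a i j)"
    by (rule sum.cartesian_product)
  also have "\<dots> \<approx>\<^bsub>M\<^esub> sum_mod M (\<lambda>(i, j). a i j)"
  proof (rule hcong_sym, rule sum_mod_finite)
    fix x assume "x \<notin> I \<times> J"
    then show "hdvd M (case x of (i, j) \<Rightarrow> a i j)"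
      using hdvd_I[of "fst x" "snd x"] hdvd_J[of "snd x" "fst x"] by (cases x) auto
  qed (simp add: finIJ)
  finally show ?thesis .
qed

lemma summable_mod_iterated:
  assumes "summable_mod M (\<lambda>(i, j). a i j)"
  shows "summable_mod M (\<lambda>i. sum_mod M (a i))"
proof (rule summable_modI)
  show "finite (fst ` {x. \<not> hdvd M (case x of (i, j) \<Rightarrow> a i j)})"
    using assms unfolding summable_mod_def by (rule finite_imageI)
  fix i assume i: "i \<notin> fst ` {x. \<not> hdvd M (case x of (i, j) \<Rightarrow> a i j)}"
  have "hdvd M (a i j)" for j
  proof (rule ccontr)
    assume "\<not> hdvd M (a i j)"
    then have "(i, j) \<in> {x. \<not> hdvd M (case x of (i, j) \<Rightarrow> a i j)}"
      by simp
    then show False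
      using i by (metis fst_conv imageI)
  qed
  then show "hdvd M (sum_mod M (a i))"
    by (simp add: sum_mod_hdvd)
qed

lemma sum_mod_reindex:
  assumes "inj f" "\<And>j. j \<notin> range f \<Longrightarrow> hdvd M (a j)"
  shows "sum_mod M (\<lambda>i. a (f i)) = sum_mod M a"
proof -
  have "{j. \<not> hdvd M (a j)} = f ` {i. \<not> hdvd M (a (f i))}"
  proof (intro set_eqI iffI)
    fix j assume j: "j \<in> {j. \<not> hdvd M (a j)}"
    then obtain i where "j = f i"
      using assms(2)[of j] by auto
    then show "j \<in> f ` {i. \<not> hdvd M (a (f i))}"
      using j by simp
  qed auto
  then show ?thesis
    unfolding sum_mod_def using assms(1) by (simp add: sum.reindex inj_on_subset)
qed

lemma summable_mod_reindex:
  assumes "inj f" "summable_mod M a"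
  shows "summable_mod M (\<lambda>i. a (f i))"
  using finite_vimageI[OF assms(2)[unfolded summable_mod_def] assms(1)]
  by (simp add: summable_mod_def vimage_def)

lemma sum_mod_swap:
  assumes "summable_mod M (\<lambda>(i, j). a i j)"
  shows "sum_mod M (\<lambda>i. sum_mod M (a i)) \<approx>\<^bsub>M\<^esub> sum_mod M (\<lambda>j. sum_mod M (\<lambda>i. a i j))"
proof -
  have sw: "inj prod.swap"
    by simp
  have "summable_mod M (\<lambda>(j, i). a i j)"
    using summable_mod_reindex[OF sw assms] by (simp add: case_prod_unfold)
  then have "sum_mod M (\<lambda>j. sum_mod M (\<lambda>i. a i j)) \<approx>\<^bsub>M\<^esub> sum_mod M (\<lambda>(j, i). a i j)"
    by (rule sum_mod_Fubini)
  also have "\<dots> = sum_mod M (\<lambda>(i, j). a i j)"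
    using sum_mod_reindex[OF sw, of M "\<lambda>(i, j). a i j"] by (simp add: case_prod_unfold)
  finally show ?thesis
    by (rule hcong_trans[OF sum_mod_Fubini[OF assms] hcong_sym])
qed

lemma sum_mod_single: "(\<And>j. j \<noteq> i \<Longrightarrow> hdvd M (a j)) \<Longrightarrow> sum_mod M a \<approx>\<^bsub>M\<^esub> a i"
  using sum_mod_finite[of "{i}" M a] by auto


section \<open>Formal sums, tensor relations and multilinear functionals\<close>

lemma fsum_apply_superset:
  assumes "finite K" "Poly_Mapping.keys x \<subseteq> K"
  shows "fsum_apply F x = (\<Sum>t\<in>K. of_int (Poly_Mapping.lookup x t) *s F t)"
  unfolding fsum_apply_def using assms
  by (intro sum.mono_neutral_left) (auto simp: in_keys_iff)

lemma fsum_apply_add: "fsum_apply F (x + y) = fsum_apply F x + fsum_apply F y"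
proof -
  let ?K = "Poly_Mapping.keys x \<union> Poly_Mapping.keys y"
  have "fsum_apply F z = (\<Sum>t\<in>?K. of_int (Poly_Mapping.lookup z t) *s F t)"
    if "Poly_Mapping.keys z \<subseteq> ?K" for z
    using that by (intro fsum_apply_superset) auto
  moreover have "Poly_Mapping.keys (x + y) \<subseteq> ?K"
    by (rule Poly_Mapping.keys_add)
  ultimately show ?thesis
    by (simp add: lookup_add scale_left_distrib sum.distrib)
qed

lemma fsum_apply_0 [simp]: "fsum_apply F 0 = 0"
  by (simp add: fsum_apply_def)

lemma fsum_apply_diff: "fsum_apply F (x - y) = fsum_apply F x - fsum_apply F y"
  using fsum_apply_add[of F "x - y" y] by simp

lemma fsum_apply_frag_of [simp]: "fsum_apply F (frag_of t) = F t"
  by (simp add: fsum_apply_def)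

lemma fsum_apply_sum: "finite J \<Longrightarrow> fsum_apply F (\<Sum>j\<in>J. x j) = (\<Sum>j\<in>J. fsum_apply F (x j))"
  by (induction J rule: finite_induct) (simp_all add: fsum_apply_add)

lemma fsum_apply_extend:
  "fsum_apply F (frag_extend g x) = fsum_apply (\<lambda>t. fsum_apply F (g t)) x"
proof (rule frag_induction[of x UNIV "\<lambda>x. fsum_apply F (frag_extend g x) =
    fsum_apply (\<lambda>t. fsum_apply F (g t)) x"])
qed (simp_all add: frag_extend_diff fsum_apply_diff)

lemma fsum_apply_cong:
  "(\<And>t. t \<in> Poly_Mapping.keys x \<Longrightarrow> F t \<approx>\<^bsub>M\<^esub> G t) \<Longrightarrow> fsum_apply F x \<approx>\<^bsub>M\<^esub> fsum_apply G x"
  unfolding fsum_apply_def by (intro hcong_sum hcong_scale)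

lemma fsum_apply_cong_split:
  assumes "\<And>us f. (us, f) \<in> Poly_Mapping.keys x \<Longrightarrow> F us f \<approx>\<^bsub>M\<^esub> G us f"
  shows "fsum_apply (\<lambda>(us, f). F us f) x \<approx>\<^bsub>M\<^esub> fsum_apply (\<lambda>(us, f). G us f) x"
  by (rule fsum_apply_cong) (use assms in auto)

lemma fsum_apply_add_fun:
  "fsum_apply (\<lambda>t. F t + G t) x = fsum_apply F x + fsum_apply G x"
  by (simp add: fsum_apply_def scale_right_distrib sum.distrib)

lemma fsum_apply_diff_fun:
  "fsum_apply (\<lambda>t. F t - G t) x = fsum_apply F x - fsum_apply G x"
  by (simp add: fsum_apply_def scale_right_diff_distrib sum_subtractf)

lemma fsum_apply_hom:
  "module_hom scale scale g \<Longrightarrow> g (fsum_apply F x) = fsum_apply (\<lambda>t. g (F t)) x"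
  by (simp add: fsum_apply_def module_hom.sum module_hom.scale)

lemma fsum_apply_scale: "r *s fsum_apply F x = fsum_apply (\<lambda>t. r *s F t) x"
  by (rule fsum_apply_hom[OF module_hom_scale])

lemma sum_mod_fsum_apply:
  assumes "\<And>t. t \<in> Poly_Mapping.keys x \<Longrightarrow> summable_mod M (a t)"
  shows "sum_mod M (\<lambda>i. fsum_apply (\<lambda>t. a t i) x) \<approx>\<^bsub>M\<^esub> fsum_apply (\<lambda>t. sum_mod M (a t)) x"
proof -
  have "sum_mod M (\<lambda>i. fsum_apply (\<lambda>t. a t i) x) \<approx>\<^bsub>M\<^esub>
      (\<Sum>t\<in>Poly_Mapping.keys x. sum_mod M (\<lambda>i. of_int (Poly_Mapping.lookup x t) *s a t i))"
    unfolding fsum_apply_def using assms by (intro sum_mod_sum summable_mod_scale)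
  also have "\<dots> \<approx>\<^bsub>M\<^esub> fsum_apply (\<lambda>t. sum_mod M (a t)) x"
    unfolding fsum_apply_def using assms by (intro hcong_sum hcong_sym[OF sum_mod_scale])
  finally show ?thesis .
qed

text \<open>
  As \<^const>\<open>sum_mod\<close> omits the members divisible by \<open>h^M\<close>, operators defined by it are linear only
  up to multiples of \<open>h^M\<close>.
\<close>

definition linear_mod :: "nat \<Rightarrow> ('v \<Rightarrow> 'v) \<Rightarrow> bool" where
  "linear_mod M g \<longleftrightarrow> (\<forall>x y. g (x + y) \<approx>\<^bsub>M\<^esub> g x + g y) \<and> (\<forall>r x. g (r *s x) \<approx>\<^bsub>M\<^esub> r *s g x)"

lemma linear_mod_add: "linear_mod M g \<Longrightarrow> g (x + y) \<approx>\<^bsub>M\<^esub> g x + g y"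
  by (simp add: linear_mod_def)

lemma linear_mod_scale: "linear_mod M g \<Longrightarrow> g (r *s x) \<approx>\<^bsub>M\<^esub> r *s g x"
  by (simp add: linear_mod_def)

lemma linear_mod_hom: "module_hom scale scale g \<Longrightarrow> linear_mod M g"
  by (simp add: linear_mod_def module_hom.add module_hom.scale)

lemma linear_mod_diff:
  assumes "linear_mod M f" "linear_mod M g"
  shows "linear_mod M (\<lambda>x. f x - g x)"
  unfolding linear_mod_def
proof (intro conjI allI)
  fix x y
  show "f (x + y) - g (x + y) \<approx>\<^bsub>M\<^esub> f x - g x + (f y - g y)"
    using hcong_diff[OF linear_mod_add[OF assms(1), of x y] linear_mod_add[OF assms(2), of x y]]
    by (simp add: algebra_simps)
next
  fix r x
  show "f (r *s x) - g (r *s x) \<approx>\<^bsub>M\<^esub> r *s (f x - g x)"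
    using hcong_diff[OF linear_mod_scale[OF assms(1), of r x] linear_mod_scale[OF assms(2), of r x]]
    by (simp add: scale_right_diff_distrib)
qed

lemma linear_mod_comp:
  assumes "module_hom scale scale f" "linear_mod M g"
  shows "linear_mod M (\<lambda>x. f (g x))"
  unfolding linear_mod_def
  using hcong_hom[OF assms(1) linear_mod_add[OF assms(2)]] hcong_hom[OF assms(1) linear_mod_scale[OF assms(2)]]
  by (simp add: module_hom.add[OF assms(1)] module_hom.scale[OF assms(1)])

lemma linear_mod_sum_mod:
  assumes "\<And>i. linear_mod M (\<lambda>x. A x i)" "\<And>x. summable_mod M (A x)"
  shows "linear_mod M (\<lambda>x. sum_mod M (A x))"
  unfolding linear_mod_def
proof (intro conjI allI)
  fix x y
  have "sum_mod M (A (x + y)) \<approx>\<^bsub>M\<^esub> sum_mod M (\<lambda>i. A x i + A y i)"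
    by (rule sum_mod_cong, rule linear_mod_add[OF assms(1)])
  also have "\<dots> \<approx>\<^bsub>M\<^esub> sum_mod M (A x) + sum_mod M (A y)"
    by (rule sum_mod_add[OF assms(2) assms(2)])
  finally show "sum_mod M (A (x + y)) \<approx>\<^bsub>M\<^esub> sum_mod M (A x) + sum_mod M (A y)" .
next
  fix r x
  have "sum_mod M (A (r *s x)) \<approx>\<^bsub>M\<^esub> sum_mod M (\<lambda>i. r *s A x i)"
    by (rule sum_mod_cong, rule linear_mod_scale[OF assms(1)])
  also have "\<dots> \<approx>\<^bsub>M\<^esub> r *s sum_mod M (A x)"
    by (rule hcong_sym[OF sum_mod_scale[OF assms(2)]])
  finally show "sum_mod M (A (r *s x)) \<approx>\<^bsub>M\<^esub> r *s sum_mod M (A x)" .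
qed

lemma linear_mod_fsum_apply:
  assumes "\<And>t. linear_mod M (\<lambda>x. A x t)"
  shows "linear_mod M (\<lambda>x. fsum_apply (A x) y)"
  unfolding linear_mod_def
proof (intro conjI allI)
  fix x x'
  show "fsum_apply (A (x + x')) y \<approx>\<^bsub>M\<^esub> fsum_apply (A x) y + fsum_apply (A x') y"
    unfolding fsum_apply_add_fun[symmetric] by (rule fsum_apply_cong, rule linear_mod_add[OF assms])
next
  fix r x
  show "fsum_apply (A (r *s x)) y \<approx>\<^bsub>M\<^esub> r *s fsum_apply (A x) y"
    unfolding fsum_apply_scale by (rule fsum_apply_cong, rule linear_mod_scale[OF assms])
qed

text \<open>
  The universal property of the tensor product modulo \<open>h^M\<close>. Divisibility of the generators
  \<open>hpower\<close> comes from linearity in the slot that carries \<open>h^M\<close>.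
\<close>

lemma multilinear_kills_tensor_rel:
  assumes "x \<in> tensor_rel \<iota> n M"
    and add: "\<And>vs i a b c. length vs = n \<Longrightarrow> i < n \<Longrightarrow>
      F (vs[i := a + b], c) \<approx>\<^bsub>M\<^esub> F (vs[i := a], c) + F (vs[i := b], c)"
    and scale: "\<And>vs i r c. length vs = n \<Longrightarrow> i < n \<Longrightarrow>
      F (vs[i := r *s (vs ! i)], c) \<approx>\<^bsub>M\<^esub> r *s F (vs, c)"
    and add_coeff: "\<And>vs c d. length vs = n \<Longrightarrow> F (vs, c + d) \<approx>\<^bsub>M\<^esub> F (vs, c) + F (vs, d)"
    and scale_coeff: "\<And>vs s c. length vs = n \<Longrightarrow> F (vs, \<iota> s * c) \<approx>\<^bsub>M\<^esub> s *k F (vs, c)"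
  shows "hdvd M (fsum_apply F x)"
  using assms(1)
proof (induction rule: tensor_rel.induct)
  case (diff x y)
  then show ?case
    by (simp add: fsum_apply_diff hdvd_diff)
next
  case (add_slot vs i a b c)
  then show ?case
    using add[of vs i a b c] by (simp add: fsum_apply_diff fsum_apply_add hcong_def diff_diff_eq)
next
  case (add_coeff vs c d)
  then show ?case
    using assms(4)[of vs c d] by (simp add: fsum_apply_diff fsum_apply_add hcong_def diff_diff_eq)
next
  case (balance_slots vs i j r c)
  then show ?case
    using hcong_trans[OF scale[of vs i r c] hcong_sym[OF scale[of vs j r c]]]
    by (simp add: fsum_apply_diff hcong_def)
next
  case (balance_coeff vs i s c)
  then show ?case
    using hcong_trans[OF scale[of vs i _ c] hcong_sym[OF scale_coeff[of vs s c]]]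
    by (simp add: fsum_apply_diff hcong_def)
next
  case (hpower vs i a c)
  then have "F (vs[i := fps_X ^ M *s a], c) \<approx>\<^bsub>M\<^esub> fps_X ^ M *s F (vs[i := a], c)"
    using scale[of "vs[i := a]" i "fps_X ^ M" c] by simp
  moreover have "hdvd M (fps_X ^ M *s F (vs[i := a], c))"
    unfolding hdvd_def by blast
  ultimately show ?case
    using hcong_hdvd by auto
qed simp

lemma length_2_cases:
  assumes "length vs = 2"
  obtains a b where "vs = [a, b]"
  using assms by (auto simp: length_Suc_conv numeral_2_eq_2)

lemma bilinear_kills_tensor_rel:
  assumes "x \<in> tensor_rel fls_const 2 M"
    and lin1: "\<And>b f. linear_mod M (\<lambda>a. G a b f)" and lin2: "\<And>a f. linear_mod M (\<lambda>b. G a b f)"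
    and add: "\<And>a b f g. G a b (f + g) \<approx>\<^bsub>M\<^esub> G a b f + G a b g"
    and scale: "\<And>a b s f. G a b (fls_const s * f) \<approx>\<^bsub>M\<^esub> s *k G a b f"
  shows "hdvd M (fsum_apply (\<lambda>(vs, f). G (vs ! 0) (vs ! 1) f) x)"
  using assms(1)
proof (rule multilinear_kills_tensor_rel)
  fix vs :: "'v list" and i :: nat and a b c
  assume vs: "length vs = 2" "i < 2"
  obtain a' b' where "vs = [a', b']"
    using length_2_cases[OF vs(1)] by blast
  then show "(case (vs[i := a + b], c) of (vs, f) \<Rightarrow> G (vs ! 0) (vs ! 1) f) \<approx>\<^bsub>M\<^esub>
      (case (vs[i := a], c) of (vs, f) \<Rightarrow> G (vs ! 0) (vs ! 1) f) +
      (case (vs[i := b], c) of (vs, f) \<Rightarrow> G (vs ! 0) (vs ! 1) f)"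
    using vs(2) linear_mod_add[OF lin1, of a b b' c] linear_mod_add[OF lin2, of a' a b c]
    by (auto simp: less_2_cases_iff)
next
  fix vs :: "'v list" and i :: nat and r c
  assume vs: "length vs = 2" "i < 2"
  obtain a' b' where "vs = [a', b']"
    using length_2_cases[OF vs(1)] by blast
  then show "(case (vs[i := r *s vs ! i], c) of (vs, f) \<Rightarrow> G (vs ! 0) (vs ! 1) f) \<approx>\<^bsub>M\<^esub>
      r *s (case (vs, c) of (vs, f) \<Rightarrow> G (vs ! 0) (vs ! 1) f)"
    using vs(2) linear_mod_scale[OF lin1, of r a' b' c] linear_mod_scale[OF lin2, of a' r b' c]
    by (auto simp: less_2_cases_iff)
qed (use add scale in auto)

lemma tensor_eq_bilinear:
  assumes "tensor_eq1 2 M x y"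
    and lin1: "\<And>b f. linear_mod M (\<lambda>a. G a b f)" and lin2: "\<And>a f. linear_mod M (\<lambda>b. G a b f)"
    and add: "\<And>a b f g. G a b (f + g) \<approx>\<^bsub>M\<^esub> G a b f + G a b g"
    and scale: "\<And>a b s f. G a b (fls_const s * f) \<approx>\<^bsub>M\<^esub> s *k G a b f"
  shows "fsum_apply (\<lambda>(vs, f). G (vs ! 0) (vs ! 1) f) x \<approx>\<^bsub>M\<^esub> fsum_apply (\<lambda>(vs, f). G (vs ! 0) (vs ! 1) f) y"
proof -
  have "hdvd M (fsum_apply (\<lambda>(vs, f). G (vs ! 0) (vs ! 1) f) (x - y))"
  proof (rule bilinear_kills_tensor_rel)
    show "x - y \<in> tensor_rel fls_const 2 M"
      using assms(1) by (simp add: tensor_eq_def)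
  qed (fact assms)+
  then show ?thesis
    by (simp add: hcong_def fsum_apply_diff)
qed

text \<open>
  Relations only involve lists of the right length. Hence so does every representative of an element
  of the completed tensor product, and indexing its slots is meaningful.
\<close>

lemma tensor_rel_keys:
  "x \<in> tensor_rel \<iota> n M \<Longrightarrow> \<forall>(vs, c) \<in> Poly_Mapping.keys x. length vs = n"
proof (induction rule: tensor_rel.induct)
  case (diff x y)
  then show ?case
    using keys_diff[of x y] by blast
next
  case (add_slot vs i a b c)
  then show ?case
    using keys_diff[of "frag_of (vs[i := a + b], c) - frag_of (vs[i := a], c)" "frag_of (vs[i := b], c)"]
      keys_diff[of "frag_of (vs[i := a + b], c)" "frag_of (vs[i := a], c)"] by fastforce
next
  case (add_coeff vs c d)
  then show ?case
    using keys_diff[of "frag_of (vs, c + d) - frag_of (vs, c)" "frag_of (vs, d)"]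
      keys_diff[of "frag_of (vs, c + d)" "frag_of (vs, c)"] by fastforce
next
  case (balance_slots vs i j r c)
  then show ?case
    using keys_diff[of "frag_of (vs[i := r *s (vs ! i)], c)" "frag_of (vs[j := r *s (vs ! j)], c)"] by fastforce
next
  case (balance_coeff vs i s c)
  then show ?case
    using keys_diff[of "frag_of (vs[i := fps_const s *s (vs ! i)], c)" "frag_of (vs, \<iota> s * c)"] by fastforce
qed auto


section \<open>Laurent series acting on \<open>V((w))\<close>\<close>

text \<open>
  Membership in \<open>V((w))\<close> modulo \<open>h^M\<close>.
\<close>

definition bounded_below :: "nat \<Rightarrow> (int \<Rightarrow> 'v) \<Rightarrow> bool" where
  "bounded_below M a \<longleftrightarrow> (\<exists>n0. \<forall>n<n0. hdvd M (a n))"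

lemma bounded_belowI: "(\<And>n. n < n0 \<Longrightarrow> hdvd M (a n)) \<Longrightarrow> bounded_below M a"
  unfolding bounded_below_def by blast

lemma bounded_below_add:
  assumes "bounded_below M a" "bounded_below M b"
  shows "bounded_below M (\<lambda>n. a n + b n)"
proof -
  obtain n0 n1 where "\<forall>n<n0. hdvd M (a n)" "\<forall>n<n1. hdvd M (b n)"
    using assms unfolding bounded_below_def by blast
  then show ?thesis
    by (intro bounded_belowI[of "min n0 n1"] hdvd_add) auto
qed

lemma bounded_below_hom:
  "module_hom scale scale g \<Longrightarrow> bounded_below M a \<Longrightarrow> bounded_below M (\<lambda>n. g (a n))"
  unfolding bounded_below_def by (metis hdvd_hom)

lemma bounded_below_scale: "bounded_below M a \<Longrightarrow> bounded_below M (\<lambda>n. r *s a n)"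
  by (rule bounded_below_hom[OF module_hom_scale])

text \<open>
  The action of \<open>k((w))\<close> on \<open>V((w))\<close>.
\<close>

definition lmul :: "nat \<Rightarrow> 'k fls \<Rightarrow> (int \<Rightarrow> 'v) \<Rightarrow> int \<Rightarrow> 'v" where
  "lmul M g a q = sum_mod M (\<lambda>i. fls_nth g i *k a (q - i))"

lemma summable_lmul:
  assumes "bounded_below M a"
  shows "summable_mod M (\<lambda>i. fls_nth g i *k a (q - i))"
proof -
  obtain n0 where n0: "\<forall>n<n0. hdvd M (a n)"
    using assms unfolding bounded_below_def by blast
  show ?thesis
  proof (rule summable_modI)
    fix i assume "i \<notin> {fls_subdegree g..q - n0}"
    then consider "i < fls_subdegree g" | "q - i < n0"
      by force
    then show "hdvd M (fls_nth g i *k a (q - i))"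
      by cases (use n0 in \<open>auto intro: hdvd_scale\<close>)
  qed simp
qed

lemma hdvd_lmul: "m \<le> M \<Longrightarrow> (\<And>n. hdvd m (a n)) \<Longrightarrow> hdvd m (lmul M g a q)"
  unfolding lmul_def by (intro hdvd_sum_mod hdvd_scale)

lemma bounded_below_lmul:
  assumes "bounded_below M a"
  shows "bounded_below M (lmul M g a)"
proof -
  obtain n0 where n0: "\<forall>n<n0. hdvd M (a n)"
    using assms unfolding bounded_below_def by blast
  show ?thesis
  proof (rule bounded_belowI)
    fix q assume q: "q < n0 + fls_subdegree g"
    have "hdvd M (fls_nth g i *k a (q - i))" for i
      using q n0 by (cases "i < fls_subdegree g") (auto intro: hdvd_scale)
    then show "hdvd M (lmul M g a q)"
      unfolding lmul_def by (simp add: sum_mod_hdvd)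
  qed
qed

lemma lmul_diff:
  assumes "bounded_below M a" "bounded_below M b"
  shows "lmul M g (\<lambda>n. a n - b n) q \<approx>\<^bsub>M\<^esub> lmul M g a q - lmul M g b q"
  unfolding lmul_def scale_right_diff_distrib using assms by (intro sum_mod_diff summable_lmul)

lemma hom_lmul:
  assumes "module_hom scale scale \<phi>" "bounded_below M a"
  shows "\<phi> (lmul M g a q) \<approx>\<^bsub>M\<^esub> lmul M g (\<lambda>n. \<phi> (a n)) q"
  unfolding lmul_def module_hom.scale[OF assms(1), symmetric]
  using assms by (intro sum_mod_hom summable_lmul)

lemma lmul_add_left:
  "bounded_below M a \<Longrightarrow> lmul M (g + h) a q \<approx>\<^bsub>M\<^esub> lmul M g a q + lmul M h a q"
  unfolding lmul_def fls_plus_nth fps_const_add_scale by (intro sum_mod_add summable_lmul)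

lemma lmul_const_mult:
  "bounded_below M a \<Longrightarrow> lmul M (fls_const s * g) a q \<approx>\<^bsub>M\<^esub> s *k lmul M g a q"
  unfolding lmul_def fls_mult_const_nth fps_const_mult_scale
  by (intro hcong_sym[OF sum_mod_scale] summable_lmul)

lemma lmul_zero_left: "lmul M 0 a q = 0"
  by (simp add: lmul_def sum_mod_hdvd)

lemma lmul_one: "lmul M 1 a q \<approx>\<^bsub>M\<^esub> a q"
  unfolding lmul_def using sum_mod_single[of 0 M "\<lambda>i. fls_nth 1 i *k a (q - i)"] by simp

text \<open>
  Both sides are rearrangements of the double sum of \<open>g_j h_k a_(q-j-k)\<close>, to which only finitely
  many pairs \<open>(j, k)\<close> contribute.
\<close>

lemma lmul_mult:
  assumes "bounded_below M a"
  shows "lmul M (g * h) a q \<approx>\<^bsub>M\<^esub> lmul M g (lmul M h a) q"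
proof -
  obtain n0 where n0: "\<forall>n<n0. hdvd M (a n)"
    using assms unfolding bounded_below_def by blast
  let ?F = "\<lambda>(j, k). (fls_nth g j * fls_nth h k) *k a (q - j - k)"
  let ?dg = "fls_subdegree g" and ?dh = "fls_subdegree h"
  have F: "summable_mod M ?F"
  proof (rule summable_modI)
    fix x :: "int \<times> int"
    assume x: "x \<notin> {?dg..q - n0 - ?dh} \<times> {?dh..q - n0 - ?dg}"
    obtain j k where [simp]: "x = (j, k)"
      by force
    consider "j < ?dg" | "k < ?dh" | "q - j - k < n0"
      using x by force
    then show "hdvd M (?F x)"
      by cases (use n0 in \<open>auto intro: hdvd_scale\<close>)
  qed simp
  let ?f = "\<lambda>(i, j). (j, i - j) :: int \<times> int"
  have f: "inj ?f" "range ?f = UNIV"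
    by (auto simp: inj_def image_def) (metis add_diff_cancel_left')
  have "lmul M g (lmul M h a) q \<approx>\<^bsub>M\<^esub> sum_mod M (\<lambda>j. sum_mod M (\<lambda>k. ?F (j, k)))"
    unfolding lmul_def
  proof (rule sum_mod_cong)
    fix j
    show "fls_nth g j *k sum_mod M (\<lambda>i. fls_nth h i *k a (q - j - i)) \<approx>\<^bsub>M\<^esub>
        sum_mod M (\<lambda>k. ?F (j, k))"
      using sum_mod_scale[OF summable_lmul[OF assms], of "fps_const (fls_nth g j)" h "q - j"]
      by (simp add: fps_const_mult_scale del: fps_const_mult scale_scale)
  qed
  also have "\<dots> \<approx>\<^bsub>M\<^esub> sum_mod M (\<lambda>(j, k). ?F (j, k))"
    using F by (intro sum_mod_Fubini) simp
  also have "\<dots> = sum_mod M (\<lambda>x. ?F (?f x))"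
    using sum_mod_reindex[OF f(1), of M ?F] f(2) by simp
  also have "\<dots> = sum_mod M (\<lambda>(i, j). ?F (j, i - j))"
    by (simp add: case_prod_unfold)
  also have "\<dots> \<approx>\<^bsub>M\<^esub> sum_mod M (\<lambda>i. sum_mod M (\<lambda>j. ?F (j, i - j)))"
    using summable_mod_reindex[OF f(1) F]
    by (intro hcong_sym[OF sum_mod_Fubini]) (simp add: case_prod_unfold)
  also have "\<dots> \<approx>\<^bsub>M\<^esub> lmul M (g * h) a q"
    unfolding lmul_def
  proof (rule sum_mod_cong)
    fix i
    have "sum_mod M (\<lambda>j. ?F (j, i - j)) \<approx>\<^bsub>M\<^esub> (\<Sum>j\<in>{?dg..i - ?dh}. ?F (j, i - j))"
    proof (rule sum_mod_finite)
      fix j assume "j \<notin> {?dg..i - ?dh}"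
      then have "j < ?dg \<or> i - j < ?dh"
        by force
      then show "hdvd M (?F (j, i - j))"
        by auto
    qed simp
    also have "\<dots> = fls_nth (g * h) i *k a (q - i)"
      by (simp add: fls_times_nth(2) kscale_sum_left)
    finally show "sum_mod M (\<lambda>j. ?F (j, i - j)) \<approx>\<^bsub>M\<^esub> fls_nth (g * h) i *k a (q - i)" .
  qed
  finally show ?thesis
    by (rule hcong_sym)
qed

lemma linear_mod_lmul:
  assumes "\<And>n. linear_mod M (\<lambda>x. A x n)" "\<And>x. bounded_below M (A x)"
  shows "linear_mod M (\<lambda>x. lmul M g (A x) q)"
  unfolding lmul_def
  by (rule linear_mod_sum_mod, rule linear_mod_comp[OF module_hom_scale assms(1)], rule summable_lmul[OF assms(2)])


section \<open>Multiplication by \<open>u + w\<close> on series in two variables\<close>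

text \<open>
  Multiplication by \<open>u + w\<close>; \<open>A p q\<close> is the coefficient of \<open>u^p w^q\<close>.
\<close>

definition theta :: "(int \<Rightarrow> int \<Rightarrow> 'v) \<Rightarrow> int \<Rightarrow> int \<Rightarrow> 'v" where
  "theta A p q = A (p - 1) q + A p (q - 1)"

lemma theta_pow_Suc: "(theta ^^ Suc n) A p q = (theta ^^ n) A (p - 1) q + (theta ^^ n) A p (q - 1)"
  by (simp add: theta_def)

lemma theta_pow_cong:
  assumes "\<And>p q. A p q \<approx>\<^bsub>M\<^esub> B p q"
  shows "(theta ^^ n) A p q \<approx>\<^bsub>M\<^esub> (theta ^^ n) B p q"
  using assms by (induction n arbitrary: p q) (auto simp: theta_pow_Suc simp del: funpow.simps(2) intro: hcong_add)

lemma theta_pow_hom: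
  assumes "module_hom scale scale g"
  shows "(theta ^^ n) (\<lambda>p q. g (A p q)) p q = g ((theta ^^ n) A p q)"
  by (induction n arbitrary: p q) (auto simp: theta_def module_hom.add[OF assms])

lemma theta_pow_scale: "(theta ^^ n) (\<lambda>p q. r *s A p q) p q = r *s (theta ^^ n) A p q"
  by (rule theta_pow_hom[OF module_hom_scale])

lemma theta_pow_add:
  "(theta ^^ n) (\<lambda>p q. A p q + B p q) p q = (theta ^^ n) A p q + (theta ^^ n) B p q"
  by (induction n arbitrary: p q) (auto simp: theta_def algebra_simps)

lemma theta_pow_diff:
  "(theta ^^ n) (\<lambda>p q. A p q - B p q) p q = (theta ^^ n) A p q - (theta ^^ n) B p q"
  by (induction n arbitrary: p q) (auto simp: theta_def algebra_simps)

lemma theta_pow_zero [simp]: "(theta ^^ n) (\<lambda>p q. 0) p q = 0"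
  by (induction n arbitrary: p q) (auto simp: theta_def)

lemma theta_pow_sum:
  "(theta ^^ n) (\<lambda>p q. \<Sum>t\<in>J. A t p q) p q = (\<Sum>t\<in>J. (theta ^^ n) (A t) p q)"
  by (induction J rule: infinite_finite_induct) (auto simp: theta_pow_add)

lemma theta_pow_fsum_apply:
  "(theta ^^ n) (\<lambda>p q. fsum_apply (\<lambda>t. A t p q) x) p q = fsum_apply (\<lambda>t. (theta ^^ n) (A t) p q) x"
  by (simp add: fsum_apply_def theta_pow_sum theta_pow_scale)

lemma theta_pow_flip: "(theta ^^ n) (\<lambda>q p. A p q) q p = (theta ^^ n) A p q"
  by (induction n arbitrary: p q) (auto simp: theta_def algebra_simps)

lemma hdvd_theta_pow: "(\<And>p q. hdvd m (A p q)) \<Longrightarrow> hdvd m ((theta ^^ n) A p q)"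
  by (induction n arbitrary: p q) (auto simp: theta_def intro: hdvd_add)

text \<open>
  Summability is part of the conclusion because the induction needs it.
\<close>

lemma theta_pow_sum_mod:
  assumes "\<And>p q. summable_mod M (\<lambda>i. A i p q)"
  shows "(theta ^^ n) (\<lambda>p q. sum_mod M (\<lambda>i. A i p q)) p q \<approx>\<^bsub>M\<^esub> sum_mod M (\<lambda>i. (theta ^^ n) (A i) p q)
    \<and> summable_mod M (\<lambda>i. (theta ^^ n) (A i) p q)"
proof (induction n arbitrary: p q)
  case 0
  then show ?case
    using assms by simp
next
  case (Suc n)
  have "(theta ^^ Suc n) (\<lambda>p q. sum_mod M (\<lambda>i. A i p q)) p q \<approx>\<^bsub>M\<^esub>
      sum_mod M (\<lambda>i. (theta ^^ n) (A i) (p - 1) q) + sum_mod M (\<lambda>i. (theta ^^ n) (A i) p (q - 1))"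
    unfolding theta_pow_Suc using Suc by (intro hcong_add) auto
  also have "\<dots> \<approx>\<^bsub>M\<^esub> sum_mod M (\<lambda>i. (theta ^^ Suc n) (A i) p q)"
    unfolding theta_pow_Suc using Suc by (intro hcong_sym[OF sum_mod_add]) auto
  finally show ?case
    using summable_mod_add[of M "\<lambda>i. (theta ^^ n) (A i) (p - 1) q" "\<lambda>i. (theta ^^ n) (A i) p (q - 1)"] Suc
    unfolding theta_pow_Suc by auto
qed

lemma linear_mod_theta_pow:
  assumes "\<And>p q. linear_mod M (\<lambda>x. A x p q)"
  shows "linear_mod M (\<lambda>x. (theta ^^ n) (A x) p q)"
  unfolding linear_mod_def theta_pow_add[symmetric] theta_pow_scale[symmetric]
  by (intro conjI allI theta_pow_cong linear_mod_add linear_mod_scale assms)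

text \<open>
  Modulo \<open>h^M\<close>, only finitely many coefficients of the series below and to the left of any
  given position are nonzero. Both \<open>V((w))((u))\<close> and \<open>V((u))((w))\<close> consist of such series, and
  power series in \<open>u + w\<close> act on them.
\<close>

definition quadrant_finite :: "nat \<Rightarrow> (int \<Rightarrow> int \<Rightarrow> 'v) \<Rightarrow> bool" where
  "quadrant_finite M A \<longleftrightarrow>
    (\<forall>p q. \<exists>K. \<forall>p' q'. p' \<le> p \<longrightarrow> q' \<le> q \<longrightarrow> p' + q' < K \<longrightarrow> hdvd M (A p' q'))"

lemma quadrant_finiteE:
  assumes "quadrant_finite M A"
  obtains K where "\<And>p' q'. p' \<le> p \<Longrightarrow> q' \<le> q \<Longrightarrow> p' + q' < K \<Longrightarrow> hdvd M (A p' q')"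
  using assms unfolding quadrant_finite_def by meson

lemma quadrant_finite_row:
  assumes "quadrant_finite M A"
  shows "bounded_below M (A p)"
proof -
  obtain K where K: "\<And>p' q'. p' \<le> p \<Longrightarrow> q' \<le> 0 \<Longrightarrow> p' + q' < K \<Longrightarrow> hdvd M (A p' q')"
    using quadrant_finiteE[OF assms] by blast
  show ?thesis
    by (rule bounded_belowI[of "min 0 (K - p)"], rule K) auto
qed

lemma quadrant_finite_add:
  assumes "quadrant_finite M A" "quadrant_finite M B"
  shows "quadrant_finite M (\<lambda>p q. A p q + B p q)"
  unfolding quadrant_finite_def
proof (intro allI)
  fix p q
  obtain K where K: "\<And>p' q'. p' \<le> p \<Longrightarrow> q' \<le> q \<Longrightarrow> p' + q' < K \<Longrightarrow> hdvd M (A p' q')"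
    using quadrant_finiteE[OF assms(1)] by blast
  obtain L where L: "\<And>p' q'. p' \<le> p \<Longrightarrow> q' \<le> q \<Longrightarrow> p' + q' < L \<Longrightarrow> hdvd M (B p' q')"
    using quadrant_finiteE[OF assms(2)] by blast
  show "\<exists>K. \<forall>p' q'. p' \<le> p \<longrightarrow> q' \<le> q \<longrightarrow> p' + q' < K \<longrightarrow> hdvd M (A p' q' + B p' q')"
    by (intro exI[of _ "min K L"] allI impI hdvd_add K L) auto
qed

lemma quadrant_finite_hom:
  "module_hom scale scale g \<Longrightarrow> quadrant_finite M A \<Longrightarrow> quadrant_finite M (\<lambda>p q. g (A p q))"
  unfolding quadrant_finite_def by (meson hdvd_hom)

lemma quadrant_finite_scale: "quadrant_finite M A \<Longrightarrow> quadrant_finite M (\<lambda>p q. r *s A p q)"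
  by (rule quadrant_finite_hom[OF module_hom_scale])

lemma quadrant_finite_diff:
  "quadrant_finite M A \<Longrightarrow> quadrant_finite M B \<Longrightarrow> quadrant_finite M (\<lambda>p q. A p q - B p q)"
  using quadrant_finite_add[of M A "\<lambda>p q. (- 1) *s B p q"] quadrant_finite_scale[of M B "- 1"] by simp

lemma quadrant_finite_sum:
  "(\<And>t. t \<in> J \<Longrightarrow> quadrant_finite M (A t)) \<Longrightarrow> quadrant_finite M (\<lambda>p q. \<Sum>t\<in>J. A t p q)"
proof (induction J rule: infinite_finite_induct)
  case (insert t J)
  then show ?case
    using quadrant_finite_add[of M "A t" "\<lambda>p q. \<Sum>t\<in>J. A t p q"] by simp
qed (simp_all add: quadrant_finite_def)

lemma quadrant_finite_fsum_apply:
  "(\<And>t. t \<in> Poly_Mapping.keys x \<Longrightarrow> quadrant_finite M (A t)) \<Longrightarrow>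
    quadrant_finite M (\<lambda>p q. fsum_apply (\<lambda>t. A t p q) x)"
  unfolding fsum_apply_def by (intro quadrant_finite_sum quadrant_finite_scale)

lemma quadrant_finite_lmul:
  assumes "quadrant_finite M A"
  shows "quadrant_finite M (\<lambda>p. lmul M g (A p))"
  unfolding quadrant_finite_def
proof (intro allI)
  fix p q
  let ?d = "fls_subdegree g"
  obtain K where K: "\<And>p' q'. p' \<le> p \<Longrightarrow> q' \<le> q - ?d \<Longrightarrow> p' + q' < K \<Longrightarrow> hdvd M (A p' q')"
    using quadrant_finiteE[OF assms] by blast
  have "hdvd M (lmul M g (A p') q')" if "p' \<le> p" "q' \<le> q" "p' + q' < K + ?d" for p' q'
  proof -
    have "hdvd M (fls_nth g i *k A p' (q' - i))" for i
      using that by (cases "i < ?d") (auto intro!: hdvd_scale K)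
    then show ?thesis
      unfolding lmul_def by (simp add: sum_mod_hdvd)
  qed
  then show "\<exists>K. \<forall>p' q'. p' \<le> p \<longrightarrow> q' \<le> q \<longrightarrow> p' + q' < K \<longrightarrow> hdvd M (lmul M g (A p') q')"
    by blast
qed

text \<open>
  Each multiplication by \<open>u + w\<close> moves the support one diagonal up. So only finitely many powers
  contribute to a given coefficient.
\<close>

lemma theta_pow_hdvd_below:
  assumes "\<And>p' q'. p' \<le> p \<Longrightarrow> q' \<le> q \<Longrightarrow> p' + q' < K \<Longrightarrow> hdvd M (A p' q')"
  shows "p' \<le> p \<Longrightarrow> q' \<le> q \<Longrightarrow> p' + q' < K + int j \<Longrightarrow> hdvd M ((theta ^^ j) A p' q')"
  by (induction j arbitrary: p' q') (auto simp: theta_def intro!: hdvd_add assms)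

lemma quadrant_finite_theta_pow:
  assumes "quadrant_finite M A"
  shows "quadrant_finite M ((theta ^^ n) A)"
  unfolding quadrant_finite_def
proof (intro allI)
  fix p q
  obtain K where K: "\<And>p' q'. p' \<le> p \<Longrightarrow> q' \<le> q \<Longrightarrow> p' + q' < K \<Longrightarrow> hdvd M (A p' q')"
    using quadrant_finiteE[OF assms] by blast
  have "hdvd M ((theta ^^ n) A p' q')" if "p' \<le> p" "q' \<le> q" "p' + q' < K + int n" for p' q'
    by (rule theta_pow_hdvd_below[of p q K]) (use K that in auto)
  then show "\<exists>K. \<forall>p' q'. p' \<le> p \<longrightarrow> q' \<le> q \<longrightarrow> p' + q' < K \<longrightarrow> hdvd M ((theta ^^ n) A p' q')"
    by (intro exI[of _ "K + int n"]) blast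
qed

lemma quadrant_finite_flip: "quadrant_finite M A \<Longrightarrow> quadrant_finite M (\<lambda>q p. A p q)"
  unfolding quadrant_finite_def by (metis add.commute)

lemma theta_pow_lmul:
  assumes "quadrant_finite M A"
  shows "(theta ^^ n) (\<lambda>p. lmul M g (A p)) p q \<approx>\<^bsub>M\<^esub> lmul M g ((theta ^^ n) A p) q"
proof -
  have "(theta ^^ n) (\<lambda>p q. sum_mod M (\<lambda>i. fls_nth g i *k A p (q - i))) p q \<approx>\<^bsub>M\<^esub>
      sum_mod M (\<lambda>i. (theta ^^ n) (\<lambda>p q. fls_nth g i *k A p (q - i)) p q)"
    using theta_pow_sum_mod[of M "\<lambda>i p q. fls_nth g i *k A p (q - i)"]
      summable_lmul[OF quadrant_finite_row[OF assms]] by blast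
  moreover have "(theta ^^ n) (\<lambda>p q. A p (q - i)) p q = (theta ^^ n) A p (q - i)" for i
    by (induction n arbitrary: p q) (auto simp: theta_def algebra_simps)
  ultimately show ?thesis
    by (simp add: lmul_def[abs_def] theta_pow_scale)
qed

text \<open>
  Membership in \<open>V((w))((u))\<close> modulo \<open>h^M\<close>.
\<close>

definition iterated_laurent :: "nat \<Rightarrow> (int \<Rightarrow> int \<Rightarrow> 'v) \<Rightarrow> bool" where
  "iterated_laurent M A \<longleftrightarrow> (\<exists>p0. \<forall>p<p0. \<forall>q. hdvd M (A p q)) \<and> (\<forall>p. bounded_below M (A p))"

lemma iterated_laurent_quadrant_finite:
  assumes "iterated_laurent M A"
  shows "quadrant_finite M A"
  unfolding quadrant_finite_def
proof (intro allI)
  fix p q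
  obtain p0 where p0: "\<And>p q. p < p0 \<Longrightarrow> hdvd M (A p q)"
    using assms unfolding iterated_laurent_def by blast
  obtain f where f: "\<And>p q. q < f p \<Longrightarrow> hdvd M (A p q)"
    using assms unfolding iterated_laurent_def bounded_below_def by metis
  define b where "b = Min (insert 0 (f ` {p0..p}))"
  have b: "b \<le> f p'" if "p0 \<le> p'" "p' \<le> p" for p'
    using that unfolding b_def by (intro Min_le) auto
  have "hdvd M (A p' q')" if "p' \<le> p" "q' \<le> q" "p' + q' < p0 + b" for p' q'
  proof (cases "p' < p0")
    case False
    then show ?thesis
      using b[of p'] that by (intro f) auto
  qed (rule p0)
  then show "\<exists>K. \<forall>p' q'. p' \<le> p \<longrightarrow> q' \<le> q \<longrightarrow> p' + q' < K \<longrightarrow> hdvd M (A p' q')"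
    by blast
qed

lemma iterated_laurent_theta_pow:
  assumes "iterated_laurent M A"
  shows "iterated_laurent M ((theta ^^ n) A)"
proof -
  obtain p0 where p0: "\<And>p q. p < p0 \<Longrightarrow> hdvd M (A p q)"
    using assms unfolding iterated_laurent_def by blast
  have "hdvd M ((theta ^^ n) A p q)" if "p < p0" for p q
    using that by (induction n arbitrary: p q) (auto simp: theta_def p0 intro!: hdvd_add)
  then show ?thesis
    using quadrant_finite_row quadrant_finite_theta_pow iterated_laurent_quadrant_finite assms
    unfolding iterated_laurent_def by blast
qed

lemma iterated_laurent_cong:
  assumes "\<And>p q. A p q \<approx>\<^bsub>M\<^esub> B p q"
  shows "iterated_laurent M A \<longleftrightarrow> iterated_laurent M B"
  by (simp add: iterated_laurent_def bounded_below_def hcong_hdvd[OF assms])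

lemma iterated_laurent_lmul:
  assumes "iterated_laurent M A"
  shows "iterated_laurent M (\<lambda>p. lmul M g (A p))"
  using assms unfolding iterated_laurent_def by (blast intro: hdvd_lmul bounded_below_lmul)

lemma iterated_laurent_add:
  assumes "iterated_laurent M A" "iterated_laurent M B"
  shows "iterated_laurent M (\<lambda>p q. A p q + B p q)"
proof -
  obtain p0 p1 where "\<forall>p<p0. \<forall>q. hdvd M (A p q)" "\<forall>p<p1. \<forall>q. hdvd M (B p q)"
    using assms unfolding iterated_laurent_def by blast
  then have "\<forall>p<min p0 p1. \<forall>q. hdvd M (A p q + B p q)"
    by (auto intro: hdvd_add)
  then show ?thesis
    using assms unfolding iterated_laurent_def by (blast intro: bounded_below_add)
qed

lemma iterated_laurent_scale:
  "iterated_laurent M A \<Longrightarrow> iterated_laurent M (\<lambda>p q. r *s A p q)"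
  unfolding iterated_laurent_def using bounded_below_scale[of M "A _" r] by (metis hdvd_scale)

lemma iterated_laurent_fsum_apply:
  assumes "\<And>t. t \<in> Poly_Mapping.keys x \<Longrightarrow> iterated_laurent M (A t)"
  shows "iterated_laurent M (\<lambda>p q. fsum_apply (\<lambda>t. A t p q) x)"
proof -
  have "iterated_laurent M (\<lambda>p q. \<Sum>t\<in>J. r t *s A t p q)"
    if "J \<subseteq> Poly_Mapping.keys x" for J r
    using that
  proof (induction J rule: infinite_finite_induct)
    case (insert t J)
    then show ?case
      using iterated_laurent_add[OF iterated_laurent_scale[OF assms], of t "\<lambda>p q. \<Sum>t\<in>J. r t *s A t p q"]
      by simp
  qed (simp_all add: iterated_laurent_def bounded_below_def)
  then show ?thesis
    unfolding fsum_apply_def by simp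
qed

text \<open>
  On \<open>V((w))((u))\<close> the coefficient of the lowest power of \<open>u\<close> in \<open>(u + w) A\<close> is \<open>w\<close> times that
  of \<open>A\<close>, so multiplication by \<open>u + w\<close> is injective. It is not on all families: the difference of
  the two expansions of \<open>1 / (u + w)\<close> is killed.
\<close>

lemma theta_pow_injective:
  assumes "iterated_laurent M A" "\<And>p q. hdvd M ((theta ^^ n) A p q)"
  shows "hdvd M (A p q)"
  using assms(2)
proof (induction n arbitrary: p q)
  case (Suc n)
  let ?B = "(theta ^^ n) A"
  have "hdvd M (?B p q)" for p q
  proof -
    obtain p0 where p0: "\<And>p q. p < p0 \<Longrightarrow> hdvd M (?B p q)"
      using iterated_laurent_theta_pow[OF assms(1)] unfolding iterated_laurent_def by blast
    have "hdvd M (?B (p0 - 1 + int k) q)" for k q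
    proof (induction k arbitrary: q)
      case (Suc k)
      have "hdvd M (?B (p0 - 1 + int k) (q + 1) + ?B (p0 + int k) q)"
        using Suc.prems
      proof -
        have "theta ?B (p0 + int k) (q + 1) = ?B (p0 - 1 + int k) (q + 1) + ?B (p0 + int k) q"
          by (simp add: theta_def algebra_simps)
        then show ?thesis
          using \<open>\<And>p q. hdvd M ((theta ^^ Suc n) A p q)\<close> by (metis comp_apply funpow.simps(2))
      qed
      from hdvd_diff[OF this Suc[of "q + 1"]] show ?case
        by simp
    qed (simp add: p0)
    from this[of "nat (p - p0 + 1)" q] p0[of p q] show ?thesis
      by (cases "p < p0") (auto simp: algebra_simps)
  qed
  then show ?case
    by (rule Suc.IH)
qed simp


section \<open>Multiplication by Laurent series in \<open>u + w\<close>\<close>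

text \<open>
  \<open>pmul M N f A\<close> is the product of \<open>A\<close> with the regular part of \<open>x^N f(x)\<close> at \<open>x = u + w\<close>.
\<close>

definition pmul :: "nat \<Rightarrow> nat \<Rightarrow> 'k fls \<Rightarrow> (int \<Rightarrow> int \<Rightarrow> 'v) \<Rightarrow> int \<Rightarrow> int \<Rightarrow> 'v" where
  "pmul M N f A p q = sum_mod M (\<lambda>j::nat. fls_nth f (int j - int N) *k (theta ^^ j) A p q)"

lemma summable_pmul:
  assumes "quadrant_finite M A"
  shows "summable_mod M (\<lambda>j::nat. c j *k (theta ^^ j) A p q)"
proof -
  obtain K where K: "\<And>p' q'. p' \<le> p \<Longrightarrow> q' \<le> q \<Longrightarrow> p' + q' < K \<Longrightarrow> hdvd M (A p' q')"
    using quadrant_finiteE[OF assms] by blast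
  show ?thesis
  proof (rule summable_modI)
    fix j assume j: "j \<notin> {..nat (p + q - K)}"
    have "hdvd M ((theta ^^ j) A p q)"
      by (rule theta_pow_hdvd_below[of p q K]) (use K j in auto)
    then show "hdvd M (c j *k (theta ^^ j) A p q)"
      by (rule hdvd_scale)
  qed simp
qed

lemma pmul_cong:
  assumes "\<And>p q. A p q \<approx>\<^bsub>M\<^esub> B p q"
  shows "pmul M N f A p q \<approx>\<^bsub>M\<^esub> pmul M N f B p q"
  unfolding pmul_def by (intro sum_mod_cong hcong_scale theta_pow_cong assms)

lemma hdvd_pmul: "m \<le> M \<Longrightarrow> (\<And>p q. hdvd m (A p q)) \<Longrightarrow> hdvd m (pmul M N f A p q)"
  unfolding pmul_def by (intro hdvd_sum_mod hdvd_scale hdvd_theta_pow)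

lemma pmul_diff:
  assumes "quadrant_finite M A" "quadrant_finite M B"
  shows "pmul M N f (\<lambda>p q. A p q - B p q) p q \<approx>\<^bsub>M\<^esub> pmul M N f A p q - pmul M N f B p q"
  unfolding pmul_def theta_pow_diff scale_right_diff_distrib
  using assms by (intro sum_mod_diff summable_pmul)

lemma pmul_add_left:
  assumes "quadrant_finite M A"
  shows "pmul M N (f + g) A p q \<approx>\<^bsub>M\<^esub> pmul M N f A p q + pmul M N g A p q"
  unfolding pmul_def fls_plus_nth fps_const_add_scale
  using assms by (intro sum_mod_add summable_pmul)

lemma pmul_const_mult:
  assumes "quadrant_finite M A"
  shows "pmul M N (fls_const s * f) A p q \<approx>\<^bsub>M\<^esub> s *k pmul M N f A p q"
  unfolding pmul_def fls_mult_const_nth fps_const_mult_scale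
  using assms by (intro hcong_sym[OF sum_mod_scale] summable_pmul)

text \<open>
  If \<open>x^N f\<close> has no pole, it is its own regular part, and so is its product with \<open>x^K\<close>.
\<close>

lemma pmul_shift:
  assumes "\<And>i. i < - int N \<Longrightarrow> fls_nth f i = 0"
  shows "pmul M (N + K) f A p q = pmul M N f ((theta ^^ K) A) p q"
proof -
  let ?a = "\<lambda>j. fls_nth f (int j - int (N + K)) *k (theta ^^ j) A p q"
  have "sum_mod M (\<lambda>j. ?a (j + K)) = sum_mod M ?a"
  proof (rule sum_mod_reindex)
    fix j assume "j \<notin> range (\<lambda>j. j + K)"
    then have "j < K"
      by (metis le_add_diff_inverse2 linorder_not_less rangeI)
    then show "hdvd M (?a j)"
      by (simp add: assms)
  qed (simp add: inj_def)
  then show ?thesis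
    unfolding pmul_def by (simp add: funpow_add)
qed

lemma pmul_one: "pmul M N 1 A p q \<approx>\<^bsub>M\<^esub> (theta ^^ N) A p q"
  unfolding pmul_def
  using sum_mod_single[of N M "\<lambda>j. fls_nth 1 (int j - int N) *k (theta ^^ j) A p q"] by simp

lemma pmul_flip: "pmul M N f (\<lambda>q p. A p q) q p = pmul M N f A p q"
  by (simp add: pmul_def theta_pow_flip[of _ A])

lemma quadrant_finite_pmul:
  assumes "quadrant_finite M A"
  shows "quadrant_finite M (pmul M N f A)"
  unfolding quadrant_finite_def
proof (intro allI)
  fix p q
  obtain K where K: "\<And>p' q'. p' \<le> p \<Longrightarrow> q' \<le> q \<Longrightarrow> p' + q' < K \<Longrightarrow> hdvd M (A p' q')"
    using quadrant_finiteE[OF assms] by blast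
  have "hdvd M (pmul M N f A p' q')" if "p' \<le> p" "q' \<le> q" "p' + q' < K" for p' q'
  proof -
    have "hdvd M ((theta ^^ j) A p' q')" for j
      by (rule theta_pow_hdvd_below[of p q K]) (use K that in auto)
    then show ?thesis
      unfolding pmul_def by (simp add: sum_mod_hdvd hdvd_scale)
  qed
  then show "\<exists>K. \<forall>p' q'. p' \<le> p \<longrightarrow> q' \<le> q \<longrightarrow> p' + q' < K \<longrightarrow> hdvd M (pmul M N f A p' q')"
    by blast
qed

lemma linear_mod_pmul:
  assumes "\<And>p q. linear_mod M (\<lambda>x. A x p q)" "\<And>x. quadrant_finite M (A x)"
  shows "linear_mod M (\<lambda>x. pmul M N f (A x) p q)"
  unfolding pmul_def
  by (rule linear_mod_sum_mod, rule linear_mod_comp[OF module_hom_scale linear_mod_theta_pow[OF assms(1)]],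
      rule summable_pmul[OF assms(2)])

text \<open>
  \<open>xpow M l A\<close> is \<open>(w + u)^l A\<close>, expanded in nonnegative powers of \<open>u\<close>.
\<close>

definition xpow :: "nat \<Rightarrow> int \<Rightarrow> (int \<Rightarrow> int \<Rightarrow> 'v) \<Rightarrow> int \<Rightarrow> int \<Rightarrow> 'v" where
  "xpow M l A p q = sum_mod M (\<lambda>m::nat. (of_int l gchoose m) *k A (p - int m) (q - l + int m))"

lemma summable_xpow:
  assumes "iterated_laurent M A"
  shows "summable_mod M (\<lambda>m::nat. c m *k A (p - int m) (q m))"
proof -
  obtain p0 where p0: "\<And>p q. p < p0 \<Longrightarrow> hdvd M (A p q)"
    using assms unfolding iterated_laurent_def by blast
  show ?thesis
  proof (rule summable_modI)
    fix m assume "m \<notin> {..nat (p - p0)}"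
    then show "hdvd M (c m *k A (p - int m) (q m))"
      by (intro hdvd_scale p0) auto
  qed simp
qed

lemma xpow_cong:
  assumes "\<And>p q. A p q \<approx>\<^bsub>M\<^esub> B p q"
  shows "xpow M l A p q \<approx>\<^bsub>M\<^esub> xpow M l B p q"
  unfolding xpow_def by (intro sum_mod_cong hcong_scale assms)

lemma xpow_0: "xpow M 0 A p q \<approx>\<^bsub>M\<^esub> A p q"
  unfolding xpow_def
  using sum_mod_single[of 0 M "\<lambda>m. (of_int 0 gchoose m) *k A (p - int m) (q - 0 + int m)"]
  by (simp add: gbinomial_0_left)

text \<open>
  Pascal's rule in the form in which a factor \<open>w + u\<close> produces it.
\<close>

lemma sum_mod_Pascal:
  fixes l :: int
  assumes "summable_mod M (\<lambda>m::nat. (of_int l gchoose m) *k a m)"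
    and "summable_mod M (\<lambda>m::nat. (of_int l gchoose m) *k a (Suc m))"
  shows "sum_mod M (\<lambda>m::nat. (of_int l gchoose m) *k a (Suc m)) + sum_mod M (\<lambda>m::nat. (of_int l gchoose m) *k a m)
    \<approx>\<^bsub>M\<^esub> sum_mod M (\<lambda>m::nat. (of_int (l + 1) gchoose m) *k a m)"
proof -
  let ?b = "\<lambda>m. (case m of 0 \<Rightarrow> 0 | Suc m' \<Rightarrow> of_int l gchoose m') *k a m"
  have eq: "sum_mod M (\<lambda>m. ?b (Suc m)) = sum_mod M ?b"
  proof (rule sum_mod_reindex)
    fix j assume "j \<notin> range Suc"
    then have "j = 0"
      by (metis not0_implies_Suc rangeI)
    then show "hdvd M (?b j)"
      by simp
  qed simp
  have "summable_mod M ?b"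
  proof (rule summable_modI)
    show "finite (insert 0 (Suc ` {m. \<not> hdvd M ((of_int l gchoose m) *k a (Suc m))}))"
      using assms(2) by (simp add: summable_mod_def)
    fix j assume "j \<notin> insert 0 (Suc ` {m. \<not> hdvd M ((of_int l gchoose m) *k a (Suc m))})"
    then show "hdvd M (?b j)"
      by (cases j) auto
  qed
  from sum_mod_add[OF this assms(1)]
  have "sum_mod M (\<lambda>m. ?b m + (of_int l gchoose m) *k a m) \<approx>\<^bsub>M\<^esub>
      sum_mod M (\<lambda>m. ?b (Suc m)) + sum_mod M (\<lambda>m::nat. (of_int l gchoose m) *k a m)"
    unfolding eq .
  moreover have "?b m + (of_int l gchoose m) *k a m = (of_int (l + 1) gchoose m) *k a m" for m
    by (cases m) (simp_all add: gbinomial_Suc_Suc fps_const_add_scale del: fps_const_add)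
  ultimately show ?thesis
    by (simp add: hcong_sym)
qed

lemma theta_xpow:
  assumes "iterated_laurent M A"
  shows "theta (xpow M l A) p q \<approx>\<^bsub>M\<^esub> xpow M (l + 1) A p q"
proof -
  let ?a = "\<lambda>m::nat. A (p - int m) (q - l - 1 + int m)"
  have "theta (xpow M l A) p q =
      sum_mod M (\<lambda>m::nat. (of_int l gchoose m) *k ?a (Suc m)) + sum_mod M (\<lambda>m::nat. (of_int l gchoose m) *k ?a m)"
    unfolding theta_def xpow_def by (simp add: algebra_simps)
  also have "\<dots> \<approx>\<^bsub>M\<^esub> sum_mod M (\<lambda>m::nat. (of_int (l + 1) gchoose m) *k ?a m)"
    using summable_xpow[OF assms, of _ p "\<lambda>m. q - l - 1 + int m"]
      summable_xpow[OF assms, of _ "p - 1" "\<lambda>m. q - l + int m"]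
    by (intro sum_mod_Pascal) (simp_all add: algebra_simps)
  also have "\<dots> = xpow M (l + 1) A p q"
    by (simp add: xpow_def diff_diff_eq)
  finally show ?thesis .
qed

lemma xpow_theta:
  assumes "iterated_laurent M A"
  shows "xpow M l (theta A) p q \<approx>\<^bsub>M\<^esub> xpow M (l + 1) A p q"
proof -
  let ?a = "\<lambda>m::nat. A (p - int m) (q - l - 1 + int m)"
  have s: "summable_mod M (\<lambda>m::nat. (of_int l gchoose m) *k ?a m)"
      "summable_mod M (\<lambda>m::nat. (of_int l gchoose m) *k ?a (Suc m))"
    using summable_xpow[OF assms, of _ p "\<lambda>m. q - l - 1 + int m"]
      summable_xpow[OF assms, of _ "p - 1" "\<lambda>m. q - l + int m"]
    by (simp_all add: algebra_simps)
  have "xpow M l (theta A) p q =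
      sum_mod M (\<lambda>m::nat. (of_int l gchoose m) *k ?a (Suc m) + (of_int l gchoose m) *k ?a m)"
    unfolding theta_def xpow_def by (simp add: algebra_simps)
  also have "\<dots> \<approx>\<^bsub>M\<^esub>
      sum_mod M (\<lambda>m::nat. (of_int l gchoose m) *k ?a (Suc m)) + sum_mod M (\<lambda>m::nat. (of_int l gchoose m) *k ?a m)"
    using s by (intro sum_mod_add)
  also have "\<dots> \<approx>\<^bsub>M\<^esub> sum_mod M (\<lambda>m::nat. (of_int (l + 1) gchoose m) *k ?a m)"
    using s by (intro sum_mod_Pascal)
  also have "\<dots> = xpow M (l + 1) A p q"
    by (simp add: xpow_def diff_diff_eq)
  finally show ?thesis .
qed

lemma theta_pow_xpow:
  assumes "iterated_laurent M A"
  shows "(theta ^^ n) (xpow M l A) p q \<approx>\<^bsub>M\<^esub> xpow M (l + int n) A p q"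
proof (induction n arbitrary: p q)
  case (Suc n)
  have "(theta ^^ Suc n) (xpow M l A) p q \<approx>\<^bsub>M\<^esub> theta (xpow M (l + int n) A) p q"
    unfolding theta_pow_Suc theta_def[of "xpow M (l + int n) A"] by (intro hcong_add Suc)
  also have "\<dots> \<approx>\<^bsub>M\<^esub> xpow M (l + int n + 1) A p q"
    by (rule theta_xpow[OF assms])
  finally show ?case
    by (simp add: algebra_simps)
qed simp

lemma xpow_theta_pow:
  assumes "iterated_laurent M A"
  shows "xpow M l ((theta ^^ n) A) p q \<approx>\<^bsub>M\<^esub> xpow M (l + int n) A p q"
proof (induction n arbitrary: l)
  case (Suc n)
  have "xpow M l ((theta ^^ Suc n) A) p q \<approx>\<^bsub>M\<^esub> xpow M (l + 1) ((theta ^^ n) A) p q"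
    using xpow_theta[OF iterated_laurent_theta_pow[OF assms]] by simp
  also have "\<dots> \<approx>\<^bsub>M\<^esub> xpow M (l + 1 + int n) A p q"
    by (rule Suc)
  finally show ?case
    by (simp add: algebra_simps)
qed simp

lemma xpow_nat:
  assumes "iterated_laurent M A"
  shows "xpow M (int n) A p q \<approx>\<^bsub>M\<^esub> (theta ^^ n) A p q"
  using hcong_trans[OF hcong_sym[OF xpow_theta_pow[OF assms, of 0 n]] xpow_0] by simp

lemma xpow_theta_pow_cancel:
  assumes "iterated_laurent M A"
  shows "xpow M (- int N) ((theta ^^ N) A) p q \<approx>\<^bsub>M\<^esub> A p q"
  using hcong_trans[OF xpow_theta_pow[OF assms, of "- int N" N p q]] xpow_0[of M A p q] by simp

text \<open>
  \<open>tmul M f A\<close> is \<open>f(w + u) A\<close>, expanded in nonnegative powers of \<open>u\<close>.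
\<close>

definition tmul :: "nat \<Rightarrow> 'k fls \<Rightarrow> (int \<Rightarrow> int \<Rightarrow> 'v) \<Rightarrow> int \<Rightarrow> int \<Rightarrow> 'v" where
  "tmul M f A p q = sum_mod M (\<lambda>(m::nat, i).
     ((of_int (i + int m) gchoose m) * fls_nth f (i + int m)) *k A (p - int m) (q - i))"

lemma summable_tmul:
  assumes "iterated_laurent M A"
  shows "summable_mod M (\<lambda>(m::nat, i).
    ((of_int (i + int m) gchoose m) * fls_nth f (i + int m)) *k A (p - int m) (q - i))"
    (is "summable_mod M ?F")
proof -
  obtain p0 where p0: "\<And>p q. p < p0 \<Longrightarrow> hdvd M (A p q)"
    using assms unfolding iterated_laurent_def by blast
  have rows: "bounded_below M (A p)" for p
    using assms unfolding iterated_laurent_def by blast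
  then obtain b where b: "\<And>p q. q < b p \<Longrightarrow> hdvd M (A p q)"
    unfolding bounded_below_def by metis
  show ?thesis
  proof (rule summable_modI)
    let ?S = "SIGMA m:{..nat (p - p0)}. {fls_subdegree f - int m..q - b (p - int m)}"
    show "finite ?S"
      by (rule finite_SigmaI) auto
    fix x assume "x \<notin> ?S"
    moreover obtain m i where [simp]: "x = (m, i)"
      by force
    ultimately consider "p - int m < p0" | "i + int m < fls_subdegree f" | "q - i < b (p - int m)"
      by force
    then show "hdvd M (?F x)"
      by cases (auto intro: hdvd_scale p0 b)
  qed
qed

text \<open>
  \<open>f(w + u)\<close> is summed either by powers of \<open>w + u\<close>, which shows how \<^const>\<open>theta\<close> acts, or by
  powers of \<open>u\<close>, which is the form in which Taylor expansions produce it.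
\<close>

lemma tmul_expand:
  assumes "iterated_laurent M A"
  shows "tmul M f A p q \<approx>\<^bsub>M\<^esub> sum_mod M (\<lambda>l. fls_nth f l *k xpow M l A p q)"
    and "summable_mod M (\<lambda>l. fls_nth f l *k xpow M l A p q)"
    and "tmul M f A p q \<approx>\<^bsub>M\<^esub> sum_mod M (\<lambda>m::nat. sum_mod M (\<lambda>i.
      ((of_int (i + int m) gchoose m) * fls_nth f (i + int m)) *k A (p - int m) (q - i)))"
proof -
  let ?F = "\<lambda>(m::nat, i). ((of_int (i + int m) gchoose m) * fls_nth f (i + int m)) *k A (p - int m) (q - i)"
  let ?G = "\<lambda>(l, m::nat). (fls_nth f l * (of_int l gchoose m)) *k A (p - int m) (q - l + int m)"
  \<comment> \<open>The power \<open>l = i + m\<close> of \<open>w + u\<close> replaces the power \<open>i\<close> of \<open>w\<close>.\<close>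
  let ?g = "\<lambda>(l, m::nat). (m, l - int m)"
  have g: "inj ?g" "range ?g = UNIV"
    by (auto simp: inj_def image_def) (metis add_diff_cancel)
  have Gg: "?F (?g x) = ?G x" for x
    by (auto simp: case_prod_unfold mult.commute algebra_simps)
  have F: "summable_mod M ?F"
    by (rule summable_tmul[OF assms])
  have G: "summable_mod M ?G"
    using summable_mod_reindex[OF g(1) F] unfolding Gg .
  have eta: "(\<lambda>(l, m). ?G (l, m)) = ?G"
    by auto
  have G': "summable_mod M (\<lambda>(l, m). ?G (l, m))"
    unfolding eta by (rule G)
  have x: "fls_nth f l *k xpow M l A p q \<approx>\<^bsub>M\<^esub> sum_mod M (\<lambda>m. ?G (l, m))" for l
    unfolding xpow_def
    using sum_mod_scale[OF summable_xpow[OF assms, of "\<lambda>m. of_int l gchoose m" p "\<lambda>m. q - l + int m"],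
        of "fps_const (fls_nth f l)"]
    by simp
  show "tmul M f A p q \<approx>\<^bsub>M\<^esub> sum_mod M (\<lambda>l. fls_nth f l *k xpow M l A p q)"
  proof -
    have "tmul M f A p q = sum_mod M (\<lambda>x. ?F (?g x))"
      unfolding tmul_def using sum_mod_reindex[OF g(1), of M ?F] g(2) by simp
    also have "\<dots> = sum_mod M ?G"
      by (simp only: Gg)
    also have "\<dots> \<approx>\<^bsub>M\<^esub> sum_mod M (\<lambda>l. sum_mod M (\<lambda>m. ?G (l, m)))"
      using hcong_sym[OF sum_mod_Fubini[OF G']] unfolding eta .
    also have "\<dots> \<approx>\<^bsub>M\<^esub> sum_mod M (\<lambda>l. fls_nth f l *k xpow M l A p q)"
      by (intro sum_mod_cong hcong_sym[OF x])
    finally show ?thesis .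
  qed
  have "summable_mod M (\<lambda>l. sum_mod M (\<lambda>m. ?G (l, m)))"
    by (rule summable_mod_iterated[OF G'])
  then show "summable_mod M (\<lambda>l. fls_nth f l *k xpow M l A p q)"
    by (subst summable_mod_cong[where b = "\<lambda>l. sum_mod M (\<lambda>m. ?G (l, m))"]) (rule x)
  show "tmul M f A p q \<approx>\<^bsub>M\<^esub> sum_mod M (\<lambda>m::nat. sum_mod M (\<lambda>i.
      ((of_int (i + int m) gchoose m) * fls_nth f (i + int m)) *k A (p - int m) (q - i)))"
    unfolding tmul_def using F by (intro hcong_sym[OF sum_mod_Fubini]) simp
qed

lemma tmul_fsum_apply:
  assumes "\<And>t. t \<in> Poly_Mapping.keys x \<Longrightarrow> iterated_laurent M (A t)"
  shows "tmul M f (\<lambda>p q. fsum_apply (\<lambda>t. A t p q) x) p q \<approx>\<^bsub>M\<^esub> fsum_apply (\<lambda>t. tmul M f (A t) p q) x"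
proof -
  let ?c = "\<lambda>(m::nat, i). (of_int (i + int m) gchoose m) * fls_nth f (i + int m)"
  have "sum_mod M (\<lambda>s. fsum_apply (\<lambda>t. ?c s *k A t (p - int (fst s)) (q - snd s)) x) \<approx>\<^bsub>M\<^esub>
      fsum_apply (\<lambda>t. sum_mod M (\<lambda>s. ?c s *k A t (p - int (fst s)) (q - snd s))) x"
    using summable_tmul[OF assms, of _ f p q] by (intro sum_mod_fsum_apply) (simp add: case_prod_unfold)
  then show ?thesis
    by (simp add: tmul_def fsum_apply_scale case_prod_unfold)
qed

text \<open>
  Multiplying by a large power of \<open>w + u\<close> removes the pole of \<open>f\<close>, and then it does not matter
  in which direction \<open>f(w + u)\<close> is expanded.
\<close>

lemma theta_pow_tmul:
  assumes A: "iterated_laurent M A" and f: "\<And>i. i < - int N \<Longrightarrow> fls_nth f i = 0"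
  shows "(theta ^^ N) (tmul M f A) p q \<approx>\<^bsub>M\<^esub> pmul M N f A p q"
proof -
  let ?a = "\<lambda>l. fls_nth f l *k xpow M (l + int N) A p q"
  have "(theta ^^ N) (tmul M f A) p q \<approx>\<^bsub>M\<^esub>
      (theta ^^ N) (\<lambda>p q. sum_mod M (\<lambda>l. fls_nth f l *k xpow M l A p q)) p q"
    by (intro theta_pow_cong tmul_expand[OF A])
  also have "\<dots> \<approx>\<^bsub>M\<^esub> sum_mod M (\<lambda>l. (theta ^^ N) (\<lambda>p q. fls_nth f l *k xpow M l A p q) p q)"
    using theta_pow_sum_mod[of M "\<lambda>l p q. fls_nth f l *k xpow M l A p q"] tmul_expand(2)[OF A]
    by blast
  also have "\<dots> \<approx>\<^bsub>M\<^esub> sum_mod M ?a"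
    unfolding theta_pow_scale by (intro sum_mod_cong hcong_scale theta_pow_xpow A)
  also have "\<dots> = sum_mod M (\<lambda>j::nat. ?a (int j - int N))"
  proof (rule sum_mod_reindex[symmetric])
    fix l assume "l \<notin> range (\<lambda>j. int j - int N)"
    moreover have "l = int (nat (l + int N)) - int N" if "\<not> l < - int N"
      using that by simp
    ultimately have "l < - int N"
      by blast
    then show "hdvd M (?a l)"
      by (simp add: f)
  qed (simp add: inj_def)
  also have "\<dots> \<approx>\<^bsub>M\<^esub> pmul M N f A p q"
    unfolding pmul_def using xpow_nat[OF A] by (intro sum_mod_cong hcong_scale) simp
  finally show ?thesis .
qed


section \<open>Products with Laurent series in \<open>z1 - z2\<close>\<close>

lemma funpow_fls_deriv_nth:
  "fls_nth ((fls_deriv ^^ m) f) i =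
    fact m * (of_int (i + int m) gchoose m) * fls_nth (f :: 'k fls) (i + int m)"
proof (induction m arbitrary: i)
  case (Suc m)
  let ?a = "of_int (i + int (Suc m)) :: 'k"
  have *: "of_nat (Suc m) * (?a gchoose Suc m) = of_int (i + 1) * (?a gchoose m)"
    using gbinomial_mult_1[of ?a m] by (simp add: algebra_simps)
  have "fls_nth ((fls_deriv ^^ Suc m) f) i =
      fact m * (of_int (i + 1) * (?a gchoose m)) * fls_nth f (i + int (Suc m))"
    by (simp add: Suc algebra_simps)
  also have "\<dots> = fact (Suc m) * (?a gchoose Suc m) * fls_nth f (i + int (Suc m))"
    unfolding *[symmetric] by (simp add: algebra_simps)
  finally show ?case .
qed simp

lemma fls_taylor_nth:
  "fls_nth (fls_taylor s f) n =
    (if n < 0 then 0 else fls_const (s ^ nat n / fact (nat n)) * (fls_deriv ^^ nat n) f)"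
  by (simp add: fls_taylor_def)

lemma fls_taylor_nth_nth:
  "fls_nth (fls_nth (fls_taylor s f) (int m)) i =
    s ^ m * ((of_int (i + int m) gchoose m) * fls_nth (f :: 'k fls) (i + int m))"
  by (simp add: fls_taylor_nth funpow_fls_deriv_nth)

text \<open>
  \<open>alt q x\<close> is \<open>(-1)^q x\<close>: on coefficients it realises the substitution of \<open>-z\<close> for \<open>z\<close>.
\<close>

definition alt :: "int \<Rightarrow> 'v \<Rightarrow> 'v" where
  "alt q x = (if even q then x else - x)"

lemma module_hom_alt: "module_hom scale scale (alt q)"
  by unfold_locales (auto simp: alt_def)

lemma hdvd_alt_iff [simp]: "hdvd M (alt q x) \<longleftrightarrow> hdvd M x"
  by (simp add: alt_def)

lemma alt_sum_mod: "alt q (sum_mod M a) = sum_mod M (\<lambda>i. alt q (a i))"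
  by (simp add: sum_mod_def module_hom.sum[OF module_hom_alt])

text \<open>
  After the substitution of \<open>-z2\<close> for \<open>z2\<close>, the expansion of \<open>f(z1 - z2)\<close> in powers of \<open>z2\<close> is
  that of \<open>f(z1 + z2)\<close>. The variable of expansion is the first one in \<^const>\<open>tmul\<close> but the
  second one in \<^const>\<open>series_mult\<close>, hence the exchanged arguments.
\<close>

lemma series_mult_taylor:
  "alt q (series_mult M (fls_taylor (- 1) f) A p q) = tmul M f (\<lambda>q p. alt q (A p q)) q p"
proof -
  let ?a = "\<lambda>(i, j). alt q (fls_nth (fls_nth (fls_taylor (- 1) f) j) i *k A (p - i) (q - j))"
  let ?g = "\<lambda>(m::nat, i::int). (i, int m)"
  have *: "((of_int (i + int m) gchoose m) * fls_nth f (i + int m)) *k alt (q - int m) (A (p - i) (q - int m))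
      = ?a (?g (m, i))" for m :: nat and i
  proof -
    let ?c = "(of_int (i + int m) gchoose m) * fls_nth f (i + int m)"
    have "?c *k alt (q - int m) x = alt q (((- 1) ^ m * ?c) *k x)" for x
      by (cases "even m"; cases "even q") (auto simp: alt_def simp flip: fps_const_neg)
    then show ?thesis
      by (simp add: fls_taylor_nth_nth)
  qed
  have "tmul M f (\<lambda>q p. alt q (A p q)) q p = sum_mod M (\<lambda>x. ?a (?g x))"
    unfolding tmul_def * by (simp add: case_prod_unfold)
  also have "\<dots> = sum_mod M ?a"
  proof (rule sum_mod_reindex)
    fix x assume x: "x \<notin> range ?g"
    obtain i j where [simp]: "x = (i, j)"
      by force
    have "j < 0"
    proof (rule ccontr)
      assume "\<not> j < 0"
      then have "x = ?g (nat j, i)"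
        by simp
      then show False
        using x by blast
    qed
    then show "hdvd M (?a x)"
      by (simp add: fls_taylor_nth)
  qed (auto simp: inj_def)
  finally show ?thesis
    unfolding series_mult_def alt_sum_mod by (simp add: case_prod_unfold)
qed

text \<open>
  Each factor \<open>z1 - z2\<close> acts on \<open>A\<close> as a difference operator; the sign \<open>(-1)^q\<close> turns that operator
  into \<^const>\<open>theta\<close>. Finiteness is assumed for the pair \<open>g, A\<close> rather than for \<open>A\<close>, as it holds
  for different reasons on the two sides of (QA1): on the side without \<open>S\<close>, the series \<open>A\<close> need not
  lie in \<open>V((z1))((z2))\<close>, but \<open>g = 1\<close>.
\<close>

lemma alt_series_mult_power:
  assumes "\<And>p q. finite {(i, j). fls_nth (fls_nth g j) i \<noteq> 0 \<and> \<not> hdvd M (A (p - i) (q - j))}"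
  shows "alt q (series_mult M ((fls_const fls_X - fls_X) ^ N * g) A p q) \<approx>\<^bsub>M\<^esub>
      (theta ^^ N) (\<lambda>p q. alt q (series_mult M g A p q)) p q
    \<and> finite {(i, j). fls_nth (fls_nth ((fls_const fls_X - fls_X) ^ N * g) j) i \<noteq> 0 \<and>
        \<not> hdvd M (A (p - i) (q - j))}"
proof (induction N arbitrary: p q)
  case 0
  then show ?case
    using assms by simp
next
  case (Suc N)
  define G where "G = (fls_const fls_X - fls_X) ^ N * g"
  define G' where "G' = (fls_const fls_X - fls_X) ^ Suc N * g"
  have "G' = (fls_const fls_X - fls_X) * G"
    by (simp add: G_def G'_def mult.assoc)
  then have nth: "fls_nth (fls_nth G' j) i = fls_nth (fls_nth G j) (i - 1) - fls_nth (fls_nth G (j - 1)) i" for i j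
    by (simp add: left_diff_distrib fls_X_times_conv_shift)
  let ?S = "\<lambda>p q. {(i, j). fls_nth (fls_nth G j) i \<noteq> 0 \<and> \<not> hdvd M (A (p - i) (q - j))}"
  have finS: "finite (?S p q)" for p q
    using Suc unfolding G_def by blast
  have fin: "finite {(i, j). fls_nth (fls_nth G' j) i \<noteq> 0 \<and> \<not> hdvd M (A (p - i) (q - j))}"
  proof (rule finite_subset)
    show "finite ((\<lambda>(i, j). (i + 1, j)) ` ?S (p - 1) q \<union> (\<lambda>(i, j). (i, j + 1)) ` ?S p (q - 1))"
      using finS by blast
    show "{(i, j). fls_nth (fls_nth G' j) i \<noteq> 0 \<and> \<not> hdvd M (A (p - i) (q - j))}
      \<subseteq> (\<lambda>(i, j). (i + 1, j)) ` ?S (p - 1) q \<union> (\<lambda>(i, j). (i, j + 1)) ` ?S p (q - 1)"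
    proof clarify
      fix i j
      assume *: "fls_nth (fls_nth G' j) i \<noteq> 0" "\<not> hdvd M (A (p - i) (q - j))"
        "(i, j) \<notin> (\<lambda>(i, j). (i, j + 1)) ` ?S p (q - 1)"
      have "(i, j - 1) \<notin> ?S p (q - 1)"
        using *(3) by (metis (no_types, lifting) case_prod_conv diff_add_cancel image_eqI)
      then have "(i - 1, j) \<in> ?S (p - 1) q"
        using *(1,2) by (auto simp: nth algebra_simps)
      moreover have "(i, j) = (\<lambda>(i, j). (i + 1, j)) (i - 1, j)"
        by simp
      ultimately show "(i, j) \<in> (\<lambda>(i, j). (i + 1, j)) ` ?S (p - 1) q"
        by (rule rev_image_eqI)
    qed
  qed
  let ?a = "\<lambda>p q (i, j). fls_nth (fls_nth G j) i *k A (p - i) (q - j)"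
  have summ: "summable_mod M (?a p q)" for p q
    by (rule summable_modI[OF finS[of p q]]) (auto intro: hdvd_scale)
  let ?s1 = "\<lambda>(i, j). (i - 1, j) :: int \<times> int" and ?s2 = "\<lambda>(i, j). (i, j - 1) :: int \<times> int"
  have s: "inj ?s1" "inj ?s2" "range ?s1 = UNIV" "range ?s2 = UNIV"
    by (auto simp: inj_def image_def) (metis add_diff_cancel)+
  have "series_mult M G' A p q =
      sum_mod M (\<lambda>x. ?a (p - 1) q (?s1 x) - ?a p (q - 1) (?s2 x))"
    unfolding series_mult_def
    by (rule arg_cong[where f = "sum_mod M"])
      (auto simp: nth fun_eq_iff algebra_simps simp flip: fps_const_sub)
  also have "\<dots> \<approx>\<^bsub>M\<^esub> sum_mod M (\<lambda>x. ?a (p - 1) q (?s1 x)) - sum_mod M (\<lambda>x. ?a p (q - 1) (?s2 x))"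
    by (rule sum_mod_diff[OF summable_mod_reindex[OF s(1) summ[of "p - 1" q]]
          summable_mod_reindex[OF s(2) summ[of p "q - 1"]]])
  also have "\<dots> = series_mult M G A (p - 1) q - series_mult M G A p (q - 1)"
    unfolding series_mult_def using sum_mod_reindex[OF s(1), of M "?a (p - 1) q"]
      sum_mod_reindex[OF s(2), of M "?a p (q - 1)"] s(3,4) by simp
  finally have "alt q (series_mult M G' A p q) \<approx>\<^bsub>M\<^esub>
      alt q (series_mult M G A (p - 1) q) - alt q (series_mult M G A p (q - 1))"
    using hcong_hom[OF module_hom_alt] module_hom.diff[OF module_hom_alt] by metis
  also have "\<dots> = alt q (series_mult M G A (p - 1) q) + alt (q - 1) (series_mult M G A p (q - 1))"
    by (simp add: alt_def)
  also have "\<dots> \<approx>\<^bsub>M\<^esub> (theta ^^ Suc N) (\<lambda>p q. alt q (series_mult M g A p q)) p q"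
    unfolding theta_pow_Suc using Suc unfolding G_def by (intro hcong_add) auto
  finally show ?case
    using fin unfolding G'_def by blast
qed

lemma finite_support_product:
  assumes "iterated_laurent M (\<lambda>q p. A p q)"
  shows "finite {(i, j). fls_nth (fls_nth g j) i \<noteq> 0 \<and> \<not> hdvd M (A (p - i) (q - j))}"
proof -
  obtain q0 where q0: "\<And>p q. q < q0 \<Longrightarrow> hdvd M (A p q)"
    using assms unfolding iterated_laurent_def by blast
  have rows: "bounded_below M (\<lambda>p. A p q)" for q
    using assms unfolding iterated_laurent_def by blast
  then obtain b where b: "\<And>p q. p < b q \<Longrightarrow> hdvd M (A p q)"
    unfolding bounded_below_def by metis
  let ?S = "SIGMA j:{fls_subdegree g..q - q0}. {fls_subdegree (fls_nth g j)..p - b (q - j)}"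
  have "(j, i) \<in> ?S" if "fls_nth (fls_nth g j) i \<noteq> 0" "\<not> hdvd M (A (p - i) (q - j))" for i j
  proof -
    have "\<not> j < fls_subdegree g"
      using that(1) by auto
    moreover have "\<not> i < fls_subdegree (fls_nth g j)"
      using that(1) by auto
    moreover have "\<not> q - j < q0" "\<not> p - i < b (q - j)"
      using that(2) q0 b by blast+
    ultimately show ?thesis
      by auto
  qed
  then have "{(i, j). fls_nth (fls_nth g j) i \<noteq> 0 \<and> \<not> hdvd M (A (p - i) (q - j))} \<subseteq> prod.swap ` ?S"
    by force
  moreover have "finite (prod.swap ` ?S)"
    by (intro finite_imageI finite_SigmaI) auto
  ultimately show ?thesis
    by (rule finite_subset)
qed


section \<open>The residue at \<open>z = w\<close>\<close>

lemma summable_reexpand: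
  assumes "iterated_laurent M (\<lambda>q p. A p q)"
  shows "summable_mod M (\<lambda>m::nat. c m *k A (f m) (q - int m))"
  using summable_xpow[OF assms] by blast

text \<open>
  Multiplying by \<open>z\<close> before the substitution \<open>z = x + w\<close> is multiplying by \<open>x + w\<close> after it.
\<close>

lemma theta_reexpand:
  assumes "iterated_laurent M (\<lambda>q p. A p q)"
  shows "(theta ^^ N) (reexpand M 0 A) p q \<approx>\<^bsub>M\<^esub> reexpand M N A p q"
proof (induction N arbitrary: p q)
  case (Suc N)
  let ?a = "\<lambda>m::nat. A (p + int m - int N - 1) (q - int m)"
  let ?b = "\<lambda>m::nat. A (p + int m - int N) (q - 1 - int m)"
  let ?d = "\<lambda>m. (case m of 0 \<Rightarrow> 0 | Suc m' \<Rightarrow> (of_int (p + int m - 1) gchoose m')) *k ?a m"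
  have eq: "sum_mod M (\<lambda>m. ?d (Suc m)) = sum_mod M ?d"
  proof (rule sum_mod_reindex)
    fix j assume "j \<notin> range Suc"
    then have "j = 0"
      by (metis not0_implies_Suc rangeI)
    then show "hdvd M (?d j)"
      by simp
  qed simp
  have 1: "reexpand M N A (p - 1) q = sum_mod M (\<lambda>m::nat. (of_int (p - 1 + int m) gchoose m) *k ?a m)"
    unfolding reexpand_def by (simp add: algebra_simps)
  have 2: "reexpand M N A p (q - 1) = sum_mod M ?d"
    unfolding eq[symmetric] reexpand_def by (simp add: algebra_simps)
  have "(theta ^^ Suc N) (reexpand M 0 A) p q \<approx>\<^bsub>M\<^esub>
      sum_mod M (\<lambda>m::nat. (of_int (p - 1 + int m) gchoose m) *k ?a m) + sum_mod M ?d"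
    using hcong_add[OF Suc[of "p - 1" q] Suc[of p "q - 1"]] unfolding theta_pow_Suc 1 2 .
  also have "\<dots> \<approx>\<^bsub>M\<^esub> sum_mod M (\<lambda>m::nat. (of_int (p - 1 + int m) gchoose m) *k ?a m + ?d m)"
    by (intro hcong_sym[OF sum_mod_add] summable_reexpand assms)
  also have "\<dots> = reexpand M (Suc N) A p q"
    unfolding reexpand_def
  proof (rule arg_cong[where f = "sum_mod M"], rule ext)
    fix m
    have "(of_int (p - 1 + int m) gchoose m) + (case m of 0 \<Rightarrow> 0 | Suc m' \<Rightarrow> (of_int (p + int m - 1) gchoose m'))
        = (of_int (p + int m) gchoose m :: 'k)"
    proof (cases m)
      case (Suc m')
      then show ?thesis
        using gbinomial_Suc_Suc[of "of_int (p + int m' ) :: 'k" m'] by (simp add: algebra_simps)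
    qed simp
    then show "(of_int (p - 1 + int m) gchoose m) *k ?a m + ?d m =
        (of_int (p + int m) gchoose m) *k A (p + int m - int (Suc N)) (q - int m)"
      by (simp add: algebra_simps flip: fps_const_add_scale)
  qed
  finally show ?case .
qed simp

lemma suitable_iff: "suitable M N A \<longleftrightarrow> iterated_laurent M (reexpand M N A)"
  by (simp add: suitable_def iterated_laurent_def bounded_below_def)

lemma residue_coeff_eq:
  "residue_coeff M N n A j = xpow M (- int N) (reexpand M N A) (- n - 1) j"
  by (simp add: residue_coeff_def xpow_def)

text \<open>
  \<open>N\<close> need not be the exponent \<open>L\<close> used to compute the residue. If \<open>z^L\<close> is suitable, both
  \<open>z^L A\<close> and \<open>(x + w)^L B\<close> lie in \<open>V((w))((x))\<close>, where \<open>(x + w)^N\<close> can be cancelled, so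
  they agree; dividing by \<open>(w + x)^L\<close> leaves \<open>B\<close>.
\<close>

lemma has_residue_if_associative:
  assumes A: "\<And>M. iterated_laurent M (\<lambda>q p. A p q)" and B: "\<And>M. iterated_laurent M B"
    and eq: "\<And>M. \<exists>N. \<forall>p q. (theta ^^ N) (reexpand M 0 A) p q \<approx>\<^bsub>M\<^esub> (theta ^^ N) B p q"
  shows "has_residue n A (B (- n - 1))"
  unfolding has_residue_def
proof (intro allI conjI impI)
  fix M
  obtain N where N: "\<And>p q. (theta ^^ N) (reexpand M 0 A) p q \<approx>\<^bsub>M\<^esub> (theta ^^ N) B p q"
    using eq by blast
  have N': "reexpand M N A p q \<approx>\<^bsub>M\<^esub> (theta ^^ N) B p q" for p q
    using hcong_trans[OF hcong_sym[OF theta_reexpand[OF A]] N] .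
  show "\<exists>N. suitable M N A"
    unfolding suitable_iff
    by (rule exI[of _ N], subst iterated_laurent_cong[where B = "(theta ^^ N) B"])
      (rule N', rule iterated_laurent_theta_pow[OF B])
  fix L j
  assume L: "suitable M L A"
  \<comment> \<open>The difference lies in \<open>V((w))((x))\<close> and is killed by \<open>(x + w)^N\<close>.\<close>
  let ?D = "\<lambda>p q. reexpand M L A p q - (theta ^^ L) B p q"
  have D: "iterated_laurent M ?D"
    using iterated_laurent_add[OF L[unfolded suitable_iff]
        iterated_laurent_scale[OF iterated_laurent_theta_pow[OF B], of M "- 1" L]] by simp
  have "hdvd M ((theta ^^ N) ?D p q)" for p q
  proof -
    have comm: "(theta ^^ N) ((theta ^^ L) X) = (theta ^^ L) ((theta ^^ N) X)" for X
      by (metis add.commute comp_apply funpow_add)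
    have "(theta ^^ N) ?D p q = (theta ^^ N) (reexpand M L A) p q - (theta ^^ L) ((theta ^^ N) B) p q"
      by (simp add: theta_pow_diff comm)
    also have "\<dots> \<approx>\<^bsub>M\<^esub> (theta ^^ N) ((theta ^^ L) (reexpand M 0 A)) p q - (theta ^^ L) ((theta ^^ N) B) p q"
      by (intro hcong_diff hcong_refl theta_pow_cong hcong_sym[OF theta_reexpand] A)
    also have "\<dots> = (theta ^^ L) ((theta ^^ N) (reexpand M 0 A)) p q - (theta ^^ L) ((theta ^^ N) B) p q"
      by (simp only: comm)
    also have "\<dots> \<approx>\<^bsub>M\<^esub> 0"
      using theta_pow_cong[OF N, where n = L and p = p and q = q] by (simp add: hcong_def)
    finally show ?thesis
      by simp
  qed
  then have "reexpand M L A p q \<approx>\<^bsub>M\<^esub> (theta ^^ L) B p q" for p q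
    unfolding hcong_def by (rule theta_pow_injective[OF D])
  then have "residue_coeff M L n A j \<approx>\<^bsub>M\<^esub> xpow M (- int L) ((theta ^^ L) B) (- n - 1) j"
    unfolding residue_coeff_eq by (rule xpow_cong)
  also have "\<dots> \<approx>\<^bsub>M\<^esub> B (- n - 1) j"
    by (rule xpow_theta_pow_cancel[OF B])
  finally show "hdvd M (B (- n - 1) j - residue_coeff M L n A j)"
    using hcong_sym unfolding hcong_def by blast
qed

text \<open>
  A suitable exponent exists for each \<open>M\<close>, so the residue is determined modulo every power of \<open>h\<close>.
\<close>

lemma has_residue_unique:
  assumes "has_residue n A r" "has_residue n A r'"
  shows "r j = r' j"
proof -
  have "hdvd M (r j - r' j)" for M
  proof -
    obtain N where N: "suitable M N A"
      using assms(1) unfolding has_residue_def by blast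
    then have "hdvd M (r j - residue_coeff M N n A j)" "hdvd M (r' j - residue_coeff M N n A j)"
      using assms unfolding has_residue_def by blast+
    then show ?thesis
      using hdvd_diff by fastforce
  qed
  then show ?thesis
    using hdvd_all_imp_zero by fastforce
qed

end


section \<open>The translation operator\<close>

context braided_VOA
begin

lemma Y_zero_right [simp]: "Y v 0 n = 0"
  using module_hom.zero[OF Y_linear_right] .

lemma bounded_below_Y: "bounded_below M (Y v w)"
  using Y_laurent unfolding laurent_def bounded_below_def by blast

text \<open>
  The divided powers \<open>T^k / k!\<close>.
\<close>

definition Tdiv :: "nat \<Rightarrow> 'v \<Rightarrow> 'v" where
  "Tdiv k x = (1 / fact k) *k (T ^^ k) x"

lemma Tdiv_0 [simp]: "Tdiv 0 x = x"
  by (simp add: Tdiv_def)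

lemma T_add: "T (x + y) = T x + T y"
  using module_hom.add[OF T_linear] .

lemma T_scale: "T (r *s x) = r *s T x"
  using module_hom.scale[OF T_linear] .

lemma T_sum: "T (sum a J) = (\<Sum>i\<in>J. T (a i))"
  using module_hom.sum[OF T_linear] .

lemma Tdiv_linear: "module_hom scale scale (Tdiv k)"
proof unfold_locales
  have add: "(T ^^ k) (x + y) = (T ^^ k) x + (T ^^ k) y" for x y
    by (induction k) (auto simp: T_add)
  have scale: "(T ^^ k) (r *s x) = r *s (T ^^ k) x" for r x
    by (induction k) (auto simp: T_scale)
  show "Tdiv k (x + y) = Tdiv k x + Tdiv k y" for x y
    by (simp add: Tdiv_def add scale_right_distrib)
  show "Tdiv k (r *s x) = r *s Tdiv k x" for r x
    by (simp add: Tdiv_def scale mult.commute)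
qed

lemma T_Tdiv: "T (Tdiv k x) = of_nat (Suc k) *k Tdiv (Suc k) x"
proof -
  have "of_nat (Suc k) * (1 / fact (Suc k)) = (1 / fact k :: 'k)"
    by (simp add: field_simps del: of_nat_Suc)
  moreover have "T (Tdiv k x) = (1 / fact k) *k (T ^^ Suc k) x"
    by (simp add: Tdiv_def T_scale)
  ultimately have "T (Tdiv k x) = (of_nat (Suc k) * (1 / fact (Suc k))) *k (T ^^ Suc k) x"
    by (simp only:)
  then show ?thesis
    by (simp only: fps_const_mult_scale Tdiv_def)
qed

lemma T_Y: "T (Y v w n) = Y v (T w) n + of_int (n + 1) *k Y v w (n + 1)"
  using QA2_derivative[of n v w] by (simp add: fps_of_int[symmetric] del: fps_of_int)

text \<open>
  This is \<open>e^(xT) Y(v,z) = Y(v,z+x) e^(xT)\<close>, expanded in nonnegative powers of \<open>x\<close>.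
\<close>

lemma Tdiv_Y:
  "Tdiv k (Y v w n) = (\<Sum>i\<le>k. (of_int (n + int i) gchoose i) *k Y v (Tdiv (k - i) w) (n + int i))"
proof (induction k)
  case (Suc k)
  let ?C = "\<lambda>i. of_int (n + int i) gchoose i :: 'k"
  let ?y = "\<lambda>i. Y v (Tdiv (Suc k - i) w) (n + int i)"
  have "of_nat (Suc k) *k Tdiv (Suc k) (Y v w n) = T (Tdiv k (Y v w n))"
    by (simp only: T_Tdiv)
  \<comment> \<open>The two sums contribute the parts \<open>k + 1 - i\<close> and \<open>i\<close> of the factor \<open>k + 1\<close>.\<close>
  also have "\<dots> = (\<Sum>i\<le>k. ?C i *k Y v (T (Tdiv (k - i) w)) (n + int i)) +
      (\<Sum>i\<le>k. ?C i *k (of_int (n + int i + 1) *k Y v (Tdiv (k - i) w) (n + int i + 1)))"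
    by (simp add: Suc T_sum T_scale T_Y scale_right_distrib sum.distrib del: fps_const_mult scale_scale of_int_add)
  also have "(\<Sum>i\<le>k. ?C i *k Y v (T (Tdiv (k - i) w)) (n + int i)) =
      (\<Sum>i\<le>Suc k. (?C i * of_nat (Suc k - i)) *k ?y i)"
    by (simp add: T_Tdiv module_hom.scale[OF Y_linear_right] Suc_diff_le fps_const_mult_scale
        del: fps_const_mult scale_scale of_nat_Suc of_int_add of_nat_diff)
  also have "(\<Sum>i\<le>k. ?C i *k (of_int (n + int i + 1) *k Y v (Tdiv (k - i) w) (n + int i + 1))) =
      (\<Sum>i\<le>Suc k. (?C i * of_nat i) *k ?y i)"
  proof -
    have *: "?C i * of_int (n + int i + 1) = ?C (Suc i) * of_nat (Suc i)" for i
      using Suc_times_gbinomial[of i "of_int (n + int i) :: 'k"] by (simp add: algebra_simps)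
    have "(\<Sum>i\<le>k. ?C i *k (of_int (n + int i + 1) *k Y v (Tdiv (k - i) w) (n + int i + 1))) =
        (\<Sum>i\<le>k. (?C (Suc i) * of_nat (Suc i)) *k Y v (Tdiv (k - i) w) (n + int i + 1))"
      by (simp only: fps_const_mult_scale[symmetric] *)
    also have "\<dots> = (\<Sum>i\<le>k. (?C (Suc i) * of_nat (Suc i)) *k ?y (Suc i))"
      by (simp add: ac_simps)
    also have "\<dots> = (\<Sum>i\<le>Suc k. (?C i * of_nat i) *k ?y i)"
      by (simp only: sum.atMost_Suc_shift) simp
    finally show ?thesis .
  qed
  also have "(\<Sum>i\<le>Suc k. (?C i * of_nat (Suc k - i)) *k ?y i) + (\<Sum>i\<le>Suc k. (?C i * of_nat i) *k ?y i)
      = (\<Sum>i\<le>Suc k. of_nat (Suc k) *k (?C i *k ?y i))"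
    unfolding sum.distrib[symmetric]
  proof (rule sum.cong)
    fix i assume "i \<in> {..Suc k}"
    then have "of_nat (Suc k - i) + of_nat i = (of_nat (Suc k) :: 'k)"
      by (simp flip: of_nat_add)
    then have "of_nat (Suc k) * ?C i = ?C i * of_nat (Suc k - i) + ?C i * of_nat i"
      by (metis distrib_left mult.commute)
    then show "(?C i * of_nat (Suc k - i)) *k ?y i + (?C i * of_nat i) *k ?y i = of_nat (Suc k) *k (?C i *k ?y i)"
      by (simp only: fps_const_add_scale fps_const_mult_scale[symmetric])
  qed simp
  also have "\<dots> = of_nat (Suc k) *k (\<Sum>i\<le>Suc k. ?C i *k ?y i)"
    by (simp only: scale_sum_right)
  finally show ?case
    by (rule kscale_cancel_Suc)
qed simp

text \<open>
  Conversely, \<open>Y(v,z) e^(xT) = e^(xT) Y(v,z-x)\<close>.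
\<close>

lemma Y_Tdiv:
  "Y v (Tdiv k w) n = (\<Sum>i\<le>k. ((- 1) ^ i * (of_int (n + int i) gchoose i)) *k Tdiv (k - i) (Y v w (n + int i)))"
proof (induction k arbitrary: n)
  case (Suc k)
  let ?C = "\<lambda>i. of_int (n + int i) gchoose i :: 'k"
  let ?s = "\<lambda>i. (- 1) ^ i * ?C i"
  let ?y = "\<lambda>i. Tdiv (Suc k - i) (Y v w (n + int i))"
  have "of_nat (Suc k) *k Y v (Tdiv (Suc k) w) n = Y v (T (Tdiv k w)) n"
    by (simp only: T_Tdiv module_hom.scale[OF Y_linear_right])
  also have "\<dots> = T (Y v (Tdiv k w) n) + (- of_int (n + 1)) *k Y v (Tdiv k w) (n + 1)"
    unfolding T_Y kscale_neg by simp
  also have "T (Y v (Tdiv k w) n) = (\<Sum>i\<le>Suc k. (?s i * of_nat (Suc k - i)) *k ?y i)"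
    by (simp add: Suc T_sum T_scale T_Tdiv Suc_diff_le fps_const_mult_scale
        del: fps_const_mult scale_scale of_nat_Suc of_int_add of_nat_diff)
  also have "(- of_int (n + 1)) *k Y v (Tdiv k w) (n + 1) = (\<Sum>i\<le>Suc k. (?s i * of_nat i) *k ?y i)"
  proof -
    have *: "- of_int (n + 1) * ((- 1) ^ i * (of_int (n + 1 + int i) gchoose i)) = ?s (Suc i) * of_nat (Suc i)" for i
    proof -
      let ?a = "of_int (n + int (Suc i)) :: 'k"
      have 1: "of_int (n + 1) * (?a gchoose i) = of_nat (Suc i) * (?a gchoose Suc i)"
        using gbinomial_mult_1[of ?a i] by (simp add: algebra_simps)
      have 2: "of_int (n + 1 + int i) = ?a"
        by simp
      have "- of_int (n + 1) * ((- 1) ^ i * (?a gchoose i)) = - ((- 1) ^ i * (of_int (n + 1) * (?a gchoose i)))"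
        by (simp only: mult_minus_left mult_minus_right mult.left_commute[of "of_int (n + 1)"])
      also have "\<dots> = ?s (Suc i) * of_nat (Suc i)"
        unfolding 1 power_Suc by (simp only: mult_minus_left mult_minus_right mult_1_left mult.assoc mult.commute[of "of_nat (Suc i)"])
      finally show ?thesis
        unfolding 2 .
    qed
    have "(- of_int (n + 1)) *k Y v (Tdiv k w) (n + 1) =
        (\<Sum>i\<le>k. (- of_int (n + 1) * ((- 1) ^ i * (of_int (n + 1 + int i) gchoose i))) *k
          Tdiv (k - i) (Y v w (n + 1 + int i)))"
      by (simp only: Suc scale_sum_right fps_const_mult_scale)
    also have "\<dots> = (\<Sum>i\<le>k. (?s (Suc i) * of_nat (Suc i)) *k ?y (Suc i))"
      by (simp only: * diff_Suc_Suc) (simp add: algebra_simps)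
    also have "\<dots> = (\<Sum>i\<le>Suc k. (?s i * of_nat i) *k ?y i)"
      by (simp only: sum.atMost_Suc_shift) simp
    finally show ?thesis .
  qed
  also have "(\<Sum>i\<le>Suc k. (?s i * of_nat (Suc k - i)) *k ?y i) + (\<Sum>i\<le>Suc k. (?s i * of_nat i) *k ?y i)
      = (\<Sum>i\<le>Suc k. of_nat (Suc k) *k (?s i *k ?y i))"
    unfolding sum.distrib[symmetric]
  proof (rule sum.cong)
    fix i assume "i \<in> {..Suc k}"
    then have "of_nat (Suc k - i) + of_nat i = (of_nat (Suc k) :: 'k)"
      by (simp flip: of_nat_add)
    then have "of_nat (Suc k) * ?s i = ?s i * of_nat (Suc k - i) + ?s i * of_nat i"
      by (metis distrib_left mult.commute)
    then show "(?s i * of_nat (Suc k - i)) *k ?y i + (?s i * of_nat i) *k ?y i = of_nat (Suc k) *k (?s i *k ?y i)"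
      by (simp only: fps_const_add_scale fps_const_mult_scale[symmetric])
  qed simp
  also have "\<dots> = of_nat (Suc k) *k (\<Sum>i\<le>Suc k. ?s i *k ?y i)"
    by (simp only: scale_sum_right)
  finally show ?case
    by (rule kscale_cancel_Suc)
qed simp

text \<open>
  \<open>Y(v,z)\<Omega> = e^(zT) v\<close>, the solution of the differential equation given by (QA2).
\<close>

lemma Y_vacuum: "Y v \<Omega> n = (if n < 0 then 0 else Tdiv (nat n) v)"
proof -
  have "Y v \<Omega> (int k) = Tdiv k v" for k
  proof (induction k)
    case (Suc k)
    have "of_nat (Suc k) *k Y v \<Omega> (int (Suc k)) = T (Tdiv k v)"
      using T_Y[of v \<Omega> "int k"] by (simp add: Suc QA2_vacuum algebra_simps)
    then show ?case
      unfolding T_Tdiv by (rule kscale_cancel_Suc)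
  qed (simp add: QA3_value)
  from this[of "nat n"] show ?thesis
    by (auto simp: QA3_regular)
qed

text \<open>
  \<open>expT M a\<close> is \<open>e^(wT) a(w)\<close>.
\<close>

definition expT :: "nat \<Rightarrow> (int \<Rightarrow> 'v) \<Rightarrow> int \<Rightarrow> 'v" where
  "expT M a q = sum_mod M (\<lambda>k::nat. Tdiv k (a (q - int k)))"

lemma summable_expT:
  assumes "bounded_below M a"
  shows "summable_mod M (\<lambda>k::nat. Tdiv k (a (q - int k)))"
proof -
  obtain n0 where n0: "\<And>n. n < n0 \<Longrightarrow> hdvd M (a n)"
    using assms unfolding bounded_below_def by blast
  show ?thesis
  proof (rule summable_modI)
    fix k assume "k \<notin> {..nat (q - n0)}"
    then show "hdvd M (Tdiv k (a (q - int k)))"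
      by (intro hdvd_hom[OF Tdiv_linear] n0) auto
  qed simp
qed

lemma expT_cong: "(\<And>n. a n \<approx>\<^bsub>M\<^esub> b n) \<Longrightarrow> expT M a q \<approx>\<^bsub>M\<^esub> expT M b q"
  unfolding expT_def by (rule sum_mod_cong, rule hcong_hom[OF Tdiv_linear]) blast

lemma expT_fsum_apply:
  assumes "\<And>t. t \<in> Poly_Mapping.keys x \<Longrightarrow> bounded_below M (a t)"
  shows "expT M (\<lambda>q. fsum_apply (\<lambda>t. a t q) x) q \<approx>\<^bsub>M\<^esub> fsum_apply (\<lambda>t. expT M (a t) q) x"
proof -
  have "sum_mod M (\<lambda>k. fsum_apply (\<lambda>t. Tdiv k (a t (q - int k))) x) \<approx>\<^bsub>M\<^esub>
      fsum_apply (\<lambda>t. sum_mod M (\<lambda>k. Tdiv k (a t (q - int k)))) x"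
    by (rule sum_mod_fsum_apply, rule summable_expT, rule assms)
  then show ?thesis
    by (simp add: expT_def fsum_apply_hom[OF Tdiv_linear])
qed

lemma theta_pow_expT:
  assumes "quadrant_finite M A"
  shows "(theta ^^ n) (\<lambda>p. expT M (A p)) p q \<approx>\<^bsub>M\<^esub> expT M ((theta ^^ n) A p) q"
proof -
  have "(theta ^^ n) (\<lambda>p q. sum_mod M (\<lambda>k. Tdiv k (A p (q - int k)))) p q \<approx>\<^bsub>M\<^esub>
      sum_mod M (\<lambda>k. (theta ^^ n) (\<lambda>p q. Tdiv k (A p (q - int k))) p q)"
    using theta_pow_sum_mod[of M "\<lambda>k p q. Tdiv k (A p (q - int k))"]
      summable_expT[OF quadrant_finite_row[OF assms]] by blast
  moreover have "(theta ^^ n) (\<lambda>p q. A p (q - int k)) p q = (theta ^^ n) A p (q - int k)" for k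
    by (induction n arbitrary: p q) (auto simp: theta_def algebra_simps)
  ultimately show ?thesis
    by (simp add: expT_def[abs_def] theta_pow_hom[OF Tdiv_linear])
qed

lemma expT_pmul:
  assumes "quadrant_finite M A"
  shows "expT M (pmul M N f A p) q \<approx>\<^bsub>M\<^esub> pmul M N f (\<lambda>p. expT M (A p)) p q"
proof -
  let ?c = "\<lambda>j::nat. fls_nth f (int j - int N)"
  let ?F = "\<lambda>(k::nat) (j::nat). ?c j *k Tdiv k ((theta ^^ j) A p (q - int k))"
  obtain K where K: "\<And>p' q'. p' \<le> p \<Longrightarrow> q' \<le> q \<Longrightarrow> p' + q' < K \<Longrightarrow> hdvd M (A p' q')"
    using quadrant_finiteE[OF assms] by blast
  have F: "summable_mod M (\<lambda>(k, j). ?F k j)"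
  proof (rule summable_modI)
    fix x assume x: "x \<notin> {..nat (p + q - K)} \<times> {..nat (p + q - K)}"
    obtain k j where [simp]: "x = (k, j)"
      by force
    have "hdvd M ((theta ^^ j) A p (q - int k))"
      by (rule theta_pow_hdvd_below[of p q K]) (use K x in auto)
    then show "hdvd M (case x of (k, j) \<Rightarrow> ?F k j)"
      by (auto intro: hdvd_scale hdvd_hom[OF Tdiv_linear])
  qed simp
  have "expT M (pmul M N f A p) q \<approx>\<^bsub>M\<^esub> sum_mod M (\<lambda>k. sum_mod M (?F k))"
    unfolding expT_def
  proof (rule sum_mod_cong)
    fix k
    show "Tdiv k (pmul M N f A p (q - int k)) \<approx>\<^bsub>M\<^esub> sum_mod M (?F k)"
      unfolding pmul_def using sum_mod_hom[OF Tdiv_linear summable_pmul[OF assms]]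
      by (simp add: module_hom.scale[OF Tdiv_linear])
  qed
  also have "\<dots> \<approx>\<^bsub>M\<^esub> sum_mod M (\<lambda>j. sum_mod M (\<lambda>k. ?F k j))"
    by (rule sum_mod_swap[OF F])
  also have "\<dots> \<approx>\<^bsub>M\<^esub> sum_mod M (\<lambda>j. ?c j *k (theta ^^ j) (\<lambda>p. expT M (A p)) p q)"
  proof (rule sum_mod_cong)
    fix j
    have "sum_mod M (\<lambda>k. ?F k j) \<approx>\<^bsub>M\<^esub> ?c j *k expT M ((theta ^^ j) A p) q"
      unfolding expT_def
      by (rule hcong_sym, rule sum_mod_scale, rule summable_expT,
          rule quadrant_finite_row[OF quadrant_finite_theta_pow[OF assms]])
    also have "\<dots> \<approx>\<^bsub>M\<^esub> ?c j *k (theta ^^ j) (\<lambda>p. expT M (A p)) p q"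
      by (rule hcong_scale[OF hcong_sym[OF theta_pow_expT[OF assms]]])
    finally show "sum_mod M (\<lambda>k. ?F k j) \<approx>\<^bsub>M\<^esub> ?c j *k (theta ^^ j) (\<lambda>p. expT M (A p)) p q" .
  qed
  finally show ?thesis
    by (simp add: pmul_def)
qed


section \<open>Braided commutativity and skew symmetry\<close>

lemma iterated_laurent_Y_Y: "iterated_laurent M (\<lambda>q p. Y a (Y b u q) p)"
proof -
  obtain q0 where q0: "\<forall>q<q0. hdvd M (Y b u q)"
    using bounded_below_Y unfolding bounded_below_def by blast
  then have "\<forall>q<q0. \<forall>p. hdvd M (Y a (Y b u q) p)"
    by (auto intro: hdvd_hom[OF Y_linear_right])
  then show ?thesis
    unfolding iterated_laurent_def by (meson bounded_below_Y)
qed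

lemma iterated_laurent_alt:
  "iterated_laurent M (\<lambda>q p. A p q) \<Longrightarrow> iterated_laurent M (\<lambda>q p. alt q (A p q))"
  by (simp add: iterated_laurent_def bounded_below_def)

text \<open>
  (QA1) with the power of \<open>z1 - z2\<close> absorbed into the coefficients of \<open>S\<close>. The exponent may be
  enlarged at will, and large exponents also exceed the poles of \<open>S\<close>, so that the way in which
  \<open>S(z1 - z2)\<close> is expanded no longer matters. The variable \<open>z2\<close> is replaced by its negative.
\<close>

lemma braided_commutativity:
  "\<exists>N0. \<forall>N\<ge>N0. (\<forall>(vs, f) \<in> Poly_Mapping.keys (rep (S v w) M). \<forall>i < - int N. fls_nth f i = 0) \<and>
    (\<forall>u p q. (theta ^^ N) (\<lambda>p q. alt q (Y w (Y v u p) q)) p q \<approx>\<^bsub>M\<^esub>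
      fsum_apply (\<lambda>(vs, f). pmul M N f (\<lambda>p q. alt q (Y (vs ! 0) (Y (vs ! 1) u q) p)) p q)
        (rep (S v w) M))"
proof -
  let ?x = "rep (S v w) M"
  let ?A = "\<lambda>vs u p q. Y (vs ! 0) (Y (vs ! 1) u q) p"
  obtain N1 where N1: "\<And>u p q. hdvd M
      (fsum_apply (\<lambda>(vs, f). series_mult M ((fls_const fls_X - fls_X) ^ N1 * fls_taylor (- 1) f) (?A vs u) p q) ?x
        - series_mult M ((fls_const fls_X - fls_X) ^ N1) (\<lambda>p q. Y w (Y v u p) q) p q)"
    using QA1[of M v w] by blast
  \<comment> \<open>A bound for the orders of all poles of \<open>S(v \<otimes> w)\<close> modulo \<open>h^M\<close>.\<close>
  define N2 where "N2 = (\<Sum>t\<in>Poly_Mapping.keys ?x. nat (- fls_subdegree (snd t)))"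
  have pole: "fls_nth f i = 0" if "(vs, f) \<in> Poly_Mapping.keys ?x" "i < - int N" "N \<ge> N2" for vs f i N
  proof -
    have "nat (- fls_subdegree (snd (vs, f))) \<le> N2"
      unfolding N2_def using that(1) by (intro member_le_sum) auto
    then show ?thesis
      using that by auto
  qed
  show ?thesis
  proof (intro exI[of _ "N1 + N2"] allI impI conjI)
    fix N assume N: "N1 + N2 \<le> N"
    then show "\<forall>(vs, f) \<in> Poly_Mapping.keys ?x. \<forall>i < - int N. fls_nth f i = 0"
      using pole by fastforce
    fix u p q
    let ?A' = "\<lambda>vs q p. alt q (?A vs u p q)"
    let ?R = "\<lambda>p q. Y w (Y v u p) q"
    have A': "iterated_laurent M (?A' vs)" for vs
      by (intro iterated_laurent_alt iterated_laurent_Y_Y)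
    obtain K where K: "N = K + N1"
      using N by (metis add.commute le_Suc_ex add_leD1)
    have one: "(theta ^^ N1) (\<lambda>p q. alt q (?R p q)) p q \<approx>\<^bsub>M\<^esub>
        fsum_apply (\<lambda>(vs, f). (theta ^^ N1) (\<lambda>p q. tmul M f (?A' vs) q p) p q) ?x" for p q
    proof -
      have "(theta ^^ N1) (\<lambda>p q. alt q (?R p q)) p q \<approx>\<^bsub>M\<^esub>
          (theta ^^ N1) (\<lambda>p q. alt q (series_mult M 1 ?R p q)) p q"
      proof (intro theta_pow_cong hcong_hom[OF module_hom_alt])
        fix p q
        show "?R p q \<approx>\<^bsub>M\<^esub> series_mult M 1 ?R p q"
          unfolding series_mult_def
          by (rule hcong_sym, rule hcong_eq_trans, rule sum_mod_single[of "(0, 0)"])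
              (auto split: if_splits)
      qed
      also have "\<dots> \<approx>\<^bsub>M\<^esub> alt q (series_mult M ((fls_const fls_X - fls_X) ^ N1 * 1) ?R p q)"
      proof -
        have "finite {(i, j). fls_nth (fls_nth (1 :: 'k fls fls) j) i \<noteq> 0 \<and> \<not> hdvd M (?R (p - i) (q - j))}" for p q
          by (rule finite_subset[of _ "{(0, 0)}"]) (auto split: if_splits)
        then show ?thesis
          using alt_series_mult_power[of 1 M ?R q N1 p] hcong_sym by blast
      qed
      also have "\<dots> \<approx>\<^bsub>M\<^esub> alt q (fsum_apply (\<lambda>(vs, f).
          series_mult M ((fls_const fls_X - fls_X) ^ N1 * fls_taylor (- 1) f) (?A vs u) p q) ?x)"
        using N1[of u p q] hcong_sym
        by (intro hcong_hom[OF module_hom_alt]) (simp add: hcong_def)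
      also have "\<dots> = fsum_apply (\<lambda>(vs, f).
          alt q (series_mult M ((fls_const fls_X - fls_X) ^ N1 * fls_taylor (- 1) f) (?A vs u) p q)) ?x"
        by (simp add: fsum_apply_hom[OF module_hom_alt] case_prod_unfold)
      also have "\<dots> \<approx>\<^bsub>M\<^esub> fsum_apply (\<lambda>(vs, f). (theta ^^ N1) (\<lambda>p q. tmul M f (?A' vs) q p) p q) ?x"
      proof (rule fsum_apply_cong, clarify)
        fix vs f
        show "alt q (series_mult M ((fls_const fls_X - fls_X) ^ N1 * fls_taylor (- 1) f) (?A vs u) p q)
            \<approx>\<^bsub>M\<^esub> (theta ^^ N1) (\<lambda>p q. tmul M f (?A' vs) q p) p q"
          using alt_series_mult_power[where g = "fls_taylor (- 1) f" and A = "?A vs u" and M = M and q = q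
              and N = N1 and p = p, OF finite_support_product[OF iterated_laurent_Y_Y]]
          by (simp add: series_mult_taylor)
      qed
      finally show ?thesis .
    qed
    have "(theta ^^ N) (\<lambda>p q. alt q (?R p q)) p q = (theta ^^ K) ((theta ^^ N1) (\<lambda>p q. alt q (?R p q))) p q"
      by (simp add: K funpow_add)
    also have "\<dots> \<approx>\<^bsub>M\<^esub> (theta ^^ K) (\<lambda>p q. fsum_apply (\<lambda>(vs, f). (theta ^^ N1) (\<lambda>p q. tmul M f (?A' vs) q p) p q) ?x) p q"
      by (rule theta_pow_cong[OF one])
    also have "\<dots> = fsum_apply (\<lambda>(vs, f). (theta ^^ N) (\<lambda>p q. tmul M f (?A' vs) q p) p q) ?x"
      by (simp add: theta_pow_fsum_apply case_prod_unfold K funpow_add)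
    also have "\<dots> \<approx>\<^bsub>M\<^esub> fsum_apply (\<lambda>(vs, f). pmul M N f (\<lambda>p q. alt q (?A vs u p q)) p q) ?x"
    proof (rule fsum_apply_cong, clarify)
      fix vs f assume t: "(vs, f) \<in> Poly_Mapping.keys ?x"
      have "(theta ^^ N) (\<lambda>p q. tmul M f (?A' vs) q p) p q = (theta ^^ N) (tmul M f (?A' vs)) q p"
        by (rule theta_pow_flip)
      also have "\<dots> \<approx>\<^bsub>M\<^esub> pmul M N f (?A' vs) q p"
        using pole[OF t] N by (intro theta_pow_tmul A') auto
      also have "\<dots> = pmul M N f (\<lambda>p q. alt q (?A vs u p q)) p q"
        by (rule pmul_flip)
      finally show "(theta ^^ N) (\<lambda>p q. tmul M f (?A' vs) q p) p q \<approx>\<^bsub>M\<^esub>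
          pmul M N f (\<lambda>p q. alt q (?A vs u p q)) p q" .
    qed
    finally show "(theta ^^ N) (\<lambda>p q. alt q (Y w (Y v u p) q)) p q \<approx>\<^bsub>M\<^esub>
      fsum_apply (\<lambda>(vs, f). pmul M N f (\<lambda>p q. alt q (Y (vs ! 0) (Y (vs ! 1) u q) p)) p q) ?x" .
  qed
qed

lemma theta_pow_bottom_row:
  assumes "\<And>p q. q < 0 \<Longrightarrow> A p q = 0"
  shows "q < 0 \<Longrightarrow> (theta ^^ n) A p q = 0" "(theta ^^ n) A p 0 = A (p - int n) 0"
proof -
  show *: "(theta ^^ n) A p q = 0" if "q < 0" for n p q
    using that by (induction n arbitrary: p q) (auto simp: theta_def assms)
  show "(theta ^^ n) A p 0 = A (p - int n) 0"
    by (induction n arbitrary: p) (auto simp: theta_def * algebra_simps)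
qed

text \<open>
  With \<open>y(z) = Y(w,-z)v\<close>, translation covariance gives
  \<open>Y(w,-z2) e^(z1 T) v = e^(z1 T) y(z1 + z2)\<close>, expanded in nonnegative powers of \<open>z1\<close>.
  Multiplication by \<open>(z1 + z2)^N\<close> only shifts the index of \<open>y\<close>.
\<close>

lemma theta_pow_Y_vacuum:
  "(theta ^^ N) (\<lambda>p q. alt q (Y w (Y v \<Omega> p) q)) p q =
    (if p < 0 then 0 else \<Sum>i\<le>nat p. (of_int (q + int i) gchoose i) *k
      Tdiv (nat p - i) (alt (q + int i - int N) (Y w v (q + int i - int N))))"
proof -
  let ?y = "\<lambda>m. alt m (Y w v m)"
  let ?C = "\<lambda>q i. of_int (q + int i) gchoose i :: 'k"
  have "(theta ^^ N) (\<lambda>p q. alt q (Y w (Y v \<Omega> p) q)) p q =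
    (if p < 0 then 0 else \<Sum>i\<le>nat p. ?C q i *k Tdiv (nat p - i) (?y (q + int i - int N)))"
  proof (induction N arbitrary: p q)
    case 0
    have "alt q (((- 1) ^ i * c) *k Tdiv j x) = c *k Tdiv j (alt (q + int i) x)" for i c j x
      by (cases "even i"; cases "even q") (auto simp: alt_def kscale_neg module_hom.neg[OF Tdiv_linear])
    then show ?case
      by (auto simp: Y_vacuum Y_Tdiv module_hom.sum[OF module_hom_alt] alt_def[of q 0])
  next
    case (Suc N)
    let ?z = "\<lambda>j i. Tdiv j (?y (q + int i - int (Suc N)))"
    consider "p < 0" | "p = 0" | p' where "p = int (Suc p')"
      by (cases p rule: int_cases3) (auto simp: gr0_conv_Suc)
    then show ?case
    proof cases
      case (3 p')
      have "(theta ^^ Suc N) (\<lambda>p q. alt q (Y w (Y v \<Omega> p) q)) p q =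
          (\<Sum>i\<le>p'. ?C q i *k Tdiv (p' - i) (?y (q + int i - int N))) +
          (\<Sum>i\<le>Suc p'. ?C (q - 1) i *k ?z (Suc p' - i) i)"
        unfolding theta_pow_Suc Suc 3 by (simp add: nat_add_distrib algebra_simps del: sum.atMost_Suc)
      also have "(\<Sum>i\<le>p'. ?C q i *k Tdiv (p' - i) (?y (q + int i - int N))) =
          (\<Sum>i\<le>p'. ?C q i *k ?z (Suc p' - Suc i) (Suc i))"
        by (simp add: algebra_simps)
      also have "\<dots> = (\<Sum>i\<le>Suc p'. (case i of 0 \<Rightarrow> 0 | Suc i' \<Rightarrow> ?C q i') *k ?z (Suc p' - i) i)"
        by (simp only: sum.atMost_Suc_shift) simp
      also have "\<dots> + (\<Sum>i\<le>Suc p'. ?C (q - 1) i *k ?z (Suc p' - i) i) =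
          (\<Sum>i\<le>Suc p'. ?C q i *k ?z (Suc p' - i) i)"
        unfolding sum.distrib[symmetric] fps_const_add_scale[symmetric]
      proof (rule sum.cong)
        fix i
        have "(case i of 0 \<Rightarrow> 0 | Suc i' \<Rightarrow> ?C q i') + ?C (q - 1) i = ?C q i"
        proof (cases i)
          case (Suc i')
          then show ?thesis
            using gbinomial_Suc_Suc[of "of_int (q + int i') :: 'k" i'] by (simp add: algebra_simps)
        qed simp
        then show "((case i of 0 \<Rightarrow> 0 | Suc i' \<Rightarrow> ?C q i') + ?C (q - 1) i) *k ?z (Suc p' - i) i =
            ?C q i *k ?z (Suc p' - i) i"
          by simp
      qed simp
      finally show ?thesis
        by (simp only: 3 nat_int of_nat_less_0_iff if_False)
    qed (auto simp: theta_pow_Suc Suc algebra_simps simp del: funpow.simps)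
  qed
  then show ?thesis .
qed

text \<open>
  \<open>Y(z) S(z) (v \<otimes> w) = e^(zT) Y(-z) (w \<otimes> v)\<close>. In braided commutativity applied to the vacuum, the
  side with \<open>S\<close> has no negative powers of \<open>z2\<close>. Neither has the other side, once the power of
  \<open>z1 + z2\<close> exceeds the pole of \<open>Y(w,-)v\<close>, and setting \<open>z2 = 0\<close> gives the claim multiplied by a
  power of \<open>z1\<close>.
\<close>

lemma skew_symmetry:
  "fsum_apply (\<lambda>(vs, f). lmul M f (Y (vs ! 0) (vs ! 1)) n) (rep (S v w) M) \<approx>\<^bsub>M\<^esub>
    expT M (\<lambda>m. alt m (Y w v m)) n"
proof -
  let ?x = "rep (S v w) M"
  let ?y = "\<lambda>m. alt m (Y w v m)"
  obtain N0 where N0: "\<And>N. N \<ge> N0 \<Longrightarrow>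
    (\<forall>(vs, f) \<in> Poly_Mapping.keys ?x. \<forall>i < - int N. fls_nth f i = 0) \<and>
    (\<forall>u p q. (theta ^^ N) (\<lambda>p q. alt q (Y w (Y v u p) q)) p q \<approx>\<^bsub>M\<^esub>
      fsum_apply (\<lambda>(vs, f). pmul M N f (\<lambda>p q. alt q (Y (vs ! 0) (Y (vs ! 1) u q) p)) p q) ?x)"
    using braided_commutativity by blast
  obtain n0 where n0: "\<And>m. m < n0 \<Longrightarrow> hdvd M (Y w v m)"
    using bounded_below_Y unfolding bounded_below_def by blast
  define N where "N = max N0 (nat (- n0))"
  have N: "N \<ge> N0" "- int N \<le> n0"
    by (auto simp: N_def)
  \<comment> \<open>The coefficients of \<open>z1^P z2^0\<close> are compared; \<open>z1^N\<close> accounts for the shift.\<close>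
  define P where "P = n + int N"
  have "fsum_apply (\<lambda>(vs, f). lmul M f (Y (vs ! 0) (vs ! 1)) n) ?x =
      fsum_apply (\<lambda>(vs, f). pmul M N f (\<lambda>p q. alt q (Y (vs ! 0) (Y (vs ! 1) \<Omega> q) p)) P 0) ?x"
    unfolding fsum_apply_def
  proof (rule sum.cong, rule refl, rule arg_cong[where f = "scale _"], clarify)
    fix vs f assume t: "(vs, f) \<in> Poly_Mapping.keys ?x"
    let ?b = "\<lambda>i. fls_nth f i *k Y (vs ! 0) (vs ! 1) (n - i)"
    have "(theta ^^ j) (\<lambda>p q. alt q (Y (vs ! 0) (Y (vs ! 1) \<Omega> q) p)) P 0 = Y (vs ! 0) (vs ! 1) (P - int j)" for j
      by (subst theta_pow_bottom_row(2)) (auto simp: Y_vacuum alt_def)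
    then have "pmul M N f (\<lambda>p q. alt q (Y (vs ! 0) (Y (vs ! 1) \<Omega> q) p)) P 0 =
        sum_mod M (\<lambda>j::nat. ?b (int j - int N))"
      by (simp add: pmul_def P_def algebra_simps)
    also have "\<dots> = sum_mod M ?b"
    proof (rule sum_mod_reindex)
      fix i assume "i \<notin> range (\<lambda>j. int j - int N)"
      moreover have "i = int (nat (i + int N)) - int N" if "\<not> i < - int N"
        using that by simp
      ultimately have "i < - int N"
        by blast
      then show "hdvd M (?b i)"
        using N0[OF N(1)] t by fastforce
    qed (simp add: inj_def)
    finally show "lmul M f (Y (vs ! 0) (vs ! 1)) n =
        pmul M N f (\<lambda>p q. alt q (Y (vs ! 0) (Y (vs ! 1) \<Omega> q) p)) P 0"
      by (simp add: lmul_def)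
  qed
  also have "\<dots> \<approx>\<^bsub>M\<^esub> (theta ^^ N) (\<lambda>p q. alt q (Y w (Y v \<Omega> p) q)) P 0"
    using N0[OF N(1)] hcong_sym by blast
  also have "\<dots> \<approx>\<^bsub>M\<^esub> expT M ?y n"
  proof (cases "P < 0")
    case True
    then have "hdvd M (Tdiv k (?y (n - int k)))" for k
      using N by (intro hdvd_hom[OF Tdiv_linear]) (auto simp: P_def intro: n0)
    then show ?thesis
      using True by (simp add: theta_pow_Y_vacuum expT_def sum_mod_hdvd)
  next
    case False
    have bin: "of_nat i gchoose i = (1 :: 'k)" for i
      by (simp flip: binomial_gbinomial)
    have "(theta ^^ N) (\<lambda>p q. alt q (Y w (Y v \<Omega> p) q)) P 0 =
        (\<Sum>i\<le>nat P. Tdiv (nat P - i) (?y (int i - int N)))"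
      using False by (simp add: theta_pow_Y_vacuum bin)
    also have "\<dots> = (\<Sum>k\<le>nat P. Tdiv k (?y (n - int k)))"
      using False by (intro sum.reindex_bij_witness[of _ "\<lambda>k. nat P - k" "\<lambda>i. nat P - i"])
        (auto simp: P_def of_nat_diff)
    also have "\<dots> \<approx>\<^bsub>M\<^esub> expT M ?y n"
      unfolding expT_def
    proof (rule hcong_sym, rule sum_mod_finite)
      fix k assume "k \<notin> {..nat P}"
      then have "n - int k < n0"
        using N False by (auto simp: P_def)
      then show "hdvd M (Tdiv k (?y (n - int k)))"
        by (intro hdvd_hom[OF Tdiv_linear]) (simp add: n0)
    qed simp
    finally show ?thesis .
  qed
  finally show ?thesis .
qed


section \<open>The two iterated products and their difference\<close>

text \<open>
  \<open>Y(a,u+w) Y(c,w) d\<close> with \<open>u + w\<close> expanded in nonnegative powers of \<open>w\<close>, as in the definition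
  of the residue.
\<close>

definition prodY :: "nat \<Rightarrow> 'v \<Rightarrow> 'v \<Rightarrow> 'v \<Rightarrow> int \<Rightarrow> int \<Rightarrow> 'v" where
  "prodY M a c d = reexpand M 0 (\<lambda>p q. Y a (Y c d q) p)"

definition iterY :: "'v \<Rightarrow> 'v \<Rightarrow> 'v \<Rightarrow> int \<Rightarrow> int \<Rightarrow> 'v" where
  "iterY a c d p q = Y (Y a c p) d q"

lemma prodY_eq:
  "prodY M a c d p q = sum_mod M (\<lambda>m::nat. (of_int (p + int m) gchoose m) *k Y a (Y c d (q - int m)) (p + int m))"
  by (simp add: prodY_def reexpand_def)

lemma summable_prodY:
  "summable_mod M (\<lambda>m::nat. (of_int (p + int m) gchoose m) *k Y a (Y c d (q - int m)) (p + int m))"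
  using summable_reexpand[OF iterated_laurent_Y_Y[of M a c d]] .

lemma quadrant_finite_prodY: "quadrant_finite M (prodY M a c d)"
proof -
  obtain q0 where q0: "\<And>q. q < q0 \<Longrightarrow> hdvd M (Y c d q)"
    using bounded_below_Y unfolding bounded_below_def by blast
  obtain b where b: "\<And>p q. p < b q \<Longrightarrow> hdvd M (Y a (Y c d q) p)"
    using bounded_below_Y[of M a "Y c d _"] unfolding bounded_below_def by metis
  show ?thesis
    unfolding quadrant_finite_def
  proof (intro allI)
    fix p q
    define B where "B = Min (insert 0 ((\<lambda>i. b i - (q - i)) ` {q0..q}))"
    have B: "B \<le> b i - (q - i)" if "q0 \<le> i" "i \<le> q" for i
      using that unfolding B_def by (intro Min_le) auto
    have "hdvd M (prodY M a c d p' q')" if "p' \<le> p" "q' \<le> q" "p' + q' < B + q0" for p' q'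
    proof -
      have "hdvd M (Y a (Y c d (q' - int m)) (p' + int m))" for m
      proof (cases "q' - int m < q0")
        case True
        then show ?thesis
          by (intro hdvd_hom[OF Y_linear_right] q0)
      next
        case False
        then show ?thesis
          using that B[of "q' - int m"] by (intro b) auto
      qed
      then show ?thesis
        unfolding prodY_eq by (simp add: sum_mod_hdvd hdvd_scale)
    qed
    then show "\<exists>K. \<forall>p' q'. p' \<le> p \<longrightarrow> q' \<le> q \<longrightarrow> p' + q' < K \<longrightarrow> hdvd M (prodY M a c d p' q')"
      by blast
  qed
qed

lemma iterated_laurent_iterY: "iterated_laurent M (iterY a c d)"
proof -
  obtain p0 where p0: "\<forall>p<p0. hdvd M (Y a c p)"
    using bounded_below_Y unfolding bounded_below_def by blast
  then have "\<forall>p<p0. \<forall>q. hdvd M (iterY a c d p q)"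
    unfolding iterY_def by (auto intro: hdvd_hom[OF Y_linear_left])
  then show ?thesis
    unfolding iterated_laurent_def iterY_def by (meson bounded_below_Y)
qed

text \<open>
  \<open>e^(wT) Y(a,u) Y(b,-w) v = Y(a,u+w) e^(wT) Y(b,-w) v = Y(a,u+w) Y(w) S(w) (v \<otimes> b)\<close>, by
  translation covariance and skew symmetry.
\<close>

lemma expT_Y_Y:
  "expT M (\<lambda>q. alt q (Y a (Y b v q) p)) q \<approx>\<^bsub>M\<^esub>
    fsum_apply (\<lambda>(ts, g). lmul M g (prodY M a (ts ! 0) (ts ! 1) p) q) (rep (S v b) M)"
proof -
  let ?y = "\<lambda>m. alt m (Y b v m)"
  let ?C = "\<lambda>i. of_int (p + int i) gchoose i :: 'k"
  let ?F = "\<lambda>i l. ?C i *k Y a (Tdiv l (?y (q - int i - int l))) (p + int i)"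
  let ?x = "rep (S v b) M"
  have hom: "module_hom scale scale (\<lambda>z. ?C i *k Y a z (p + int i))" for i
    by unfold_locales (auto simp: module_hom.add[OF Y_linear_right] module_hom.scale[OF Y_linear_right]
        scale_right_distrib mult.commute)
  obtain n0 where n0: "\<And>m. m < n0 \<Longrightarrow> hdvd M (Y b v m)"
    using bounded_below_Y unfolding bounded_below_def by blast
  let ?n = "nat (q - n0)"
  have Fz: "hdvd M (?F i l)" if "\<not> i + l \<le> ?n" for i l
  proof -
    have "q - int i - int l < n0"
      using that by linarith
    then show ?thesis
      by (intro hdvd_scale hdvd_hom[OF Y_linear_right] hdvd_hom[OF Tdiv_linear]) (simp add: n0)
  qed
  have fin: "finite {(i, l). i + l \<le> ?n}"
    by (rule finite_subset[of _ "{..?n} \<times> {..?n}"]) auto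
  have F: "summable_mod M (\<lambda>(i, l). ?F i l)"
    by (rule summable_modI[OF fin]) (use Fz in auto)
  \<comment> \<open>Translation covariance: \<open>l = k - i\<close> powers of \<open>T\<close> reach \<open>Y(b,-w)v\<close>, the others shift \<open>u\<close>.\<close>
  have Tk: "Tdiv k (alt (q - int k) (Y a (Y b v (q - int k)) p)) = (\<Sum>i\<le>k. ?F i (k - i))" for k
  proof -
    have "alt m (Y a x p) = Y a (alt m x) p" for m x
      by (simp add: alt_def module_hom.neg[OF Y_linear_right])
    then have "Tdiv k (alt (q - int k) (Y a (Y b v (q - int k)) p)) =
        (\<Sum>i\<le>k. ?C i *k Y a (Tdiv (k - i) (?y (q - int k))) (p + int i))"
      by (simp add: Tdiv_Y)
    also have "\<dots> = (\<Sum>i\<le>k. ?F i (k - i))"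
      by (rule sum.cong) (auto simp: of_nat_diff)
    finally show ?thesis .
  qed
  have "expT M (\<lambda>q. alt q (Y a (Y b v q) p)) q = sum_mod M (\<lambda>k. \<Sum>i\<le>k. ?F i (k - i))"
    unfolding expT_def by (simp only: Tk)
  also have "\<dots> \<approx>\<^bsub>M\<^esub> (\<Sum>k\<le>?n. \<Sum>i\<le>k. ?F i (k - i))"
  proof (rule sum_mod_finite)
    fix k assume "k \<notin> {..?n}"
    then show "hdvd M (\<Sum>i\<le>k. ?F i (k - i))"
      by (intro hdvd_sum Fz) auto
  qed simp
  also have "\<dots> = (\<Sum>(i, l)\<in>{(i, l). i + l \<le> ?n}. ?F i l)"
    by (rule sum.triangle_reindex_eq[symmetric])
  also have "\<dots> \<approx>\<^bsub>M\<^esub> sum_mod M (\<lambda>(i, l). ?F i l)"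
    by (rule hcong_sym, rule sum_mod_finite[OF fin]) (use Fz in auto)
  also have "\<dots> \<approx>\<^bsub>M\<^esub> sum_mod M (\<lambda>i. sum_mod M (?F i))"
    by (rule hcong_sym[OF sum_mod_Fubini[OF F]])
  also have "\<dots> \<approx>\<^bsub>M\<^esub> sum_mod M (\<lambda>i. fsum_apply (\<lambda>(ts, g).
      ?C i *k Y a (lmul M g (Y (ts ! 0) (ts ! 1)) (q - int i)) (p + int i)) ?x)"
  proof (rule sum_mod_cong)
    fix i
    have bb: "bounded_below M ?y"
      using bounded_below_Y[of M b v] by (simp add: bounded_below_def)
    have "sum_mod M (?F i) \<approx>\<^bsub>M\<^esub> ?C i *k Y a (expT M ?y (q - int i)) (p + int i)"
      unfolding expT_def by (rule hcong_sym, rule sum_mod_hom[OF hom], rule summable_expT[OF bb])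
    also have "\<dots> \<approx>\<^bsub>M\<^esub> ?C i *k Y a (fsum_apply (\<lambda>(ts, g). lmul M g (Y (ts ! 0) (ts ! 1)) (q - int i)) ?x) (p + int i)"
      by (rule hcong_hom[OF hom hcong_sym[OF skew_symmetry]])
    also have "\<dots> = fsum_apply (\<lambda>(ts, g). ?C i *k Y a (lmul M g (Y (ts ! 0) (ts ! 1)) (q - int i)) (p + int i)) ?x"
      unfolding case_prod_unfold by (rule fsum_apply_hom[OF hom])
    finally show "sum_mod M (?F i) \<approx>\<^bsub>M\<^esub> fsum_apply (\<lambda>(ts, g).
      ?C i *k Y a (lmul M g (Y (ts ! 0) (ts ! 1)) (q - int i)) (p + int i)) ?x" .
  qed
  also have "\<dots> \<approx>\<^bsub>M\<^esub> fsum_apply (\<lambda>(ts, g). sum_mod M (\<lambda>i.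
      ?C i *k Y a (lmul M g (Y (ts ! 0) (ts ! 1)) (q - int i)) (p + int i))) ?x"
  proof -
    have sm: "summable_mod M (\<lambda>i. ?C i *k Y a (lmul M g (Y c d) (q - int i)) (p + int i))" for g c d
    proof -
      obtain m0 where m0: "\<And>m. m < m0 \<Longrightarrow> hdvd M (lmul M g (Y c d) m)"
        using bounded_below_lmul[OF bounded_below_Y] unfolding bounded_below_def by blast
      show ?thesis
      proof (rule summable_modI)
        fix i assume "i \<notin> {..nat (q - m0)}"
        then show "hdvd M (?C i *k Y a (lmul M g (Y c d) (q - int i)) (p + int i))"
          by (intro hdvd_scale hdvd_hom[OF Y_linear_right] m0) auto
      qed simp
    qed
    show ?thesis
      unfolding case_prod_unfold by (rule sum_mod_fsum_apply, rule sm)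
  qed
  also have "\<dots> \<approx>\<^bsub>M\<^esub> fsum_apply (\<lambda>(ts, g). lmul M g (prodY M a (ts ! 0) (ts ! 1) p) q) ?x"
  proof (rule fsum_apply_cong, clarify)
    fix ts :: "'v list" and g :: "'k fls"
    let ?c = "ts ! 0" and ?d = "ts ! 1"
    let ?G = "\<lambda>i j. fls_nth g j *k (?C i *k Y a (Y ?c ?d (q - j - int i)) (p + int i))"
    obtain m0 where m0: "\<And>m. m < m0 \<Longrightarrow> hdvd M (Y ?c ?d m)"
      using bounded_below_Y unfolding bounded_below_def by blast
    have G: "summable_mod M (\<lambda>(i, j). ?G i j)"
    proof (rule summable_modI)
      fix x assume x: "x \<notin> {..nat (q - m0 - fls_subdegree g)} \<times> {fls_subdegree g..q - m0}"
      obtain i j where [simp]: "x = (i, j)"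
        by force
      consider "j < fls_subdegree g" | "q - j - int i < m0"
        using x by force
      then show "hdvd M (case x of (i, j) \<Rightarrow> ?G i j)"
      proof cases
        case 2
        then have "hdvd M (?G i j)"
          by (intro hdvd_scale hdvd_hom[OF Y_linear_right] m0)
        then show ?thesis
          by simp
      qed simp
    qed simp
    have "sum_mod M (\<lambda>i. ?C i *k Y a (lmul M g (Y ?c ?d) (q - int i)) (p + int i)) \<approx>\<^bsub>M\<^esub>
        sum_mod M (\<lambda>i. sum_mod M (?G i))"
    proof (rule sum_mod_cong)
      fix i
      have "?C i *k Y a (lmul M g (Y ?c ?d) (q - int i)) (p + int i) \<approx>\<^bsub>M\<^esub>
          lmul M g (\<lambda>n. ?C i *k Y a (Y ?c ?d n) (p + int i)) (q - int i)"
        by (rule hom_lmul[OF hom bounded_below_Y])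
      also have "\<dots> = sum_mod M (?G i)"
        by (simp add: lmul_def algebra_simps)
      finally show "?C i *k Y a (lmul M g (Y ?c ?d) (q - int i)) (p + int i) \<approx>\<^bsub>M\<^esub> sum_mod M (?G i)" .
    qed
    also have "\<dots> \<approx>\<^bsub>M\<^esub> sum_mod M (\<lambda>j. sum_mod M (\<lambda>i. ?G i j))"
      by (rule sum_mod_swap[OF G])
    also have "\<dots> \<approx>\<^bsub>M\<^esub> lmul M g (prodY M a ?c ?d p) q"
      unfolding lmul_def prodY_eq
      by (rule sum_mod_cong, rule hcong_sym, rule sum_mod_scale, rule summable_prodY)
    finally show "sum_mod M (\<lambda>i. ?C i *k Y a (lmul M g (Y ?c ?d) (q - int i)) (p + int i)) \<approx>\<^bsub>M\<^esub>
        lmul M g (prodY M a ?c ?d p) q" .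
  qed
  finally show ?thesis .
qed

lemma quadrant_finite_iterY: "quadrant_finite M (iterY a c d)"
  by (rule iterated_laurent_quadrant_finite[OF iterated_laurent_iterY])

text \<open>
  Its vanishing, up to a power of \<open>u + w\<close>, is associativity.
\<close>

definition associator :: "nat \<Rightarrow> 'v \<Rightarrow> 'v \<Rightarrow> 'v \<Rightarrow> int \<Rightarrow> int \<Rightarrow> 'v" where
  "associator M a c d p q = prodY M a c d p q - iterY a c d p q"

lemma quadrant_finite_associator: "quadrant_finite M (associator M a c d)"
  unfolding associator_def[abs_def] by (intro quadrant_finite_diff quadrant_finite_prodY quadrant_finite_iterY)

lemma bounded_below_associator: "bounded_below M (associator M a c d p)"
  by (rule quadrant_finite_row[OF quadrant_finite_associator])

lemma linear_mod_associator:
  "linear_mod M (\<lambda>a. associator M a c d p q)"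
  "linear_mod M (\<lambda>c. associator M a c d p q)"
  "linear_mod M (\<lambda>d. associator M a c d p q)"
proof -
  have Y2: "module_hom scale scale (\<lambda>c. Y a (Y c d m) n)" "module_hom scale scale (\<lambda>d. Y a (Y c d m) n)"
    "module_hom scale scale (\<lambda>a. Y (Y a c m) d n)" "module_hom scale scale (\<lambda>c. Y (Y a c m) d n)" for a c d m n
    by (unfold_locales; simp add: module_hom.add[OF Y_linear_left] module_hom.add[OF Y_linear_right]
        module_hom.scale[OF Y_linear_left] module_hom.scale[OF Y_linear_right])+
  show "linear_mod M (\<lambda>a. associator M a c d p q)"
    unfolding associator_def prodY_eq iterY_def
    by (intro linear_mod_diff linear_mod_sum_mod linear_mod_comp[OF module_hom_scale] linear_mod_hom
        summable_prodY Y_linear_left Y2)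
  show "linear_mod M (\<lambda>c. associator M a c d p q)"
    unfolding associator_def prodY_eq iterY_def
    by (intro linear_mod_diff linear_mod_sum_mod linear_mod_comp[OF module_hom_scale] linear_mod_hom
        summable_prodY Y2)
  show "linear_mod M (\<lambda>d. associator M a c d p q)"
    unfolding associator_def prodY_eq iterY_def
    by (intro linear_mod_diff linear_mod_sum_mod linear_mod_comp[OF module_hom_scale] linear_mod_hom
        summable_prodY Y_linear_right Y2)
qed


section \<open>Cancelling \<open>S\<close>\<close>

lemma rep_S_in: "rep (S v w) M \<in> S v w M"
proof -
  obtain x where "S v w M = {y. tensor_eq1 2 M y x}"
    using S_in[of v w] unfolding completed_tensor_def by blast
  then have "x \<in> S v w M"
    by (simp add: tensor_eq_def tensor_rel.zero)
  then show ?thesis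
    unfolding rep_def by (rule someI)
qed

lemma rep_S_length: "(ts, f) \<in> Poly_Mapping.keys (rep (S v w) M) \<Longrightarrow> length ts = 2"
proof -
  assume t: "(ts, f) \<in> Poly_Mapping.keys (rep (S v w) M)"
  obtain x where x: "\<forall>(vs, c) \<in> Poly_Mapping.keys x. length vs = 2" "S v w M = {y. tensor_eq1 2 M y x}"
    using S_in[of v w] unfolding completed_tensor_def by blast
  have "rep (S v w) M - x \<in> tensor_rel fls_const 2 M"
    using rep_S_in[of v w M] x(2) by (simp add: tensor_eq_def)
  from tensor_rel_keys[OF this] x(1) show ?thesis
    using t keys_add[of "rep (S v w) M - x" x] by fastforce
qed

lemma rep_S_mod_h:
  assumes "M \<ge> 1"
  shows "rep (S v w) M - frag_of ([v, w], 1) \<in> tensor_rel fls_const 2 1"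
proof -
  have "S v w (Suc k) \<subseteq> S v w k" for k
    using S_in[of v w] unfolding completed_tensor_def by blast
  then have "S v w M \<subseteq> S v w 1"
    using assms by (rule lift_Suc_antimono_le)
  then have "rep (S v w) M \<in> S v w 1"
    using rep_S_in by blast
  moreover obtain x where x: "S v w 1 = {y. tensor_eq1 2 1 y x}"
    using S_in[of v w] unfolding completed_tensor_def by blast
  ultimately have 1: "rep (S v w) M - x \<in> tensor_rel fls_const 2 1" "rep (S v w) 1 - x \<in> tensor_rel fls_const 2 1"
    using rep_S_in[of v w 1] by (auto simp: tensor_eq_def)
  have 2: "rep (S v w) 1 - frag_of ([v, w], 1) \<in> tensor_rel fls_const 2 1"
    using S_mod_h[of v w] by (simp add: tensor_eq_def)
  have add: "a + b \<in> tensor_rel fls_const 2 1"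
    if "a \<in> tensor_rel fls_const 2 1" "b \<in> tensor_rel fls_const 2 1" for a b :: "('v, 'k fls) fsum"
    using tensor_rel.diff[OF that(1) tensor_rel.diff[OF tensor_rel.zero that(2)]] by simp
  from add[OF tensor_rel.diff[OF 1] 2] show ?thesis
    by simp
qed

text \<open>
  Since \<open>S = 1 + O(h)\<close>, a functional that vanishes on the image of \<open>S\<close> vanishes, by induction on
  the power of \<open>h\<close>: if it vanishes modulo \<open>h^m\<close>, it vanishes modulo \<open>h^(m+1)\<close> on all multiples of
  \<open>h\<close>, hence on \<open>S(a \<otimes> b) - a \<otimes> b\<close>. The functional is a sequence \<open>\<Lambda> N\<close>, and vanishing
  means vanishing of almost all of its members; this accounts for powers \<open>(u + w)^N\<close> that depend
  on the vectors and on the poles of the coefficients. The assumption \<open>coeff\<close> replaces linearity over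
  \<open>k((z))\<close>, which the individual members need not have.
\<close>

lemma vanishes_if_vanishes_on_S:
  fixes \<Lambda> :: "nat \<Rightarrow> 'v \<Rightarrow> 'v \<Rightarrow> 'k fls \<Rightarrow> int \<Rightarrow> int \<Rightarrow> 'v"
  assumes lin1: "\<And>N b f p q. linear_mod M (\<lambda>a. \<Lambda> N a b f p q)"
    and lin2: "\<And>N a f p q. linear_mod M (\<lambda>b. \<Lambda> N a b f p q)"
    and add: "\<And>N a b f g p q. \<Lambda> N a b (f + g) p q \<approx>\<^bsub>M\<^esub> \<Lambda> N a b f p q + \<Lambda> N a b g p q"
    and scale: "\<And>N a b s f p q. \<Lambda> N a b (fls_const s * f) p q \<approx>\<^bsub>M\<^esub> s *k \<Lambda> N a b f p q"
    and coeff: "\<And>m a b f. m \<le> M \<Longrightarrow> \<exists>N0. \<forall>N\<ge>N0. \<forall>p q. hdvd m (\<Lambda> N a b 1 p q) \<Longrightarrow>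
      \<exists>N0. \<forall>N\<ge>N0. \<forall>p q. hdvd m (\<Lambda> N a b f p q)"
    and S: "\<And>a b. \<exists>N0. \<forall>N\<ge>N0. \<forall>p q.
      hdvd M (fsum_apply (\<lambda>(vs, f). \<Lambda> N (vs ! 0) (vs ! 1) f p q) (rep (S a b) M))"
  shows "\<exists>N0. \<forall>N\<ge>N0. \<forall>p q. hdvd M (\<Lambda> N a b 1 p q)"
proof -
  let ?\<Phi> = "\<lambda>N p q. fsum_apply (\<lambda>(vs, f). \<Lambda> N (vs ! 0) (vs ! 1) f p q)"
  let ?van = "\<lambda>m x. \<exists>N0. \<forall>N\<ge>N0. \<forall>p q. hdvd m (?\<Phi> N p q x)"
  have van_diff: "?van m (x - y)" if "?van m x" "?van m y" for m x y
  proof -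
    obtain N0 N1 where "\<forall>N\<ge>N0. \<forall>p q. hdvd m (?\<Phi> N p q x)" "\<forall>N\<ge>N1. \<forall>p q. hdvd m (?\<Phi> N p q y)"
      using \<open>?van m x\<close> \<open>?van m y\<close> by blast
    then show ?thesis
      by (intro exI[of _ "max N0 N1"]) (auto simp: fsum_apply_diff intro: hdvd_diff)
  qed
  have rel: "?van m x" if "x \<in> tensor_rel fls_const 2 M" "m \<le> M" for m x
  proof -
    have "hdvd M (?\<Phi> N p q x)" for N p q
      by (rule bilinear_kills_tensor_rel[OF that(1), where G = "\<lambda>a b f. \<Lambda> N a b f p q"])
        (fact lin1 lin2 add scale)+
    then show ?thesis
      using hdvd_mono[OF that(2)] by blast
  qed
  have "\<exists>N0. \<forall>N\<ge>N0. \<forall>p q. hdvd m (\<Lambda> N a b 1 p q)" if "m \<le> M" for m a b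
    using that
  proof (induction m arbitrary: a b)
    case (Suc m)
    then have m: "m \<le> M"
      by simp
    \<comment> \<open>All generators except \<open>hpower\<close> are relations modulo \<open>h^M\<close> as well.\<close>
    have "?van (Suc m) x" if "x \<in> tensor_rel fls_const 2 1" for x
      using that
    proof (induction rule: tensor_rel.induct)
      case (diff x y)
      from diff.IH show ?case
        by (rule van_diff)
    next
      case (hpower vs i c f)
      obtain a b where vs: "vs = [a, b]"
        using length_2_cases[OF hpower(1)] by blast
      let ?vs = "vs[i := c]"
      obtain N0 where N0: "\<forall>N\<ge>N0. \<forall>p q. hdvd m (\<Lambda> N (?vs ! 0) (?vs ! 1) f p q)"
        using coeff[OF m Suc.IH[OF m]] by blast
      have "\<Lambda> N (vs[i := fps_X *s c] ! 0) (vs[i := fps_X *s c] ! 1) f p q \<approx>\<^bsub>M\<^esub>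
          fps_X *s \<Lambda> N (?vs ! 0) (?vs ! 1) f p q" for N p q
        using hpower(2) linear_mod_scale[OF lin1, of N fps_X c b f p q] linear_mod_scale[OF lin2, of N a fps_X c f p q]
        by (auto simp: vs less_2_cases_iff)
      from hdvd_mono[OF Suc.prems this[unfolded hcong_def]]
      have *: "\<Lambda> N (vs[i := fps_X *s c] ! 0) (vs[i := fps_X *s c] ! 1) f p q \<approx>\<^bsub>Suc m\<^esub>
          fps_X *s \<Lambda> N (?vs ! 0) (?vs ! 1) f p q" for N p q
        unfolding hcong_def .
      have "hdvd (Suc m) (\<Lambda> N (vs[i := fps_X *s c] ! 0) (vs[i := fps_X *s c] ! 1) f p q)" if "N \<ge> N0" for N p q
        using hcong_hdvd[OF *] hdvd_Suc_X N0 that by blast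
      then show ?case
        by (intro exI[of _ N0]) simp
    qed (intro rel[OF _ Suc.prems] tensor_rel.intros; assumption)+
    from this[OF rep_S_mod_h[of M a b]] Suc.prems
    have 1: "?van (Suc m) (rep (S a b) M - frag_of ([a, b], 1))"
      by simp
    have 2: "?van (Suc m) (rep (S a b) M)"
      using S[of a b] hdvd_mono[OF Suc.prems] by blast
    from van_diff[OF 2 1] show ?case
      by simp
  qed simp
  then show ?thesis
    by blast
qed

text \<open>
  The associator after \<open>S23(w)\<close>, with \<open>v\<close> in the middle slot.
\<close>

definition associator_S :: "nat \<Rightarrow> 'v \<Rightarrow> 'v \<Rightarrow> 'v \<Rightarrow> int \<Rightarrow> int \<Rightarrow> 'v" where
  "associator_S M v a b p q =
    fsum_apply (\<lambda>(ts, g). lmul M g (associator M a (ts ! 0) (ts ! 1) p) q) (rep (S v b) M)"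

lemma quadrant_finite_associator_S: "quadrant_finite M (associator_S M v a b)"
  unfolding associator_S_def[abs_def] case_prod_unfold
  by (intro quadrant_finite_fsum_apply quadrant_finite_lmul quadrant_finite_associator)

text \<open>
  Linearity in \<open>b\<close> uses that the associator, being trilinear, does not see which representatives of
  \<open>S(v \<otimes> b)\<close> are chosen.
\<close>

lemma linear_mod_associator_S:
  "linear_mod M (\<lambda>a. associator_S M v a b p q)"
  "linear_mod M (\<lambda>b. associator_S M v a b p q)"
proof -
  show "linear_mod M (\<lambda>a. associator_S M v a b p q)"
    unfolding associator_S_def case_prod_unfold
    by (intro linear_mod_fsum_apply linear_mod_lmul linear_mod_associator bounded_below_associator)
  let ?G = "\<lambda>c d g. lmul M g (associator M a c d p) q"
  let ?F = "\<lambda>(ts, g). ?G (ts ! 0) (ts ! 1) g"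
  have lin: "linear_mod M (\<lambda>c. ?G c d g)" "linear_mod M (\<lambda>d. ?G c d g)" for c d g
    by (intro linear_mod_lmul linear_mod_associator bounded_below_associator)+
  have bil: "fsum_apply ?F x \<approx>\<^bsub>M\<^esub> fsum_apply ?F y" if "tensor_eq1 2 M x y" for x y
    by (rule tensor_eq_bilinear[OF that, where G = ?G])
      (intro lin lmul_add_left lmul_const_mult bounded_below_associator)+
  show "linear_mod M (\<lambda>b. associator_S M v a b p q)"
    unfolding linear_mod_def
  proof (intro conjI allI)
    fix b b'
    show "associator_S M v a (b + b') p q \<approx>\<^bsub>M\<^esub> associator_S M v a b p q + associator_S M v a b' p q"
      using bil[OF S_add_right] by (simp add: associator_S_def fsum_apply_add)
  next
    fix r b
    have "associator_S M v a (r *s b) p q \<approx>\<^bsub>M\<^esub> fsum_apply ?F (on_slot 0 (scale r) (rep (S v b) M))"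
      unfolding associator_S_def by (rule bil[OF S_scale_right])
    also have "\<dots> = fsum_apply (\<lambda>(ts, g). ?F (ts[0 := r *s (ts ! 0)], g)) (rep (S v b) M)"
      by (simp add: on_slot_def fsum_apply_extend case_prod_unfold)
    also have "\<dots> \<approx>\<^bsub>M\<^esub> fsum_apply (\<lambda>(ts, g). r *s ?G (ts ! 0) (ts ! 1) g) (rep (S v b) M)"
    proof (rule fsum_apply_cong_split)
      fix ts g assume "(ts, g) \<in> Poly_Mapping.keys (rep (S v b) M)"
      then obtain c d where "ts = [c, d]"
        using rep_S_length length_2_cases by metis
      then show "?F (ts[0 := r *s (ts ! 0)], g) \<approx>\<^bsub>M\<^esub> r *s ?G (ts ! 0) (ts ! 1) g"
        using linear_mod_scale[OF lin(1)] by simp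
    qed
    also have "\<dots> = r *s associator_S M v a b p q"
      by (simp add: associator_S_def fsum_apply_scale case_prod_unfold)
    finally show "associator_S M v a (r *s b) p q \<approx>\<^bsub>M\<^esub> r *s associator_S M v a b p q" .
  qed
qed

end


section \<open>Associativity\<close>

context quantum_VOA
begin

text \<open>
  \<open>Y(w) S(w)\<close> applied to \<open>Y(u)(v1 \<otimes> v2) \<otimes> v3\<close>, computed by skew symmetry on one side and by the
  hexagon axiom (QA4) on the other.
\<close>

lemma hexagon_and_skew_symmetry:
  "fsum_apply (\<lambda>(us, f). tmul M f
      (\<lambda>p q. fsum_apply (\<lambda>(ts, g). lmul M g (iterY (us ! 0) (ts ! 0) (ts ! 1) p) q) (rep (S v2 (us ! 1)) M)) n q)
      (rep (S v1 v3) M)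
    \<approx>\<^bsub>M\<^esub> expT M (\<lambda>m. alt m (Y v3 (Y v1 v2 n) m)) q"
proof -
  let ?X = "act S fls_const M 1 2 (act S (fls_taylor 1) M 0 2 (frag_of ([v1, v2, v3], 1)))"
  let ?\<Phi> = "\<lambda>(vs, f). lmul M f (Y (vs ! 0) (vs ! 1)) q"
  \<comment> \<open>\<open>Y(w) (Y(u) \<otimes> 1)\<close>, coefficient of \<open>u^n w^q\<close>, on pure tensors; the sum is the one in \<^const>\<open>Y_tensor_one\<close>.\<close>
  let ?H = "\<lambda>(vs, c :: 'a fls fls). \<Sum>p | fls_nth c (n - p) \<noteq> 0 \<and> \<not> hdvd M (Y (vs ! 0) (vs ! 1) p).
      lmul M (fls_nth c (n - p)) (Y (Y (vs ! 0) (vs ! 1) p) (vs ! 2)) q"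
  have fin: "finite {p. fls_nth c (n - p) \<noteq> 0 \<and> \<not> hdvd M (Y a b p)}" for c :: "'a fls fls" and a b
  proof -
    obtain p0 where p0: "\<And>p. p < p0 \<Longrightarrow> hdvd M (Y a b p)"
      using bounded_below_Y unfolding bounded_below_def by blast
    show ?thesis
      by (rule finite_subset[of _ "{p0..n - fls_subdegree c}"]) (use p0 in \<open>force simp: not_less[symmetric]\<close>)+
  qed
  \<comment> \<open>On the tensors that occur, \<open>c = f(w + u) g(w)\<close>, so that \<open>f\<close> and \<open>g\<close> can be applied one after the other.\<close>
  have H: "?H ([a, c, d], (1 * fls_taylor 1 f) * fls_const g) \<approx>\<^bsub>M\<^esub> tmul M f (\<lambda>p. lmul M g (iterY a c d p)) n q"
    for a c d f g
  proof -
    let ?c = "(1 * fls_taylor 1 f) * fls_const g :: 'a fls fls"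
    let ?b = "\<lambda>p. lmul M (fls_nth ?c (n - p)) (iterY a c d p) q"
    have bb: "bounded_below M (iterY a c d p)" for p
      using iterated_laurent_iterY unfolding iterated_laurent_def by blast
    have "?H ([a, c, d], ?c) = (\<Sum>p | fls_nth ?c (n - p) \<noteq> 0 \<and> \<not> hdvd M (Y a c p). ?b p)"
      by (simp add: iterY_def[abs_def])
    also have "\<dots> \<approx>\<^bsub>M\<^esub> sum_mod M ?b"
    proof (rule hcong_sym, rule sum_mod_finite[OF fin])
      fix p assume "p \<notin> {p. fls_nth ?c (n - p) \<noteq> 0 \<and> \<not> hdvd M (Y a c p)}"
      then consider "fls_nth ?c (n - p) = 0" | "hdvd M (Y a c p)"
        by blast
      then show "hdvd M (?b p)"
      proof cases
        case 1
        show ?thesis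
          by (simp only: 1 lmul_zero_left hdvd_0)
      next
        case 2
        then show ?thesis
          by (intro hdvd_lmul) (auto simp: iterY_def intro: hdvd_hom[OF Y_linear_left])
      qed
    qed
    also have "\<dots> = sum_mod M (\<lambda>m::nat. ?b (n - int m))"
    proof (rule sum_mod_reindex[symmetric])
      fix p assume "p \<notin> range (\<lambda>m. n - int m)"
      moreover have "p = n - int (nat (n - p))" if "\<not> n - p < 0"
        using that by simp
      ultimately have "n - p < 0"
        by blast
      then have "fls_nth ?c (n - p) = 0"
        by (simp add: fls_taylor_nth)
      then show "hdvd M (?b p)"
        by (simp only: lmul_zero_left hdvd_0)
    qed (simp add: inj_def)
    also have "\<dots> \<approx>\<^bsub>M\<^esub> sum_mod M (\<lambda>m::nat. sum_mod M (\<lambda>i.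
        ((of_int (i + int m) gchoose m) * fls_nth f (i + int m)) *k lmul M g (iterY a c d (n - int m)) (q - i)))"
    proof (rule sum_mod_cong)
      fix m
      let ?t = "fls_nth (fls_taylor 1 f) (int m)"
      have "?b (n - int m) = lmul M (?t * g) (iterY a c d (n - int m)) q"
        by simp
      also have "\<dots> \<approx>\<^bsub>M\<^esub> lmul M ?t (lmul M g (iterY a c d (n - int m))) q"
        by (rule lmul_mult[OF bb])
      also have "\<dots> = sum_mod M (\<lambda>i.
          ((of_int (i + int m) gchoose m) * fls_nth f (i + int m)) *k lmul M g (iterY a c d (n - int m)) (q - i))"
        by (simp add: lmul_def[of M ?t] fls_taylor_nth_nth)
      finally show "?b (n - int m) \<approx>\<^bsub>M\<^esub> sum_mod M (\<lambda>i.
          ((of_int (i + int m) gchoose m) * fls_nth f (i + int m)) *k lmul M g (iterY a c d (n - int m)) (q - i))" .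
    qed
    also have "\<dots> \<approx>\<^bsub>M\<^esub> tmul M f (\<lambda>p. lmul M g (iterY a c d p)) n q"
      by (rule hcong_sym, rule tmul_expand(3), rule iterated_laurent_lmul[OF iterated_laurent_iterY])
    finally show ?thesis .
  qed
  have "fsum_apply (\<lambda>(us, f). tmul M f
      (\<lambda>p q. fsum_apply (\<lambda>(ts, g). lmul M g (iterY (us ! 0) (ts ! 0) (ts ! 1) p) q) (rep (S v2 (us ! 1)) M)) n q)
      (rep (S v1 v3) M) \<approx>\<^bsub>M\<^esub>
    fsum_apply (\<lambda>(us, f). fsum_apply (\<lambda>(ts, g).
      ?H ([us ! 0, ts ! 0, ts ! 1], (1 * fls_taylor 1 f) * fls_const g)) (rep (S v2 (us ! 1)) M)) (rep (S v1 v3) M)"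
  proof (rule fsum_apply_cong_split)
    fix us :: "'b list" and f :: "'a fls"
    let ?x = "rep (S v2 (us ! 1)) M"
    have "tmul M f (\<lambda>p q. fsum_apply (\<lambda>t. lmul M (snd t) (iterY (us ! 0) (fst t ! 0) (fst t ! 1) p) q) ?x) n q \<approx>\<^bsub>M\<^esub>
        fsum_apply (\<lambda>t. tmul M f (\<lambda>p. lmul M (snd t) (iterY (us ! 0) (fst t ! 0) (fst t ! 1) p)) n q) ?x"
      by (rule tmul_fsum_apply, rule iterated_laurent_lmul[OF iterated_laurent_iterY])
    also have "\<dots> \<approx>\<^bsub>M\<^esub> fsum_apply (\<lambda>t. ?H ([us ! 0, fst t ! 0, fst t ! 1], (1 * fls_taylor 1 f) * fls_const (snd t))) ?x"
      by (rule fsum_apply_cong, rule hcong_sym[OF H])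
    finally show "tmul M f (\<lambda>p q. fsum_apply (\<lambda>(ts, g). lmul M g (iterY (us ! 0) (ts ! 0) (ts ! 1) p) q) ?x) n q \<approx>\<^bsub>M\<^esub>
        fsum_apply (\<lambda>(ts, g). ?H ([us ! 0, ts ! 0, ts ! 1], (1 * fls_taylor 1 f) * fls_const g)) ?x"
      unfolding case_prod_unfold .
  qed
  also have "\<dots> = fsum_apply ?H ?X"
    unfolding act_def by (simp add: fsum_apply_extend case_prod_unfold del: mult_1_left)
  also have "\<dots> = fsum_apply ?\<Phi> (Y_tensor_one M n ?X)"
    unfolding Y_tensor_one_def
    by (simp add: fsum_apply_extend case_prod_unfold fsum_apply_sum fin)
  also have "\<dots> \<approx>\<^bsub>M\<^esub> fsum_apply ?\<Phi> (rep (S (Y v1 v2 n) v3) M)"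
  proof (rule hcong_sym, rule tensor_eq_bilinear[OF QA4, where G = "\<lambda>a b f. lmul M f (Y a b) q"])
    show "linear_mod M (\<lambda>a. lmul M f (Y a b) q)" for b f
      by (intro linear_mod_lmul linear_mod_hom Y_linear_left bounded_below_Y)
    show "linear_mod M (\<lambda>b. lmul M f (Y a b) q)" for a f
      by (intro linear_mod_lmul linear_mod_hom Y_linear_right bounded_below_Y)
  qed (intro lmul_add_left lmul_const_mult bounded_below_Y)+
  also have "\<dots> \<approx>\<^bsub>M\<^esub> expT M (\<lambda>m. alt m (Y v3 (Y v1 v2 n) m)) q"
    by (rule skew_symmetry)
  finally show ?thesis .
qed

text \<open>
  Braided commutativity for \<open>v1, v3\<close> with \<open>z1 = u\<close>, \<open>z2 = -w\<close> connects the two computations: its side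
  without \<open>S\<close> becomes, under \<open>e^(wT)\<close>, the right-hand side of \<open>hexagon_and_skew_symmetry\<close>, and
  its side with \<open>S\<close> becomes the left-hand side of \<open>expT_Y_Y\<close>.
\<close>

lemma associativity_on_image_of_S13:
  "\<exists>N0. \<forall>N\<ge>N0. \<forall>p q. hdvd M
    (fsum_apply (\<lambda>(us, f). pmul M N f (associator_S M v2 (us ! 0) (us ! 1)) p q) (rep (S v1 v3) M))"
proof -
  let ?x = "rep (S v1 v3) M"
  let ?P = "\<lambda>a b p q. fsum_apply (\<lambda>(ts, g). lmul M g (prodY M a (ts ! 0) (ts ! 1) p) q) (rep (S v2 b) M)"
  let ?B = "\<lambda>a b p q. fsum_apply (\<lambda>(ts, g). lmul M g (iterY a (ts ! 0) (ts ! 1) p) q) (rep (S v2 b) M)"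
  let ?L = "\<lambda>a b p q. alt q (Y a (Y b v2 q) p)"
  let ?R = "\<lambda>p q. alt q (Y v3 (Y v1 v2 p) q)"
  have P: "quadrant_finite M (?P a b)" for a b
    unfolding case_prod_unfold by (intro quadrant_finite_fsum_apply quadrant_finite_lmul quadrant_finite_prodY)
  have B: "iterated_laurent M (?B a b)" for a b
    unfolding case_prod_unfold
    by (intro iterated_laurent_fsum_apply iterated_laurent_lmul iterated_laurent_iterY)
  have L: "quadrant_finite M (?L a b)" for a b
    using quadrant_finite_flip[OF iterated_laurent_quadrant_finite[OF iterated_laurent_alt[OF iterated_laurent_Y_Y]]] .
  have R: "quadrant_finite M ?R"
  proof -
    have "quadrant_finite M (\<lambda>p q. Y v3 (Y v1 v2 p) q)"
      by (rule iterated_laurent_quadrant_finite[OF iterated_laurent_Y_Y])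
    then show ?thesis
      by (simp add: quadrant_finite_def)
  qed
  have associator_S: "associator_S M v2 a b p q \<approx>\<^bsub>M\<^esub> ?P a b p q - ?B a b p q" for a b p q
    unfolding associator_S_def fsum_apply_diff_fun[symmetric] case_prod_unfold associator_def[abs_def]
    by (rule fsum_apply_cong, rule lmul_diff)
      (rule quadrant_finite_row[OF quadrant_finite_prodY], rule quadrant_finite_row[OF quadrant_finite_iterY])
  obtain N0 where N0: "\<And>N. N \<ge> N0 \<Longrightarrow>
    (\<forall>(us, f) \<in> Poly_Mapping.keys ?x. \<forall>i < - int N. fls_nth f i = 0) \<and>
    (\<forall>u p q. (theta ^^ N) (\<lambda>p q. alt q (Y v3 (Y v1 u p) q)) p q \<approx>\<^bsub>M\<^esub>
      fsum_apply (\<lambda>(us, f). pmul M N f (\<lambda>p q. alt q (Y (us ! 0) (Y (us ! 1) u q) p)) p q) ?x)"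
    using braided_commutativity by blast
  show ?thesis
  proof (intro exI[of _ N0] allI impI)
    fix N p q assume "N \<ge> N0"
    note N = N0[OF this]
    have "fsum_apply (\<lambda>(us, f). pmul M N f (?B (us ! 0) (us ! 1)) p q) ?x \<approx>\<^bsub>M\<^esub>
        fsum_apply (\<lambda>(us, f). (theta ^^ N) (tmul M f (?B (us ! 0) (us ! 1))) p q) ?x"
    proof (rule fsum_apply_cong_split, rule hcong_sym, rule theta_pow_tmul[OF B])
      fix us f i assume "(us, f) \<in> Poly_Mapping.keys ?x" "i < - int N"
      then show "fls_nth f i = 0"
        using N by blast
    qed
    also have "\<dots> = (theta ^^ N) (\<lambda>p q. fsum_apply (\<lambda>(us, f). tmul M f (?B (us ! 0) (us ! 1)) p q) ?x) p q"
      by (simp add: theta_pow_fsum_apply case_prod_unfold)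
    also have "\<dots> \<approx>\<^bsub>M\<^esub> (theta ^^ N) (\<lambda>p. expT M (?R p)) p q"
      by (rule theta_pow_cong, rule hexagon_and_skew_symmetry)
    also have "\<dots> \<approx>\<^bsub>M\<^esub> expT M ((theta ^^ N) ?R p) q"
      by (rule theta_pow_expT[OF R])
    also have "\<dots> \<approx>\<^bsub>M\<^esub> expT M (\<lambda>q. fsum_apply (\<lambda>(us, f). pmul M N f (?L (us ! 0) (us ! 1)) p q) ?x) q"
      by (rule expT_cong) (use N in blast)
    also have "\<dots> \<approx>\<^bsub>M\<^esub> fsum_apply (\<lambda>(us, f). expT M (pmul M N f (?L (us ! 0) (us ! 1)) p) q) ?x"
      unfolding case_prod_unfold
    proof (rule expT_fsum_apply)
      fix t
      show "bounded_below M (pmul M N (snd t) (?L (fst t ! 0) (fst t ! 1)) p)"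
        by (rule quadrant_finite_row[OF quadrant_finite_pmul[OF L]])
    qed
    also have "\<dots> \<approx>\<^bsub>M\<^esub> fsum_apply (\<lambda>(us, f). pmul M N f (?P (us ! 0) (us ! 1)) p q) ?x"
    proof (rule fsum_apply_cong_split)
      fix us f
      have "expT M (pmul M N f (?L (us ! 0) (us ! 1)) p) q \<approx>\<^bsub>M\<^esub>
          pmul M N f (\<lambda>p. expT M (?L (us ! 0) (us ! 1) p)) p q"
        by (rule expT_pmul[OF L])
      also have "\<dots> \<approx>\<^bsub>M\<^esub> pmul M N f (?P (us ! 0) (us ! 1)) p q"
        by (rule pmul_cong, rule expT_Y_Y)
      finally show "expT M (pmul M N f (?L (us ! 0) (us ! 1)) p) q \<approx>\<^bsub>M\<^esub> pmul M N f (?P (us ! 0) (us ! 1)) p q" .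
    qed
    finally have BP: "fsum_apply (\<lambda>(us, f). pmul M N f (?B (us ! 0) (us ! 1)) p q) ?x \<approx>\<^bsub>M\<^esub>
      fsum_apply (\<lambda>(us, f). pmul M N f (?P (us ! 0) (us ! 1)) p q) ?x" .
    have "fsum_apply (\<lambda>(us, f). pmul M N f (associator_S M v2 (us ! 0) (us ! 1)) p q) ?x \<approx>\<^bsub>M\<^esub>
        fsum_apply (\<lambda>(us, f). pmul M N f (?P (us ! 0) (us ! 1)) p q - pmul M N f (?B (us ! 0) (us ! 1)) p q) ?x"
      by (rule fsum_apply_cong_split, rule hcong_trans[OF pmul_cong[OF associator_S]],
          rule pmul_diff[OF P iterated_laurent_quadrant_finite[OF B]])
    also have "\<dots> = fsum_apply (\<lambda>(us, f). pmul M N f (?P (us ! 0) (us ! 1)) p q) ?x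
        - fsum_apply (\<lambda>(us, f). pmul M N f (?B (us ! 0) (us ! 1)) p q) ?x"
      by (simp add: fsum_apply_diff_fun case_prod_unfold)
    also have "\<dots> \<approx>\<^bsub>M\<^esub> 0"
      using hcong_sym[OF BP] by (simp add: hcong_def)
    finally show "hdvd M (fsum_apply (\<lambda>(us, f). pmul M N f (associator_S M v2 (us ! 0) (us ! 1)) p q) ?x)"
      by simp
  qed
qed

text \<open>
  Cancelling \<open>S13(u+w)\<close>, whose coefficients act through \<^const>\<open>pmul\<close>.
\<close>

lemma associativity_on_image_of_S23:
  "\<exists>N0. \<forall>N\<ge>N0. \<forall>p q. hdvd M ((theta ^^ N) (associator_S M v2 v1 v3) p q)"
proof -
  let ?E = "associator_S M v2"
  have one: "pmul M N 1 (?E a b) p q \<approx>\<^bsub>M\<^esub> (theta ^^ N) (?E a b) p q" for N a b p q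
    by (rule pmul_one)
  have "\<exists>N0. \<forall>N\<ge>N0. \<forall>p q. hdvd M (pmul M N 1 (?E v1 v3) p q)"
  proof (rule vanishes_if_vanishes_on_S[where \<Lambda> = "\<lambda>N a b f. pmul M N f (?E a b)"])
    \<comment> \<open>For \<open>N\<close> beyond the pole of \<open>f\<close>, the factor \<open>(u + w)^N0\<close> splits off from \<open>(x^N f)(u + w)\<close>.\<close>
    fix m a b f
    assume m: "m \<le> M" and "\<exists>N0. \<forall>N\<ge>N0. \<forall>p q. hdvd m (pmul M N 1 (?E a b) p q)"
    then obtain N0 where "\<forall>p q. hdvd m (pmul M N0 1 (?E a b) p q)"
      by blast
    moreover have "pmul M N0 1 (?E a b) p q \<approx>\<^bsub>m\<^esub> (theta ^^ N0) (?E a b) p q" for p q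
      using hdvd_mono[OF m] one unfolding hcong_def by blast
    ultimately have N0: "hdvd m ((theta ^^ N0) (?E a b) p q)" for p q
      using hcong_hdvd by blast
    show "\<exists>N0. \<forall>N\<ge>N0. \<forall>p q. hdvd m (pmul M N f (?E a b) p q)"
    proof (intro exI allI impI)
      fix N p q assume N: "N \<ge> nat (- fls_subdegree f) + N0"
      have "hdvd m (pmul M (N - N0) f ((theta ^^ N0) (?E a b)) p q)"
        by (rule hdvd_pmul[OF m N0])
      moreover have "pmul M (N - N0 + N0) f (?E a b) p q = pmul M (N - N0) f ((theta ^^ N0) (?E a b)) p q"
        by (rule pmul_shift) (use N in auto)
      ultimately show "hdvd m (pmul M N f (?E a b) p q)"
        using N by simp
    qed
  qed (intro linear_mod_pmul linear_mod_associator_S pmul_add_left pmul_const_mult quadrant_finite_associator_S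
      associativity_on_image_of_S13)+
  then show ?thesis
    using hcong_hdvd[OF one] by blast
qed

text \<open>
  Cancelling \<open>S23(w)\<close>, whose coefficients are series in \<open>w\<close> alone and act on both products through
  \<^const>\<open>lmul\<close>.
\<close>

lemma associativity_mod:
  "\<exists>N. \<forall>p q. (theta ^^ N) (prodY M a c d) p q \<approx>\<^bsub>M\<^esub> (theta ^^ N) (iterY a c d) p q"
proof -
  let ?D = "associator M a"
  have bb: "bounded_below M ((theta ^^ N) (?D c d) p)" for N c d p
    by (intro quadrant_finite_row quadrant_finite_theta_pow quadrant_finite_associator)
  have one: "lmul M 1 ((theta ^^ N) (?D c d) p) q \<approx>\<^bsub>M\<^esub> (theta ^^ N) (?D c d) p q" for N c d p q
    by (rule lmul_one)
  have "\<exists>N0. \<forall>N\<ge>N0. \<forall>p q. hdvd M (lmul M 1 ((theta ^^ N) (?D c d) p) q)"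
  proof (rule vanishes_if_vanishes_on_S[where \<Lambda> = "\<lambda>N c d g p q. lmul M g ((theta ^^ N) (?D c d) p) q"])
    fix m c d g
    assume m: "m \<le> M" and "\<exists>N0. \<forall>N\<ge>N0. \<forall>p q. hdvd m (lmul M 1 ((theta ^^ N) (?D c d) p) q)"
    then obtain N0 where N0: "\<forall>N\<ge>N0. \<forall>p q. hdvd m (lmul M 1 ((theta ^^ N) (?D c d) p) q)"
      by blast
    have "lmul M 1 ((theta ^^ N) (?D c d) p) q \<approx>\<^bsub>m\<^esub> (theta ^^ N) (?D c d) p q" for N p q
      using hdvd_mono[OF m] one unfolding hcong_def by blast
    then have "hdvd m ((theta ^^ N) (?D c d) p q)" if "N \<ge> N0" for N p q
      using N0 that hcong_hdvd by blast
    then show "\<exists>N0. \<forall>N\<ge>N0. \<forall>p q. hdvd m (lmul M g ((theta ^^ N) (?D c d) p) q)"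
      by (intro exI[of _ N0] allI impI hdvd_lmul[OF m])
  next
    fix c d
    obtain N0 where N0: "\<forall>N\<ge>N0. \<forall>p q. hdvd M ((theta ^^ N) (associator_S M c a d) p q)"
      using associativity_on_image_of_S23 by blast
    have "(theta ^^ N) (associator_S M c a d) p q \<approx>\<^bsub>M\<^esub>
        fsum_apply (\<lambda>(vs, g). lmul M g ((theta ^^ N) (?D (vs ! 0) (vs ! 1)) p) q) (rep (S c d) M)" for N p q
      unfolding associator_S_def[abs_def] theta_pow_fsum_apply case_prod_unfold
      by (rule fsum_apply_cong, rule theta_pow_lmul[OF quadrant_finite_associator])
    from hcong_hdvd[OF this] N0 show "\<exists>N0. \<forall>N\<ge>N0. \<forall>p q. hdvd M
        (fsum_apply (\<lambda>(vs, g). lmul M g ((theta ^^ N) (?D (vs ! 0) (vs ! 1)) p) q) (rep (S c d) M))"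
      by blast
  qed (intro linear_mod_lmul linear_mod_theta_pow linear_mod_associator lmul_add_left lmul_const_mult bb)+
  then obtain N where N: "\<forall>p q. hdvd M (lmul M 1 ((theta ^^ N) (?D c d) p) q)"
    by blast
  then have "hdvd M ((theta ^^ N) (?D c d) p q)" for p q
    using hcong_hdvd[OF one] by blast
  then show ?thesis
    by (intro exI[of _ N] allI) (simp add: hcong_def associator_def[abs_def] theta_pow_diff)
qed

lemma has_residue_product: "has_residue n (\<lambda>p q. Y v (Y w u q) p) (Y (Y v w (- n - 1)) u)"
proof -
  have "has_residue n (\<lambda>p q. Y v (Y w u q) p) (iterY v w u (- n - 1))"
    using associativity_mod unfolding prodY_def
    by (intro has_residue_if_associative iterated_laurent_Y_Y iterated_laurent_iterY)
  then show ?thesis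
    by (simp add: iterY_def[abs_def])
qed

end

theorem corollary1p5:
  fixes scale :: "'k::field_char_0 fps \<Rightarrow> 'v::ab_group_add \<Rightarrow> 'v"
    and Y :: "'v \<Rightarrow> 'v \<Rightarrow> int \<Rightarrow> 'v"
    and T :: "'v \<Rightarrow> 'v"
    and \<Omega> :: 'v
    and S :: "'v \<Rightarrow> 'v \<Rightarrow> nat \<Rightarrow> ('v, 'k fls) fsum set"
    and v w :: 'v
    and n :: int
  assumes "quantum_VOA scale Y T \<Omega> S"
  shows "\<exists>!y. \<forall>u. topologically_free.has_residue scale n (\<lambda>p q. Y v (Y w u q) p) (Y y u)"
proof -
  interpret quantum_VOA scale Y T \<Omega> S
    by (rule assms)
  show ?thesis
  proof (rule ex1I)
    show "\<forall>u. has_residue n (\<lambda>p q. Y v (Y w u q) p) (Y (Y v w (- n - 1)) u)"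
      using has_residue_product by blast
    fix y assume "\<forall>u. has_residue n (\<lambda>p q. Y v (Y w u q) p) (Y y u)"
    then have "Y y \<Omega> 0 = Y (Y v w (- n - 1)) \<Omega> 0"
      using has_residue_unique has_residue_product by blast
    then show "y = Y v w (- n - 1)"
      by (simp only: QA3_value)
  qed
qed

end
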